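(* Let $k\ge 0$. For all $\alpha\in[-1,1]$ there exists $C_\alpha>0$ so that for $\delta\in\{0,1\}$ $$|\mathcal{I}^\alpha_k(f)-\mathcal{I}^\alpha_{k,N}(f)|\le C_\alpha (1+k)^{-\delta}N^{\delta-r}\|f_c\|_{H^r_\#}$$ for all $r\ge 1$ and $k\ge 0$ (and all $f$ with $f_c\in H^r_\#$). Furthermore, for all $\varepsilon>0$ there exists $C_\varepsilon>0$ such that, if $\alpha=\pm1$, or if $\alpha=0$ and $N$ is even, it holds $$|\mathcal{I}^{\alpha}_k(f)-\mathcal{I}^{\alpha}_{k,N}(f)|\le C_\varepsilon(1+k)^{-2}(1+\alpha^2\log k)\,N^{7/2+\varepsilon-r}\|f_c\|_{H^{r}_\#}$$ for all $f$ with $f_c\in H_\#^r$, where $r>7/2+\varepsilon$.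
   Context: Throughout, $k\ge0$ is real and $N\ge1$ is an integer. For a function $f:[-1,1]\to\mathbb{C}$ put $f_c(\theta):=f(\cos\theta)$, an even $2\pi$-periodic function on $\mathbb{R}$. For real $r\ge 0$, $H^r_\#$ is the Sobolev space of $2\pi$-periodic functions $\varphi$ on $\mathbb{R}$ lying locally in $H^r$, with norm $$\|\varphi\|^2_{H^r_\#}:=|\widehat{\varphi}(0)|^2+\sum_{n\ne 0}|n|^{2r}|\widehat{\varphi}(n)|^2,\qquad \widehat{\varphi}(n):=\frac{1}{2\pi}\int_{-\pi}^{\pi}\varphi(\theta)e^{-in\theta}\,d\theta .$$ $\mathcal{Q}_Nf$ is the polynomial of degree at most $N$ with $(\mathcal{Q}_Nf)(\cos(n\pi/N))=f(\cos(n\pi/N))$ for $n=0,\ldots,N$. For $\alpha\in[-1,1]$ and $k\ge0$, $$\mathcal{I}^\alpha_k(f):=\int_{-1}^1 f(x)\log((x-\alpha)^2)e^{ikx}\,dx,\qquad \mathcal{I}^\alpha_{k,N}(f):=\int_{-1}^1(\mathcal{Q}_Nf)(x)\log((x-\alpha)^2)e^{ikx}\,dx .$$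
   Formalization: In the second bound log k is replaced by its positive part max(0, log k), since for α=±1 the factor 1+log k is negative for 0<k<1/e and undefined at k=0, where the literal inequality fails; nothing changes for k≥1 or α=0. *)

theory Defs
  imports "HOL-Analysis.Analysis" "HOL-Computational_Algebra.Polynomial"
begin

definition cos_lift :: "(real \<Rightarrow> complex) \<Rightarrow> real \<Rightarrow> complex"
  where "cos_lift f \<theta> = f (cos \<theta>)"

definition fourier_coeff :: "(real \<Rightarrow> complex) \<Rightarrow> int \<Rightarrow> complex"
  where "fourier_coeff \<phi> n =
    1 / (2 * of_real pi) *
      (LINT \<theta>:{-pi..pi}|lebesgue. \<phi> \<theta> * exp (- \<i> * of_int n * of_real \<theta>))"

text \<open>
  The periodic Sobolev space of order \<open>r \<ge> 0\<close>: locally square integrable \<open>2\<pi>\<close>-periodic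
  functions whose Fourier coefficients make the Sobolev norm finite. As with all
  Lebesgue-type spaces, members are actual functions, and two of them that agree almost everywhere
  represent the same element; point values are meaningful only for the continuous
  representative, which exists when \<open>r > 1/2\<close>.
\<close>
definition per_sobolev :: "real \<Rightarrow> (real \<Rightarrow> complex) set"
  where "per_sobolev r =
    {\<phi>. (\<forall>\<theta>. \<phi> (\<theta> + 2 * pi) = \<phi> \<theta>) \<and>
        \<phi> \<in> borel_measurable lebesgue \<and>
        set_integrable lebesgue {-pi..pi} (\<lambda>\<theta>. (cmod (\<phi> \<theta>))\<^sup>2) \<and>
        (\<lambda>n::int. \<bar>real_of_int n\<bar> powr (2 * r) * (cmod (fourier_coeff \<phi> n))\<^sup>2)
          summable_on {n. n \<noteq> 0}}"

definition per_sobolev_norm :: "real \<Rightarrow> (real \<Rightarrow> complex) \<Rightarrow> real"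
  where "per_sobolev_norm r \<phi> =
    sqrt ((cmod (fourier_coeff \<phi> 0))\<^sup>2 +
      (\<Sum>\<^sub>\<infinity>n\<in>{n::int. n \<noteq> 0}.
         \<bar>real_of_int n\<bar> powr (2 * r) * (cmod (fourier_coeff \<phi> n))\<^sup>2))"

definition cheb_node :: "nat \<Rightarrow> nat \<Rightarrow> real"
  where "cheb_node N n = cos (real n * pi / real N)"

definition is_cheb_interpolant :: "nat \<Rightarrow> (real \<Rightarrow> complex) \<Rightarrow> complex poly \<Rightarrow> bool"
  where "is_cheb_interpolant N f p \<longleftrightarrow>
    degree p \<le> N \<and> (\<forall>n\<le>N. poly p (of_real (cheb_node N n)) = f (cheb_node N n))"

definition cheb_interpolant :: "nat \<Rightarrow> (real \<Rightarrow> complex) \<Rightarrow> complex poly"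
  where "cheb_interpolant N f = (THE p. is_cheb_interpolant N f p)"

lemma inj_on_cheb_node:
  assumes "N \<ge> 1"
  shows "inj_on (cheb_node N) {..N}"
proof (rule inj_onI)
  fix m n assume "m \<in> {..N}" "n \<in> {..N}" and eq: "cheb_node N m = cheb_node N n"
  then have le: "real m * pi / real N \<le> pi" "real n * pi / real N \<le> pi"
    using assms by (auto simp: field_simps)
  have ge: "0 \<le> real m * pi / real N" "0 \<le> real n * pi / real N"
    by simp_all
  have "real m * pi / real N = real n * pi / real N"
    by (rule cos_inj_pi[OF ge(1) le(1) ge(2) le(2) eq[unfolded cheb_node_def]])
  then have "real m = real n"
    using assms by (simp only: divide_cancel_right mult_cancel_right) auto
  then show "m = n"
    by simp
qed

lemma ex1_cheb_interpolant:
  assumes "N \<ge> 1"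
  shows "\<exists>!p. is_cheb_interpolant N f p"
proof -
  define x :: "nat \<Rightarrow> complex" where "x n = of_real (cheb_node N n)" for n
  define L where "L n = (\<Prod>m\<in>{..N} - {n}. [:- x m, 1:])" for n
  define p where "p = (\<Sum>n\<le>N. smult (f (cheb_node N n) / poly (L n) (x n)) (L n))"
  have inj: "inj_on x {..N}"
    using inj_on_cheb_node[OF assms] by (auto simp: inj_on_def x_def)
  have nz: "poly (L n) (x n) \<noteq> 0" if "n \<le> N" for n
  proof -
    have "x n - x m \<noteq> 0" if "m \<in> {..N} - {n}" for m
      using inj_onD[OF inj, of n m] that \<open>n \<le> N\<close> by auto
    then show ?thesis
      unfolding L_def poly_prod by (subst prod_zero_iff) auto
  qed
  have z: "poly (L n) (x m) = 0" if "m \<le> N" "m \<noteq> n" for m n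
    unfolding L_def poly_prod using that by (intro prod_zero bexI[of _ m]) auto
  have "degree (L n) \<le> N" if "n \<le> N" for n
  proof -
    have "degree (L n) \<le> sum (degree \<circ> (\<lambda>m. [:- x m, 1:])) ({..N} - {n})"
      unfolding L_def by (rule degree_prod_sum_le) auto
    also have "\<dots> = N" using that by simp
    finally show ?thesis .
  qed
  then have "degree p \<le> N"
    unfolding p_def by (intro degree_sum_le) (auto intro: order.trans[OF degree_smult_le])
  moreover have "poly p (x n) = f (cheb_node N n)" if "n \<le> N" for n
  proof -
    have "poly p (x n) = (\<Sum>m\<le>N. if m = n then f (cheb_node N n) else 0)"
      unfolding p_def poly_sum using that nz z by (intro sum.cong) auto
    then show ?thesis using that by simp
  qed
  ultimately have ex: "is_cheb_interpolant N f p"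
    by (auto simp: is_cheb_interpolant_def x_def)
  moreover have "q = p" if "is_cheb_interpolant N f q" for q
  proof (rule ccontr)
    assume "q \<noteq> p"
    then have ne: "q - p \<noteq> 0" by simp
    have "x ` {..N} \<subseteq> {z. poly (q - p) z = 0}"
      using that ex by (auto simp: is_cheb_interpolant_def x_def)
    then have "card (x ` {..N}) \<le> card {z. poly (q - p) z = 0}"
      using ne by (intro card_mono poly_roots_finite)
    also have "\<dots> \<le> degree (q - p)"
      by (rule card_poly_roots_bound[OF ne])
    also have "\<dots> \<le> N"
      using that ex by (auto simp: is_cheb_interpolant_def intro: degree_diff_le)
    finally show False using inj by (simp add: card_image)
  qed
  ultimately show ?thesis by blast
qed

text \<open>At \<open>x = \<alpha>\<close> the integrand takes the junk value \<open>ln 0 = 0\<close>, on a null set only.\<close>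
definition log_osc_integral :: "real \<Rightarrow> real \<Rightarrow> (real \<Rightarrow> complex) \<Rightarrow> complex"
  where "log_osc_integral \<alpha> k f =
    (LINT x:{-1..1}|lebesgue.
       f x * of_real (ln ((x - \<alpha>)\<^sup>2)) * exp (\<i> * of_real k * of_real x))"

definition log_osc_rule :: "real \<Rightarrow> real \<Rightarrow> nat \<Rightarrow> (real \<Rightarrow> complex) \<Rightarrow> complex"
  where "log_osc_rule \<alpha> k N f =
    log_osc_integral \<alpha> k (\<lambda>x. poly (cheb_interpolant N f) (of_real x))"

text \<open>
  The functions \<open>f\<close> whose lift is in the Sobolev space of order \<open>r\<close>. Interpolation
  uses point values of \<open>f\<close>, so for \<open>r > 1/2\<close> the element \<open>cos_lift f\<close> has to be identified with its
  continuous representative: changing \<open>f\<close> at a single node alters the interpolant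
  but no integral. Continuity of \<open>f\<close> on \<open>[-1,1]\<close> is equivalent to continuity of \<open>cos_lift f\<close>.
\<close>
definition lift_in_sobolev :: "real \<Rightarrow> (real \<Rightarrow> complex) \<Rightarrow> bool"
  where "lift_in_sobolev r f \<longleftrightarrow> continuous_on {-1..1} f \<and> cos_lift f \<in> per_sobolev r"

text \<open>
  The factor \<open>1 + \<alpha>\<^sup>2 log k\<close> is read with the positive part of the logarithm. This is the
  literal factor whenever \<open>k \<ge> 1\<close> or \<open>\<alpha> = 0\<close>; for \<open>\<alpha> = \<plusminus>1\<close> and \<open>k < 1/e\<close> the literal
  expression is negative (or undefined, at \<open>k = 0\<close>), so it cannot occur in an upper bound.
\<close>
definition log_plus :: "real \<Rightarrow> real"
  where "log_plus k = max 0 (ln k)"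

end

theory Submission
  imports Defs
begin

text \<open>
  Put \<open>\<alpha> = cos s\<close> and \<open>x = cos t\<close>. The quadrature error is a bounded linear functional of a
  continuous \<open>f\<close>, and \<open>f (cos t)\<close> has an absolutely convergent cosine series (\<open>cosine_series_sums\<close>),
  so the error is the sum of the cosine coefficients times the errors \<open>e\<^sub>n\<close> for the Chebyshev
  polynomials. At the nodes \<open>cos (n t)\<close> coincides with \<open>cos (m t)\<close>, where \<open>m \<le> N\<close> is congruent to
  \<open>n\<close> or \<open>-n\<close> modulo \<open>2N\<close>. Hence \<open>e\<^sub>n = 0\<close> for \<open>n \<le> N\<close>, and otherwise
  \<open>e\<^sub>n = \<integral> (cos (n t) - cos (m t)) log ((cos t - cos s)\<^sup>2) e\<^bsup>i k cos t\<^esup> sin t dt\<close> over \<open>[0, \<pi>]\<close>.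
  By Cauchy--Schwarz the error is at most \<open>2 N\<^bsup>-r\<^esup>\<close> times the Sobolev norm times the square root of
  \<open>\<Sum>\<^bsub>n>N\<^esub> (N/n)\<^bsup>2r\<^esup> \<bar>e\<^sub>n\<bar>\<^sup>2\<close> (\<open>rule_error_bound_from_chebyshev\<close>). As \<open>N/n < 1\<close>, this sum decreases in \<open>r\<close>;
  bounding it at the smallest order in question gives constants that do not depend on \<open>r\<close>.

  For \<open>\<delta> = 0\<close> that order is 1. Here \<open>e\<^sub>n\<close> is a difference of two cosine coefficients of one
  function whose modulus is square integrable and independent of \<open>k\<close>, so Bessel's inequality
  applies. It also controls the aliased coefficients: a block of \<open>2N\<close> consecutive \<open>n\<close> meets each
  \<open>m\<close> at most twice, and the weights \<open>(N/n)\<^sup>2\<close> of the blocks form a convergent series (\<open>alias_sum_le\<close>).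

  For \<open>\<delta> = 1\<close> split \<open>cos (n t) - cos (m t)\<close> into its value at \<open>s\<close> and the increment from it. The
  value multiplies the integral of the kernel alone, which is \<open>O(1/k)\<close> for \<open>\<bar>\<alpha>\<bar> < 1\<close>
  (\<open>log_moment_decay_interior\<close>), and it vanishes for \<open>\<alpha> = \<plusminus>1\<close> because \<open>\<plusminus>1\<close> are nodes. The increment
  cancels the singularity, and one integration by parts against \<open>e\<^bsup>i k cos t\<^esup> sin t\<close> gains the
  factor \<open>1/k\<close>. It leaves \<open>n\<close> and \<open>m\<close> times sine coefficients of the kernel, again square summable,
  and a difference quotient whose contribution is only \<open>O(n\<^bsup>1/4\<^esup>)\<close>.

  For the last estimate \<open>\<alpha>\<close> is itself a node, so \<open>cos (n t) - cos (m t)\<close> vanishes at \<open>0\<close>, \<open>\<pi>\<close> and \<open>s\<close>.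
  One integration by parts then has no boundary terms, and what is left can be divided by \<open>sin t\<close>
  and integrated by parts again. This gives \<open>\<bar>e\<^sub>n\<bar> \<le> C n\<^sup>3 k\<^bsup>-2\<^esup> (1 + \<alpha>\<^sup>2 log k)\<close>
  (\<open>chebyshev_error_second_order\<close>), where the logarithm is that of the integral of the kernel with an
  end-point singularity, and \<open>\<Sum> n\<^bsup>-7-2\<epsilon>\<^esup> n\<^sup>6\<close> converges.
\<close>

section \<open>The denominator \<open>cos t - cos s\<close>\<close>
text \<open>
  Jordan's inequality, from the concavity of the sine.
\<close>
lemma sin_ge_linear:
  assumes "0 \<le> x" "x \<le> pi / 2"
  shows "2 / pi * x \<le> sin x"
proof -
  have "concave_on {0..pi/2} sin"
    by (rule f''_le0_imp_concave[where f' = cos and f'' = "\<lambda>x. - sin x"])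
       (auto intro!: derivative_eq_intros sin_ge_zero)
  then have conv: "convex_on {0..pi/2} (\<lambda>x. - sin x)"
    by (simp add: concave_on_def)
  define t where "t = 2 / pi * x"
  have t: "0 \<le> t" "t \<le> 1" using assms by (auto simp: t_def field_simps)
  have "- sin ((1 - t) *\<^sub>R 0 + t *\<^sub>R (pi/2)) \<le> (1 - t) * (- sin 0) + t * (- sin (pi/2))"
    using convex_onD[OF conv, of t 0 "pi/2"] t by simp
  moreover have "(1 - t) *\<^sub>R 0 + t *\<^sub>R (pi/2) = x" by (simp add: t_def)
  ultimately show ?thesis by (simp add: t_def)
qed

lemma cos_diff_factor:
  fixes t s :: real
  shows "\<bar>cos t - cos s\<bar> = 2 * \<bar>sin ((t + s) / 2)\<bar> * \<bar>sin (\<bar>t - s\<bar> / 2)\<bar>"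
proof -
  have "cos t - cos s = 2 * sin ((t + s) / 2) * sin ((s - t) / 2)"
    by (rule cos_diff_cos)
  moreover have "\<bar>sin ((s - t) / 2)\<bar> = \<bar>sin (\<bar>t - s\<bar> / 2)\<bar>"
  proof (cases "t \<le> s")
    case False
    then have "(s - t) / 2 = - (\<bar>t - s\<bar> / 2)" by (simp add: field_simps)
    then show ?thesis by (simp only: sin_minus abs_minus_cancel)
  qed (simp add: abs_minus_commute)
  ultimately show ?thesis by (simp add: abs_mult)
qed

lemma sin_half_sum_ge:
  assumes "t \<in> {0..pi}" "s \<in> {0..pi}"
  shows "\<bar>t - s\<bar> / pi \<le> sin ((t + s) / 2)"
proof (cases "(t + s) / 2 \<le> pi / 2")
  case True
  have "\<bar>t - s\<bar> \<le> t + s" using assms by auto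
  then have "\<bar>t - s\<bar> / pi \<le> 2 / pi * ((t + s) / 2)"
    by (simp add: field_simps)
  also have "\<dots> \<le> sin ((t + s) / 2)"
    using True assms by (intro sin_ge_linear) auto
  finally show ?thesis .
next
  case False
  have "\<bar>t - s\<bar> \<le> 2 * pi - (t + s)" using assms by auto
  then have "\<bar>t - s\<bar> / pi \<le> 2 / pi * (pi - (t + s) / 2)"
    by (simp add: field_simps)
  also have "\<dots> \<le> sin (pi - (t + s) / 2)"
    using False assms by (intro sin_ge_linear) auto
  finally show ?thesis by simp
qed

lemma sin_half_diff_ge:
  assumes "t \<in> {0..pi}" "s \<in> {0..pi}"
  shows "\<bar>t - s\<bar> / pi \<le> sin (\<bar>t - s\<bar> / 2)"
  using sin_ge_linear[of "\<bar>t - s\<bar> / 2"] assms by (auto simp: field_simps)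

text \<open>
  The bound is uniform in \<open>s\<close>. At \<open>s = 0\<close> and \<open>s = \<pi>\<close> the difference really vanishes to second order.
\<close>
lemma cos_diff_ge_square:
  assumes "t \<in> {0..pi}" "s \<in> {0..pi}"
  shows "2 / pi\<^sup>2 * (t - s)\<^sup>2 \<le> \<bar>cos t - cos s\<bar>"
proof -
  have "\<bar>t - s\<bar> / pi * (\<bar>t - s\<bar> / pi) \<le> sin ((t + s) / 2) * sin (\<bar>t - s\<bar> / 2)"
    using sin_half_sum_ge[OF assms] sin_half_diff_ge[OF assms]
    by (intro mult_mono order.trans[OF _ sin_half_sum_ge[OF assms]]) auto
  also have "\<dots> \<le> \<bar>sin ((t + s) / 2)\<bar> * \<bar>sin (\<bar>t - s\<bar> / 2)\<bar>"
    by (metis abs_ge_self abs_mult)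
  also have "\<bar>t - s\<bar> / pi * (\<bar>t - s\<bar> / pi) = (t - s)\<^sup>2 / pi\<^sup>2"
    by (simp add: power2_eq_square)
  finally have "2 * ((t - s)\<^sup>2 / pi\<^sup>2)
      \<le> 2 * (\<bar>sin ((t + s) / 2)\<bar> * \<bar>sin (\<bar>t - s\<bar> / 2)\<bar>)" by (intro mult_left_mono) auto
  then show ?thesis
    unfolding cos_diff_factor by (simp only: times_divide_eq_left times_divide_eq_right mult.assoc)
qed

lemma sin_le_two_sin_half_sum:
  assumes "t \<in> {0..pi}" "s \<in> {0..pi}"
  shows "sin t \<le> 2 * sin ((t + s) / 2)"
proof -
  have "sin t \<le> sin t + sin s" using assms sin_ge_zero by simp
  also have "\<dots> = 2 * sin ((t + s) / 2) * cos ((t - s) / 2)" by (rule sin_plus_sin)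
  also have "\<dots> \<le> 2 * sin ((t + s) / 2) * 1"
    using assms by (intro mult_left_mono) (auto intro!: sin_ge_zero)
  finally show ?thesis by simp
qed

text \<open>
  Together with \<open>sin t\<close> the denominator \<open>cos t - cos s\<close> is only a first-order pole, even at an end
  point: the Jacobian supplies the factor that the double zero of the cosine takes away.
\<close>
lemma dist_sin_le_cos_diff:
  assumes "t \<in> {0..pi}" "s \<in> {0..pi}"
  shows "\<bar>t - s\<bar> * sin t \<le> pi * \<bar>cos t - cos s\<bar>"
proof -
  have "\<bar>t - s\<bar> * sin t \<le> (pi * sin (\<bar>t - s\<bar> / 2)) * (2 * sin ((t + s) / 2))"
    using sin_half_diff_ge[OF assms] sin_le_two_sin_half_sum[OF assms] assms
    by (intro mult_mono mult_nonneg_nonneg) (auto simp: field_simps intro!: sin_ge_zero)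
  also have "\<dots> \<le> pi * (2 * \<bar>sin ((t + s) / 2)\<bar> * \<bar>sin (\<bar>t - s\<bar> / 2)\<bar>)"
    using abs_ge_self[of "sin ((t + s) / 2) * sin (\<bar>t - s\<bar> / 2)"]
    by (simp add: abs_mult mult_ac)
  finally show ?thesis unfolding cos_diff_factor .
qed

lemma cos_diff_nonzero:
  assumes "t \<in> {0..pi}" "s \<in> {0..pi}" "t \<noteq> s"
  shows "cos t - cos s \<noteq> 0"
  using cos_inj_pi[of t s] assms by auto

lemma dist_sin_over_cos_diff_le:
  assumes "t \<in> {0..pi}" "s \<in> {0..pi}"
  shows "\<bar>t - s\<bar> * sin t / \<bar>cos t - cos s\<bar> \<le> pi"
  using dist_sin_le_cos_diff[OF assms] by (cases "cos t = cos s") (auto simp: field_simps)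

definition log_kernel :: "real \<Rightarrow> real \<Rightarrow> real"
  where "log_kernel s t = ln ((cos t - cos s)\<^sup>2)"

lemma log_kernel_self [simp]: "log_kernel s s = 0"
  by (simp add: log_kernel_def)

text \<open>
  The exponent \<open>1/4\<close> is below \<open>1/2\<close>, so that the kernel is square integrable, and below 1, so that
  a Lipschitz factor vanishing at \<open>s\<close> removes the singularity. At \<open>t = s\<close> both sides are 0, by the
  conventions for \<open>ln 0\<close> and \<open>0 powr _\<close>.
\<close>
lemma abs_log_kernel_le:
  assumes "t \<in> {0..pi}" "s \<in> {0..pi}"
  shows "\<bar>log_kernel s t\<bar> \<le> 32 * \<bar>t - s\<bar> powr (- (1/4))"
proof (cases "t = s")
  case False
  define d where "d = \<bar>cos t - cos s\<bar>"
  have d: "d > 0" using cos_diff_nonzero[OF assms False] by (simp add: d_def)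
  have d2: "d \<le> 2"
    unfolding d_def using cos_le_one[of t] cos_ge_minus_one[of t] cos_le_one[of s] cos_ge_minus_one[of s]
    by linarith
  have eq: "log_kernel s t = 2 * ln d"
    using d using ln_realpow[of d 2] by (simp add: log_kernel_def d_def)
  define u where "u = \<bar>t - s\<bar>"
  have u: "u > 0" "u \<le> pi" using False assms by (auto simp: u_def)
  have low: "2 / pi\<^sup>2 * u\<^sup>2 \<le> d" using cos_diff_ge_square[OF assms] by (simp add: u_def d_def)
  \<comment> \<open>For \<open>d \<le> 1\<close>, \<open>ln z \<le> z - 1\<close> at \<open>z = d powr (-1/8)\<close> gives \<open>-2 ln d \<le> 16 d powr (-1/8)\<close>;
    the exponent is halved because \<open>d\<close> is of the size of \<open>u\<^sup>2\<close>.\<close>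
  have "16 * d powr (- (1/8)) \<le> 32 * u powr (- (1/4))"
  proof -
    have "d powr (- (1/8)) \<le> (2 / pi\<^sup>2 * u\<^sup>2) powr (- (1/8))"
      using low u by (intro powr_mono2') auto
    also have "\<dots> = (2 / pi\<^sup>2) powr (- (1/8)) * u powr (- (1/4))"
    proof -
      have "(2 / pi\<^sup>2 * u\<^sup>2) powr (- (1/8)) = (2 / pi\<^sup>2) powr (- (1/8)) * (u powr 2) powr (- (1/8))"
        using u by (subst powr_mult) auto
      then show ?thesis by (simp add: powr_powr)
    qed
    also have "(2 / pi\<^sup>2) powr (- (1/8)) \<le> (2 powr (- 8)) powr (- (1/8))"
    proof (intro powr_mono2')
      have "pi\<^sup>2 \<le> 4\<^sup>2" using pi_less_4 by (intro power_mono) auto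
      then show "2 powr (- 8) \<le> 2 / pi\<^sup>2" by (simp add: powr_minus field_simps)
    qed auto
    also have "\<dots> = 2" by (simp add: powr_powr)
    finally show ?thesis using u by simp
  qed
  moreover have "\<bar>2 * ln d\<bar> \<le> max (16 * d powr (- (1/8))) 2"
  proof (cases "d \<le> 1")
    case True
    have "ln (d powr (- (1/8))) \<le> d powr (- (1/8)) - 1"
      using d by (intro ln_le_minus_one) auto
    then show ?thesis using True d by (auto simp: ln_powr)
  next
    case False
    then show ?thesis using ln_le_minus_one[of d] d d2 by auto
  qed
  moreover have "2 \<le> 32 * u powr (- (1/4))"
  proof -
    have "4 powr (- (1/4)) \<le> u powr (- (1/4))"
      using u pi_less_4 by (intro powr_mono2') auto
    moreover have "(4::real) powr (-1) \<le> 4 powr (- (1/4))" by (intro powr_mono) auto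
    ultimately show ?thesis by (simp add: powr_minus)
  qed
  ultimately show ?thesis unfolding eq u_def[symmetric] by linarith
qed simp

lemma dist_powr_absolutely_integrable:
  assumes "0 \<le> a" "a < 1" and s: "s \<in> {0..pi}"
  shows "(\<lambda>t. \<bar>t - s\<bar> powr (- a)) absolutely_integrable_on {0..pi}"
proof -
  define F where "F t = sgn (t - s) * \<bar>t - s\<bar> powr (1 - a) / (1 - a)" for t
  have cont: "continuous_on {0..pi} F"
  proof -
    have *: "F = (\<lambda>t. if t \<le> s then - ((s - t) powr (1 - a) / (1 - a)) else (t - s) powr (1 - a) / (1 - a))"
      by (auto simp: F_def fun_eq_iff sgn_if)
    have "continuous_on ({0..s} \<union> {s..pi}) F"
      unfolding * using assms
      by (intro continuous_on_If continuous_on_minus continuous_on_divide continuous_on_powr'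
            continuous_intros) auto
    moreover have "{0..s} \<union> {s..pi} = {0..pi}" using s by auto
    ultimately show ?thesis by simp
  qed
  have "((\<lambda>t. \<bar>t - s\<bar> powr (- a)) has_integral (F pi - F 0)) {0..pi}"
  proof (rule fundamental_theorem_of_calculus_interior_strong[where S = "{s}"])
    fix t assume t: "t \<in> {0<..<pi} - {s}"
    show "(F has_vector_derivative \<bar>t - s\<bar> powr - a) (at t)"
    proof (cases "t < s")
      case True
      have "((\<lambda>t. - ((s - t) powr (1 - a) / (1 - a))) has_real_derivative (s - t) powr (- a)) (at t)"
        using True assms by (auto intro!: derivative_eq_intros)
      then have "(F has_real_derivative (s - t) powr (- a)) (at t)"
        by (rule has_field_derivative_transform_within_open[where S = "{..<s}"]) (use True in \<open>auto simp: F_def sgn_if\<close>)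
      then show ?thesis using True by (simp add: has_real_derivative_iff_has_vector_derivative)
    next
      case False
      then have "s < t" using t by auto
      have "((\<lambda>t. (t - s) powr (1 - a) / (1 - a)) has_real_derivative (t - s) powr (- a)) (at t)"
        using \<open>s < t\<close> assms by (auto intro!: derivative_eq_intros)
      then have "(F has_real_derivative (t - s) powr (- a)) (at t)"
        by (rule has_field_derivative_transform_within_open[where S = "{s<..}"]) (use \<open>s < t\<close> in \<open>auto simp: F_def sgn_if\<close>)
      then show ?thesis using \<open>s < t\<close> by (simp add: has_real_derivative_iff_has_vector_derivative)
    qed
  qed (use cont in auto)
  then show ?thesis
    by (intro nonnegative_absolutely_integrable_1) auto
qed

section \<open>Integration by parts against the oscillating factor\<close>
lemma absolutely_integrable_mult_continuous:
  fixes f :: "real \<Rightarrow> complex" and g :: "real \<Rightarrow> real"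
  assumes "g absolutely_integrable_on {a..b}" "continuous_on {a..b} f"
  shows "(\<lambda>t. of_real (g t) * f t) absolutely_integrable_on {a..b}"
proof -
  have "(\<lambda>t. f t * of_real (g t)) absolutely_integrable_on {a..b}"
  proof (rule absolutely_integrable_bounded_measurable_product[where h = "(*)"])
    show "bilinear ((*) :: complex \<Rightarrow> complex \<Rightarrow> complex)"
      by (rule bilinear_times)
    show "f \<in> borel_measurable (lebesgue_on {a..b})"
      using assms(2) by (intro continuous_imp_measurable_on_sets_lebesgue) auto
    show "bounded (f ` {a..b})"
      using assms(2) by (intro compact_imp_bounded compact_continuous_image) auto
    show "(\<lambda>t. complex_of_real (g t)) absolutely_integrable_on {a..b}"
      using absolutely_integrable_linear[OF assms(1), of complex_of_real] bounded_linear_of_real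
      by (simp add: o_def)
  qed auto
  then show ?thesis by (simp add: mult.commute)
qed

lemma absolutely_integrable_mult_continuous_real:
  fixes f :: "real \<Rightarrow> real" and g :: "real \<Rightarrow> real"
  assumes "g absolutely_integrable_on {a..b}" "continuous_on {a..b} f"
  shows "(\<lambda>t. f t * g t) absolutely_integrable_on {a..b}"
  using assms
  by (intro absolutely_integrable_bounded_measurable_product_real)
     (auto intro!: continuous_imp_measurable_on_sets_lebesgue compact_imp_bounded compact_continuous_image)

lemma absolutely_integrable_of_powr_bound:
  fixes f :: "real \<Rightarrow> real"
  assumes "f \<in> borel_measurable borel" "0 \<le> a" "a < 1" "s \<in> {0..pi}"
    and "\<And>t. t \<in> {0..pi} \<Longrightarrow> \<bar>f t\<bar> \<le> C * \<bar>t - s\<bar> powr (- a)"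
  shows "f absolutely_integrable_on {0..pi}"
proof (rule measurable_bounded_by_integrable_imp_absolutely_integrable)
  show "f \<in> borel_measurable (lebesgue_on {0..pi})"
    using assms(1) by (simp add: measurable_completion measurable_restrict_space1)
  show "(\<lambda>t. C * \<bar>t - s\<bar> powr (- a)) integrable_on {0..pi}"
    using dist_powr_absolutely_integrable[OF assms(2-4)]
    by (intro integrable_on_mult_right) (auto simp: absolutely_integrable_on_def)
qed (use assms in auto)

lemma measurable_log_kernel [measurable]: "log_kernel s \<in> borel_measurable borel"
  unfolding log_kernel_def[abs_def] by measurable

lemma log_kernel_absolutely_integrable:
  assumes "s \<in> {0..pi}"
  shows "log_kernel s absolutely_integrable_on {0..pi}"
  using assms by (intro absolutely_integrable_of_powr_bound[of _ "1/4" s 32])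
    (auto simp: abs_log_kernel_le)

lemma log_kernel_square_absolutely_integrable:
  assumes "s \<in> {0..pi}"
  shows "(\<lambda>t. (log_kernel s t)\<^sup>2) absolutely_integrable_on {0..pi}"
proof (rule absolutely_integrable_of_powr_bound[of _ "1/2" s "32\<^sup>2"])
  fix t assume t: "t \<in> {0..pi}"
  have "\<bar>log_kernel s t\<bar>\<^sup>2 \<le> (32 * \<bar>t - s\<bar> powr (- (1/4)))\<^sup>2"
    using abs_log_kernel_le[OF t assms] by (intro power_mono) auto
  also have "\<dots> = 32\<^sup>2 * \<bar>t - s\<bar> powr (- (1/2))"
    by (simp add: power_mult_distrib power2_eq_square powr_add[symmetric])
  finally show "\<bar>(log_kernel s t)\<^sup>2\<bar> \<le> 32\<^sup>2 * \<bar>t - s\<bar> powr (- (1/2))" by simp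
qed (use assms in auto)

definition osc :: "real \<Rightarrow> real \<Rightarrow> complex"
  where "osc k t = cis (k * cos t)"

lemma norm_osc [simp]: "cmod (osc k t) = 1"
  by (simp add: osc_def)

lemma continuous_osc [continuous_intros]: "continuous_on S (osc k)"
  unfolding osc_def[abs_def] cis_conv_exp by (intro continuous_intros)

lemma osc_absolutely_integrable:
  assumes "g absolutely_integrable_on {0..pi}"
  shows "(\<lambda>t. of_real (g t) * osc k t) absolutely_integrable_on {0..pi}"
  by (intro absolutely_integrable_mult_continuous assms continuous_intros)

abbreviation osc_integral :: "real \<Rightarrow> (real \<Rightarrow> real) \<Rightarrow> complex"
  where "osc_integral k g \<equiv> integral {0..pi} (\<lambda>t. of_real (g t) * osc k t)"

lemma norm_osc_integral_le:
  assumes "g absolutely_integrable_on {0..pi}"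
  shows "cmod (osc_integral k g) \<le> integral {0..pi} (\<lambda>t. \<bar>g t\<bar>)"
  using assms osc_absolutely_integrable[OF assms]
  by (intro integral_norm_bound_integral)
     (auto simp: norm_mult absolutely_integrable_on_def)

text \<open>
  \<open>sin t * osc k t\<close> is, up to the factor \<open>\<i> * k\<close>, the derivative of \<open>osc k\<close>; the exceptional
  set \<open>S\<close> admits functions that are continuous but not differentiable at the singularity.
\<close>
lemma osc_integration_by_parts:
  fixes G g :: "real \<Rightarrow> real"
  assumes "finite S" and cont: "continuous_on {0..pi} G"
    and der: "\<And>t. t \<in> {0<..<pi} - S \<Longrightarrow> (G has_real_derivative g t) (at t)"
    and g: "g absolutely_integrable_on {0..pi}"
  shows "\<i> * of_real k * osc_integral k (\<lambda>t. G t * sin t) =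
    of_real (G 0) * cis k - of_real (G pi) * cis (- k) + osc_integral k g"
proof -
  define A where "A t = of_real (g t) * osc k t" for t
  define B where "B t = of_real (G t * sin t) * osc k t" for t
  have "((\<lambda>t. A t - \<i> * of_real k * B t) has_integral
      (of_real (G pi) * osc k pi - of_real (G 0) * osc k 0)) {0..pi}"
  proof (rule fundamental_theorem_of_calculus_interior_strong[OF \<open>finite S\<close>])
    fix t assume t: "t \<in> {0<..<pi} - S"
    have 1: "((\<lambda>t. complex_of_real (G t)) has_vector_derivative of_real (g t)) (at t)"
      using der[OF t] by (intro has_vector_derivative_of_real)
    have 2: "(osc k has_vector_derivative (- \<i> * of_real (k * sin t)) * osc k t) (at t)"
    proof -
      have "((\<lambda>z. exp (\<i> * (of_real k * cos z))) has_field_derivative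
          - (\<i> * (of_real k * sin (of_real t)) * exp (\<i> * (of_real k * cos (of_real t))))) (at (of_real t))"
        by (auto intro!: derivative_eq_intros)
      from has_vector_derivative_real_field[OF this]
      show ?thesis by (simp add: osc_def[abs_def] cis_conv_exp flip: cos_of_real sin_of_real)
    qed
    show "((\<lambda>t. of_real (G t) * osc k t) has_vector_derivative A t - \<i> * of_real k * B t) (at t)"
      by (rule has_vector_derivative_eq_rhs[OF has_vector_derivative_mult[OF 1 2]])
         (simp add: A_def B_def algebra_simps)
  qed (use cont in \<open>auto intro!: continuous_intros\<close>)
  then have "integral {0..pi} (\<lambda>t. A t - \<i> * of_real k * B t) =
      of_real (G pi) * osc k pi - of_real (G 0) * osc k 0"
    by (rule integral_unique)
  moreover have "A integrable_on {0..pi}"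
    using osc_absolutely_integrable[OF g] unfolding A_def by (simp add: absolutely_integrable_on_def)
  moreover have B: "B integrable_on {0..pi}"
    unfolding B_def by (intro integrable_continuous_real continuous_intros cont)
  moreover have "(\<lambda>t. \<i> * of_real k * B t) integrable_on {0..pi}"
    using B by (rule integrable_on_mult_right)
  ultimately have "integral {0..pi} A - integral {0..pi} (\<lambda>t. \<i> * of_real k * B t) =
      of_real (G pi) * osc k pi - of_real (G 0) * osc k 0"
    by (subst integral_diff[symmetric]) auto
  then have "integral {0..pi} A - \<i> * of_real k * integral {0..pi} B =
      of_real (G pi) * osc k pi - of_real (G 0) * osc k 0"
    by simp
  then show ?thesis unfolding A_def B_def by (simp add: osc_def algebra_simps)
qed

lemma norm_osc_integral_by_parts:
  fixes G g :: "real \<Rightarrow> real"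
  assumes "finite S" "continuous_on {0..pi} G" "k \<ge> 0"
    and "\<And>t. t \<in> {0<..<pi} - S \<Longrightarrow> (G has_real_derivative g t) (at t)"
    and "g absolutely_integrable_on {0..pi}"
  shows "k * cmod (osc_integral k (\<lambda>t. G t * sin t)) \<le>
    \<bar>G 0\<bar> + \<bar>G pi\<bar> + cmod (osc_integral k g)"
proof -
  have "k * cmod (osc_integral k (\<lambda>t. G t * sin t)) =
    cmod (of_real (G 0) * cis k - of_real (G pi) * cis (- k) + osc_integral k g)"
    using osc_integration_by_parts[OF assms(1,2,4,5), of k, symmetric] assms(3)
    by (simp add: norm_mult)
  also have "\<dots> \<le> cmod (of_real (G 0) * cis k - of_real (G pi) * cis (- k))
      + cmod (osc_integral k g)"
    by (rule norm_triangle_ineq)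
  also have "cmod (of_real (G 0) * cis k - of_real (G pi) * cis (- k)) \<le> \<bar>G 0\<bar> + \<bar>G pi\<bar>"
    by (rule order.trans[OF norm_triangle_ineq4]) (simp add: norm_mult)
  finally show ?thesis by simp
qed

lemma has_derivative_log_kernel:
  assumes "cos t \<noteq> cos s"
  shows "(log_kernel s has_real_derivative - 2 * sin t / (cos t - cos s)) (at t)"
proof -
  have nz: "cos t - cos s \<noteq> 0" using assms by simp
  have "(log_kernel s has_real_derivative
      1 / (cos t - cos s)\<^sup>2 * (2 * (cos t - cos s) * (- sin t))) (at t)"
    unfolding log_kernel_def[abs_def]
  proof (rule DERIV_chain2[where f = ln])
    show "(ln has_real_derivative 1 / (cos t - cos s)\<^sup>2) (at ((cos t - cos s)\<^sup>2))"
      using nz by (intro DERIV_ln_divide) simp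
    show "((\<lambda>t. (cos t - cos s)\<^sup>2) has_real_derivative 2 * (cos t - cos s) * (- sin t)) (at t)"
      by (auto intro!: derivative_eq_intros)
  qed
  moreover have "1 / (cos t - cos s)\<^sup>2 * (2 * (cos t - cos s) * (- sin t)) =
      - 2 * sin t / (cos t - cos s)"
  proof -
    have "1 / d\<^sup>2 * (2 * d * (- y)) = - 2 * y / d" if "d \<noteq> 0" for d y :: real
      using that by (simp add: power2_eq_square field_simps)
    then show ?thesis using nz by blast
  qed
  ultimately show ?thesis by simp
qed

text \<open>
  The derivative of \<open>(B t - B s) * log_kernel s t\<close> when \<open>B'\<close> is that of \<open>B\<close>.
\<close>
definition log_ibp_deriv :: "real \<Rightarrow> (real \<Rightarrow> real) \<Rightarrow> (real \<Rightarrow> real) \<Rightarrow> real \<Rightarrow> real"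
  where "log_ibp_deriv s B B' t =
    B' t * log_kernel s t - 2 * ((B t - B s) * sin t / (cos t - cos s))"

text \<open>
  Multiplying the kernel by the increment of a function with bounded derivative makes it
  continuous and gives it an integrable derivative, with bounds linear in the bound \<open>K\<close>.
\<close>
context
  fixes s K :: real and B B' :: "real \<Rightarrow> real"
  assumes s: "s \<in> {0..pi}"
    and der: "\<And>t. (B has_real_derivative B' t) (at t)"
    and contB': "continuous_on UNIV B'"
    and K: "\<And>t. t \<in> {0..pi} \<Longrightarrow> \<bar>B' t\<bar> \<le> K"
begin

lemma slope_bound_nonneg: "0 \<le> K"
  using K[OF s] by linarith

lemma increment_bound:
  assumes "t \<in> {0..pi}" "u \<in> {0..pi}"
  shows "\<bar>B t - B u\<bar> \<le> K * \<bar>t - u\<bar>"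
proof -
  have "norm (B t - B u) \<le> K * norm (t - u)"
    by (rule field_differentiable_bound[of "{0..pi}" B B'])
       (use assms der K in \<open>auto intro: has_field_derivative_at_within\<close>)
  then show ?thesis by simp
qed

lemma continuous_of_derivative: "continuous_on A B"
  by (meson DERIV_isCont der continuous_at_imp_continuous_on)

lemma measurable_of_derivative: "B \<in> borel_measurable borel" "B' \<in> borel_measurable borel"
  using continuous_of_derivative contB' by (auto intro: borel_measurable_continuous_onI)

lemma abs_increment_times_log_kernel_le:
  assumes "t \<in> {0..pi}"
  shows "\<bar>(B t - B s) * log_kernel s t\<bar> \<le> 32 * K * \<bar>t - s\<bar> powr (3/4)"
proof -
  have "\<bar>(B t - B s) * log_kernel s t\<bar> \<le> (K * \<bar>t - s\<bar>) * (32 * \<bar>t - s\<bar> powr (- (1/4)))"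
    unfolding abs_mult
    using increment_bound[OF assms s] abs_log_kernel_le[OF assms s] slope_bound_nonneg by (intro mult_mono) auto
  also have "(K * \<bar>t - s\<bar>) * (32 * \<bar>t - s\<bar> powr (- (1/4))) = 32 * K * (\<bar>t - s\<bar> * \<bar>t - s\<bar> powr (- (1/4)))"
    by simp
  also have "\<bar>t - s\<bar> * \<bar>t - s\<bar> powr (- (1/4)) = \<bar>t - s\<bar> powr (3/4)"
    by (cases "t = s") (simp_all add: powr_mult_base)
  finally show ?thesis .
qed

lemma abs_increment_times_log_kernel_le_const:
  assumes "t \<in> {0..pi}"
  shows "\<bar>(B t - B s) * log_kernel s t\<bar> \<le> 128 * K"
proof -
  have "\<bar>t - s\<bar> powr (3/4) \<le> 4 powr (3/4)"
    using assms s pi_less_4 by (intro powr_mono2) auto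
  also have "\<dots> \<le> 4 powr 1" by (intro powr_mono) auto
  finally have "32 * K * \<bar>t - s\<bar> powr (3/4) \<le> 32 * K * 4"
    using slope_bound_nonneg by (intro mult_left_mono) auto
  then show ?thesis using abs_increment_times_log_kernel_le[OF assms] by linarith
qed

lemma increment_times_log_kernel_continuous:
  "continuous_on {0..pi} (\<lambda>t. (B t - B s) * log_kernel s t)"
  unfolding continuous_on_eq_continuous_within
proof
  fix t assume t: "t \<in> {0..pi}"
  show "continuous (at t within {0..pi}) (\<lambda>t. (B t - B s) * log_kernel s t)"
  proof (cases "t = s")
    case True
    have "((\<lambda>t. 32 * K * \<bar>t - s\<bar> powr (3/4)) \<longlongrightarrow> 32 * K * \<bar>s - s\<bar> powr (3/4)) (at s within {0..pi})"
      by (intro tendsto_intros tendsto_powr') auto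
    then have "((\<lambda>t. 32 * K * \<bar>t - s\<bar> powr (3/4)) \<longlongrightarrow> 0) (at s within {0..pi})"
      by simp
    moreover have "\<forall>\<^sub>F t in at s within {0..pi}. norm ((B t - B s) * log_kernel s t) \<le> 32 * K * \<bar>t - s\<bar> powr (3/4)"
      using abs_increment_times_log_kernel_le by (auto simp: eventually_at_filter)
    ultimately have "((\<lambda>t. (B t - B s) * log_kernel s t) \<longlongrightarrow> 0) (at s within {0..pi})"
      by (rule Lim_null_comparison[rotated])
    then show ?thesis by (simp add: continuous_within True)
  next
    case False
    then have "isCont (\<lambda>t. (B t - B s) * log_kernel s t) t"
      using cos_diff_nonzero[OF t s] has_derivative_log_kernel[of t s] der
      by (intro continuous_intros) (auto intro: DERIV_isCont)
    then show ?thesis by (rule continuous_at_imp_continuous_at_within)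
  qed
qed

lemma increment_times_log_kernel_derivative:
  assumes "t \<in> {0<..<pi} - {s}"
  shows "((\<lambda>t. (B t - B s) * log_kernel s t) has_real_derivative log_ibp_deriv s B B' t) (at t)"
proof -
  have "cos t \<noteq> cos s" using cos_diff_nonzero[of t s] assms s by auto
  from der[of t] has_derivative_log_kernel[OF this] show ?thesis
    unfolding log_ibp_deriv_def by (auto intro!: derivative_eq_intros)
qed

lemma abs_increment_quotient_le:
  assumes "t \<in> {0..pi}"
  shows "\<bar>(B t - B s) * sin t / (cos t - cos s)\<bar> \<le> K * pi"
proof -
  have "\<bar>(B t - B s) * sin t / (cos t - cos s)\<bar> = \<bar>B t - B s\<bar> * (sin t / \<bar>cos t - cos s\<bar>)"
    using assms by (simp add: abs_mult sin_ge_zero)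
  also have "\<dots> \<le> K * \<bar>t - s\<bar> * (sin t / \<bar>cos t - cos s\<bar>)"
    using assms increment_bound[OF assms s] by (intro mult_right_mono divide_nonneg_nonneg) (auto simp: sin_ge_zero)
  also have "\<dots> = K * (\<bar>t - s\<bar> * sin t / \<bar>cos t - cos s\<bar>)" by simp
  also have "\<dots> \<le> K * pi"
    using dist_sin_over_cos_diff_le[OF assms s] slope_bound_nonneg by (intro mult_left_mono) auto
  finally show ?thesis .
qed

lemma increment_quotient_absolutely_integrable:
  "(\<lambda>t. (B t - B s) * sin t / (cos t - cos s)) absolutely_integrable_on {0..pi}"
proof (rule measurable_bounded_by_integrable_imp_absolutely_integrable[where g = "\<lambda>_. K * pi"])
  note [measurable] = measurable_of_derivative
  have "(\<lambda>t. (B t - B s) * sin t / (cos t - cos s)) \<in> borel_measurable borel" by measurable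
  then show "(\<lambda>t. (B t - B s) * sin t / (cos t - cos s)) \<in> borel_measurable (lebesgue_on {0..pi})"
    by (simp add: measurable_completion measurable_restrict_space1)
qed (use abs_increment_quotient_le in auto)

lemma deriv_times_log_kernel_absolutely_integrable:
  "(\<lambda>t. B' t * log_kernel s t) absolutely_integrable_on {0..pi}"
  by (rule absolutely_integrable_mult_continuous_real)
     (use contB' log_kernel_absolutely_integrable[OF s] continuous_on_subset in auto)

lemma log_ibp_deriv_absolutely_integrable:
  "log_ibp_deriv s B B' absolutely_integrable_on {0..pi}"
  unfolding log_ibp_deriv_def
  using deriv_times_log_kernel_absolutely_integrable increment_quotient_absolutely_integrable
  by (intro set_integral_diff set_integrable_mult_right) auto

lemma integral_abs_log_ibp_deriv_le:
  "integral {0..pi} (\<lambda>t. \<bar>log_ibp_deriv s B B' t\<bar>) \<le>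
     K * (integral {0..pi} (\<lambda>t. \<bar>log_kernel s t\<bar>) + 2 * pi\<^sup>2)"
proof -
  have int: "(\<lambda>t. \<bar>log_kernel s t\<bar>) integrable_on {0..pi}"
    using log_kernel_absolutely_integrable[OF s] by (simp add: absolutely_integrable_on_def)
  have "integral {0..pi} (\<lambda>t. \<bar>log_ibp_deriv s B B' t\<bar>) \<le>
      integral {0..pi} (\<lambda>t. K * \<bar>log_kernel s t\<bar> + 2 * (K * pi))"
  proof (rule integral_le)
    fix t assume t: "t \<in> {0..pi}"
    have "\<bar>B' t * log_kernel s t\<bar> \<le> K * \<bar>log_kernel s t\<bar>"
      using K[OF t] by (simp add: abs_mult mult_right_mono)
    then show "\<bar>log_ibp_deriv s B B' t\<bar> \<le> K * \<bar>log_kernel s t\<bar> + 2 * (K * pi)"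
      using abs_increment_quotient_le[OF t] unfolding log_ibp_deriv_def by linarith
  qed (use log_ibp_deriv_absolutely_integrable int in
        \<open>auto simp: absolutely_integrable_on_def intro!: integrable_add integrable_on_mult_right\<close>)
  also have "\<dots> = K * (integral {0..pi} (\<lambda>t. \<bar>log_kernel s t\<bar>) + 2 * pi\<^sup>2)"
    using int by (subst integral_add) (auto intro!: integrable_on_mult_right simp: power2_eq_square algebra_simps)
  finally show ?thesis .
qed

end

section \<open>The Fourier integral of the logarithm\<close>
lemma absolutely_integrable_bounded_real:
  fixes f :: "real \<Rightarrow> real"
  assumes "f \<in> borel_measurable borel" "\<And>y. y \<in> {a..b} \<Longrightarrow> \<bar>f y\<bar> \<le> K"
  shows "f absolutely_integrable_on {a..b}"
  using assms
  by (intro measurable_bounded_by_integrable_imp_absolutely_integrable[where g = "\<lambda>_. K"])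
     (auto simp: measurable_completion measurable_restrict_space1)

lemma abs_sin_le_abs: "\<bar>sin x\<bar> \<le> \<bar>x\<bar>" for x :: real
  using abs_sin_x_le_abs_x by blast

lemma abs_one_minus_cos_le_abs: "\<bar>1 - cos x\<bar> \<le> \<bar>x\<bar>" for x :: real
proof -
  have "norm (cos x - cos 0) \<le> 1 * norm (x - 0)"
    by (rule field_differentiable_bound[of UNIV cos "\<lambda>x. - sin x"])
       (auto intro!: derivative_eq_intros)
  then show ?thesis by (simp add: abs_minus_commute)
qed

definition sinc_kernel :: "real \<Rightarrow> real \<Rightarrow> real"
  where "sinc_kernel k y = sin (k * y) / y"

definition cosc_kernel :: "real \<Rightarrow> real \<Rightarrow> real"
  where "cosc_kernel k y = (1 - cos (k * y)) / y"

lemma measurable_sinc_kernel: "sinc_kernel k \<in> borel_measurable borel"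
  unfolding sinc_kernel_def[abs_def] by measurable

lemma measurable_cosc_kernel: "cosc_kernel k \<in> borel_measurable borel"
  unfolding cosc_kernel_def[abs_def] by measurable

lemma abs_sinc_kernel_le: "k \<ge> 0 \<Longrightarrow> \<bar>sinc_kernel k y\<bar> \<le> k"
  using abs_sin_le_abs[of "k * y"] by (auto simp: sinc_kernel_def abs_mult divide_simps)

lemma abs_cosc_kernel_le: "k \<ge> 0 \<Longrightarrow> \<bar>cosc_kernel k y\<bar> \<le> k"
  using abs_one_minus_cos_le_abs[of "k * y"] by (auto simp: cosc_kernel_def abs_mult divide_simps)

lemma abs_cosc_kernel_le_inverse:
  assumes "y > 0" shows "\<bar>cosc_kernel k y\<bar> \<le> 2 / y"
proof -
  have "\<bar>1 - cos (k * y)\<bar> \<le> 2" using cos_le_one[of "k*y"] cos_ge_minus_one[of "k*y"] by linarith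
  then show ?thesis using assms by (simp add: cosc_kernel_def divide_right_mono)
qed

lemma sinc_kernel_integrable: "k \<ge> 0 \<Longrightarrow> sinc_kernel k absolutely_integrable_on {a..b}"
  by (rule absolutely_integrable_bounded_real[of _ _ _ k])
     (auto simp: abs_sinc_kernel_le measurable_sinc_kernel)

lemma cosc_kernel_integrable: "k \<ge> 0 \<Longrightarrow> cosc_kernel k absolutely_integrable_on {a..b}"
  by (rule absolutely_integrable_bounded_real[of _ _ _ k])
     (auto simp: abs_cosc_kernel_le measurable_cosc_kernel)

lemmas integrable_of_absolutely = set_lebesgue_integral_eq_integral(1)

lemma abs_integral_le_const:
  fixes f :: "real \<Rightarrow> real"
  assumes "f integrable_on {a..b}" "a \<le> b" "\<And>y. y \<in> {a..b} \<Longrightarrow> \<bar>f y\<bar> \<le> K"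
  shows "\<bar>integral {a..b} f\<bar> \<le> K * (b - a)"
proof -
  have "norm (integral {a..b} f) \<le> integral {a..b} (\<lambda>_. K)"
    using assms by (intro integral_norm_bound_integral) auto
  then show ?thesis using assms(2) by (simp add: mult.commute)
qed

text \<open>
  Away from 0 one integration by parts gives the decaying primitive \<open>-cos (k y) / (k y)\<close>, at most 1 in
  modulus for \<open>k y \<ge> 1\<close>.
\<close>
lemma abs_sinc_integral_tail_le:
  assumes k: "k > 0" and T: "1 / k \<le> T"
  shows "\<bar>integral {1/k..T} (sinc_kernel k)\<bar> \<le> 3"
proof -
  have pos: "y > 0" if "y \<in> {1/k..T}" for y
    using that k by (auto intro: less_le_trans[of 0 "1/k"])
  define G where "G y = - cos (k * y) / (k * y)" for y
  define r where "r y = cos (k * y) / (k * y\<^sup>2)" for y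
  have "((\<lambda>y. sinc_kernel k y + r y) has_integral (G T - G (1/k))) {1/k..T}"
  proof (rule fundamental_theorem_of_calculus[OF T])
    fix y assume y: "y \<in> {1/k..T}"
    have "(G has_real_derivative sinc_kernel k y + r y) (at y within {1/k..T})"
      unfolding G_def sinc_kernel_def r_def using pos[OF y] k
      by (auto intro!: derivative_eq_intros simp: field_simps power2_eq_square)
    then show "(G has_vector_derivative sinc_kernel k y + r y) (at y within {1/k..T})"
      by (simp add: has_real_derivative_iff_has_vector_derivative)
  qed
  then have eq: "integral {1/k..T} (\<lambda>y. sinc_kernel k y + r y) = G T - G (1/k)"
    by (rule integral_unique)
  have bound: "((\<lambda>y. 1 / (k * y\<^sup>2)) has_integral (- 1 / (k * T) - (- 1 / (k * (1/k))))) {1/k..T}"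
  proof (rule fundamental_theorem_of_calculus[OF T])
    fix y assume y: "y \<in> {1/k..T}"
    have "((\<lambda>y. - 1 / (k * y)) has_real_derivative 1 / (k * y\<^sup>2)) (at y within {1/k..T})"
      using pos[OF y] k by (auto intro!: derivative_eq_intros simp: field_simps power2_eq_square)
    then show "((\<lambda>y. - 1 / (k * y)) has_vector_derivative 1 / (k * y\<^sup>2)) (at y within {1/k..T})"
      by (simp add: has_real_derivative_iff_has_vector_derivative)
  qed
  have r: "r integrable_on {1/k..T}"
    unfolding r_def using pos k
    by (intro integrable_continuous_real continuous_intros) fastforce
  have "norm (integral {1/k..T} r) \<le> integral {1/k..T} (\<lambda>y. 1 / (k * y\<^sup>2))"
    using r bound k
    by (intro integral_norm_bound_integral) (auto simp: r_def abs_mult divide_right_mono)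
  also have "\<dots> \<le> 1" using integral_unique[OF bound] k T pos[of T] by simp
  finally have rle: "\<bar>integral {1/k..T} r\<bar> \<le> 1" by simp
  have Gle: "\<bar>G y\<bar> \<le> 1" if "y \<in> {1/k..T}" for y
  proof -
    have "1 \<le> k * y" using that k by (simp add: field_simps)
    then show ?thesis
      using order.trans[OF abs_cos_le_one[of "k * y"], of "k * y"] by (simp add: G_def divide_le_eq)
  qed
  have "integral {1/k..T} (sinc_kernel k) = G T - G (1/k) - integral {1/k..T} r"
    using eq r integrable_of_absolutely[OF sinc_kernel_integrable[of k]] k
    by (subst (asm) integral_add) auto
  then show ?thesis using rle Gle[of T] Gle[of "1/k"] T by auto
qed

text \<open>
  The bound is uniform in \<open>T\<close> and \<open>k\<close>, so the imaginary part of \<open>(cis (k y) - 1) / y\<close> never produces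
  a logarithm.
\<close>
lemma abs_sinc_integral_le:
  assumes k: "k > 0" and T: "T \<ge> 0"
  shows "\<bar>integral {0..T} (sinc_kernel k)\<bar> \<le> 4"
proof -
  note int = integrable_of_absolutely[OF sinc_kernel_integrable[of k]]
  define m where "m = min T (1/k)"
  have m: "0 \<le> m" "m \<le> T" "k * m \<le> 1" using k T by (auto simp: m_def min_def field_simps)
  have "\<bar>integral {0..m} (sinc_kernel k)\<bar> \<le> k * (m - 0)"
    using int k m abs_sinc_kernel_le[of k] by (intro abs_integral_le_const) auto
  then have 1: "\<bar>integral {0..m} (sinc_kernel k)\<bar> \<le> 1" using m by simp
  have 2: "\<bar>integral {m..T} (sinc_kernel k)\<bar> \<le> 3"
    using abs_sinc_integral_tail_le[OF k, of T] by (auto simp: m_def min_def)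
  have "integral {0..T} (sinc_kernel k) = integral {0..m} (sinc_kernel k) + integral {m..T} (sinc_kernel k)"
    using m int k by (intro Henstock_Kurzweil_Integration.integral_combine[symmetric]) auto
  then show ?thesis using 1 2 by linarith
qed

lemma abs_cosc_integral_le_ln:
  assumes "k \<ge> 0" "0 < u" "u \<le> v"
  shows "\<bar>integral {u..v} (cosc_kernel k)\<bar> \<le> 2 * ln (v / u)"
proof -
  have "((\<lambda>y. 2 / y) has_integral (2 * ln v - 2 * ln u)) {u..v}"
  proof (rule fundamental_theorem_of_calculus[OF assms(3)])
    fix y assume "y \<in> {u..v}"
    then have "((\<lambda>y. 2 * ln y) has_real_derivative 2 / y) (at y within {u..v})"
      using assms by (auto intro!: derivative_eq_intros)
    then show "((\<lambda>y. 2 * ln y) has_vector_derivative 2 / y) (at y within {u..v})"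
      by (simp add: has_real_derivative_iff_has_vector_derivative)
  qed
  note b = this
  have "norm (integral {u..v} (cosc_kernel k)) \<le> integral {u..v} (\<lambda>y. 2 / y)"
    using b assms abs_cosc_kernel_le_inverse[of _ k] integrable_of_absolutely[OF cosc_kernel_integrable[of k]]
    by (intro integral_norm_bound_integral) auto
  then show ?thesis using integral_unique[OF b] assms by (simp add: ln_div)
qed

text \<open>
  The real part does produce one: up to \<open>1/k\<close> the integrand is at most \<open>k\<close>, beyond it at most
  \<open>2/y\<close>.
\<close>
lemma abs_cosc_integral_le:
  assumes "k \<ge> 1" "0 \<le> T" "T \<le> 2"
  shows "\<bar>integral {0..T} (cosc_kernel k)\<bar> \<le> 3 * (1 + ln k)"
proof -
  note int = integrable_of_absolutely[OF cosc_kernel_integrable[of k]]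
  define m where "m = min T (1/k)"
  have m: "0 \<le> m" "m \<le> T" "k * m \<le> 1" using assms by (auto simp: m_def min_def field_simps)
  have "\<bar>integral {0..m} (cosc_kernel k)\<bar> \<le> k * (m - 0)"
    using int assms m abs_cosc_kernel_le[of k] by (intro abs_integral_le_const) auto
  then have 1: "\<bar>integral {0..m} (cosc_kernel k)\<bar> \<le> 1" using m by simp
  have 2: "\<bar>integral {m..T} (cosc_kernel k)\<bar> \<le> 2 + 2 * ln k"
  proof (cases "T \<le> 1/k")
    case True
    then show ?thesis using assms by (simp add: m_def)
  next
    case False
    have "\<bar>integral {1/k..T} (cosc_kernel k)\<bar> \<le> 2 * ln (T / (1/k))"
      using assms False by (intro abs_cosc_integral_le_ln) auto
    also have "ln (T / (1/k)) \<le> ln (2 * k)"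
      using assms False m by (subst ln_le_cancel_iff) (auto simp: field_simps intro: order.strict_trans2 mult_pos_pos)
    also have "ln (2 * k) = ln 2 + ln k" using assms by (simp add: ln_mult)
    also have "ln 2 \<le> (1::real)" using ln_le_minus_one[of 2] by simp
    finally show ?thesis using False by (simp add: m_def)
  qed
  have "integral {0..T} (cosc_kernel k) = integral {0..m} (cosc_kernel k) + integral {m..T} (cosc_kernel k)"
    using m int assms by (intro Henstock_Kurzweil_Integration.integral_combine[symmetric]) auto
  moreover have "0 \<le> ln k" using assms by simp
  ultimately show ?thesis using 1 2 by (simp add: algebra_simps)
qed

text \<open>
  Up to a bounded error the integrals over \<open>[0, u]\<close> and \<open>[0, v]\<close> carry the same logarithm of \<open>k\<close>, so it
  drops out of their difference.
\<close>
lemma cosc_integral_difference_le: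
  assumes "k \<ge> 0" "0 < u" "0 < v"
  shows "\<bar>integral {0..u} (cosc_kernel k) - integral {0..v} (cosc_kernel k)\<bar> \<le> 2 * \<bar>ln (v / u)\<bar>"
proof -
  note int = integrable_of_absolutely[OF cosc_kernel_integrable[OF assms(1)]]
  have *: "\<bar>integral {0..u} (cosc_kernel k) - integral {0..v} (cosc_kernel k)\<bar> \<le> 2 * ln (v / u)"
    if "u \<le> v" "0 < u" for u v
  proof -
    have "integral {0..v} (cosc_kernel k) = integral {0..u} (cosc_kernel k) + integral {u..v} (cosc_kernel k)"
      using that int by (intro Henstock_Kurzweil_Integration.integral_combine[symmetric]) auto
    then show ?thesis using abs_cosc_integral_le_ln[OF assms(1) that(2,1)] by simp
  qed
  show ?thesis
  proof (cases "u \<le> v")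
    case True
    then show ?thesis using *[OF True] assms by (auto intro: order.trans)
  next
    case False
    then have "\<bar>integral {0..v} (cosc_kernel k) - integral {0..u} (cosc_kernel k)\<bar> \<le> 2 * ln (u / v)"
      using assms by (intro *) auto
    also have "ln (u / v) = - ln (v / u)" using assms by (simp add: ln_div)
    finally show ?thesis by (simp add: abs_minus_commute)
  qed
qed

definition cis_quotient :: "real \<Rightarrow> real \<Rightarrow> complex"
  where "cis_quotient k y = (cis (k * y) - 1) / of_real y"

lemma cis_quotient_eq: "cis_quotient k y = - of_real (cosc_kernel k y) + \<i> * of_real (sinc_kernel k y)"
  by (simp add: cis_quotient_def cosc_kernel_def sinc_kernel_def complex_eq_iff cis.ctr Re_divide Im_divide
      power2_eq_square minus_divide_left)

text \<open>
  With the singularity inside \<open>[a, b]\<close>, the cosine parts of the two sides enter with opposite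
  signs and the sine parts with equal ones. Everything gained by an interior singularity rests on
  this cancellation.
\<close>
lemma integral_cis_quotient:
  assumes "k \<ge> 0" "a \<le> 0" "0 \<le> b"
  shows "cis_quotient k integrable_on {a..b}"
    and "integral {a..b} (cis_quotient k) =
      of_real (integral {0..-a} (cosc_kernel k) - integral {0..b} (cosc_kernel k)) +
      \<i> * of_real (integral {0..b} (sinc_kernel k) + integral {0..-a} (sinc_kernel k))"
proof -
  note int = integrable_of_absolutely[OF cosc_kernel_integrable[OF assms(1)]]
    integrable_of_absolutely[OF sinc_kernel_integrable[OF assms(1)]]
  have h: "(cis_quotient k has_integral
      (- of_real (integral {a..b} (cosc_kernel k)) + \<i> * of_real (integral {a..b} (sinc_kernel k)))) {a..b}" for a b
    unfolding cis_quotient_eq[abs_def]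
    by (intro has_integral_add has_integral_neg has_integral_mult_right has_integral_of_real
        integrable_integral int)
  show "cis_quotient k integrable_on {a..b}" using h by blast
  have s: "integral {a..b} f = integral {a..0} f + integral {0..b} f"
    if "f integrable_on {a..b}" for f :: "real \<Rightarrow> real"
    using assms that by (intro Henstock_Kurzweil_Integration.integral_combine[symmetric]) auto
  have c: "integral {a..0} (cosc_kernel k) = - integral {0..-a} (cosc_kernel k)"
  proof -
    have "integral {a..0} (cosc_kernel k) = integral {a..- 0} (\<lambda>x. - cosc_kernel k (- x))"
      by (simp add: cosc_kernel_def[abs_def])
    also have "\<dots> = - integral {0..-a} (cosc_kernel k)"
      using Henstock_Kurzweil_Integration.integral_reflect_real[of "-a" 0 "cosc_kernel k"] by (simp del: Henstock_Kurzweil_Integration.integral_reflect_real)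
    finally show ?thesis .
  qed
  have d: "integral {a..0} (sinc_kernel k) = integral {0..-a} (sinc_kernel k)"
  proof -
    have "integral {a..0} (sinc_kernel k) = integral {a..- 0} (\<lambda>x. sinc_kernel k (- x))"
      by (simp add: sinc_kernel_def[abs_def])
    also have "\<dots> = integral {0..-a} (sinc_kernel k)"
      using Henstock_Kurzweil_Integration.integral_reflect_real[of "-a" 0 "sinc_kernel k"] by (simp del: Henstock_Kurzweil_Integration.integral_reflect_real)
    finally show ?thesis .
  qed
  show "integral {a..b} (cis_quotient k) =
      of_real (integral {0..-a} (cosc_kernel k) - integral {0..b} (cosc_kernel k)) +
      \<i> * of_real (integral {0..b} (sinc_kernel k) + integral {0..-a} (sinc_kernel k))"
    using integral_unique[OF h[of a b]] s[OF int(1)] s[OF int(2)] c d by simp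
qed

lemma norm_cis_minus_one_le: "cmod (cis x - 1) \<le> 2 * \<bar>x\<bar>"
proof -
  have "cmod (cis x - 1) \<le> \<bar>Re (cis x - 1)\<bar> + \<bar>Im (cis x - 1)\<bar>" by (rule cmod_le)
  also have "\<dots> \<le> 2 * \<bar>x\<bar>"
    using abs_one_minus_cos_le_abs[of x] abs_sin_le_abs[of x] by (simp add: abs_minus_commute)
  finally show ?thesis .
qed

lemma tendsto_mult_ln_square: "((\<lambda>y::real. \<bar>y\<bar> * \<bar>ln (y\<^sup>2)\<bar>) \<longlongrightarrow> 0) (at 0)"
proof (rule Lim_null_comparison)
  show "\<forall>\<^sub>F y in at 0. norm (\<bar>y\<bar> * \<bar>ln (y\<^sup>2)\<bar>) \<le> 4 * sqrt \<bar>y\<bar>"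
  proof -
    have "norm (\<bar>y\<bar> * \<bar>ln (y\<^sup>2)\<bar>) \<le> 4 * sqrt \<bar>y\<bar>" if y: "\<bar>y\<bar> < 1" "y \<noteq> 0" for y :: real
    proof -
      define u where "u = sqrt \<bar>y\<bar>"
      have u: "u > 0" "\<bar>y\<bar> = u\<^sup>2" "u < 1" using y by (auto simp: u_def real_sqrt_lt_1_iff)
      have "y\<^sup>2 = u ^ 4" using u(2) by (metis power2_abs power4_eq_xxxx power2_eq_square mult.assoc)
      then have "ln (y\<^sup>2) = 4 * ln u" using u by (simp add: ln_realpow)
      moreover have "- ln u \<le> 1 / u"
        using ln_le_minus_one[of "1/u"] u by (simp add: ln_div)
      moreover have "ln u < 0" using u by simp
      ultimately have "\<bar>ln (y\<^sup>2)\<bar> \<le> 4 / u" by simp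
      then have "\<bar>y\<bar> * \<bar>ln (y\<^sup>2)\<bar> \<le> u\<^sup>2 * (4 / u)" unfolding u(2) by (intro mult_left_mono) auto
      also have "\<dots> = 4 * u" using u by (simp add: power2_eq_square)
      finally show ?thesis by (simp add: u_def)
    qed
    then show ?thesis by (auto simp: eventually_at intro!: exI[of _ 1])
  qed
  have "((\<lambda>y::real. 4 * sqrt \<bar>y\<bar>) \<longlongrightarrow> 4 * sqrt \<bar>0\<bar>) (at 0)" by (intro tendsto_intros)
  then show "((\<lambda>y::real. 4 * sqrt \<bar>y\<bar>) \<longlongrightarrow> 0) (at 0)" by simp
qed

text \<open>
  Subtracting 1 from \<open>cis (k y)\<close> in the primitive makes its product with \<open>ln (y\<^sup>2)\<close> continuous at 0.
\<close>
lemma log_moment_by_parts: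
  assumes k: "k > 0" and ab: "a \<le> 0" "0 \<le> b"
  shows "((\<lambda>y. of_real (ln (y\<^sup>2)) * cis (k * y)) has_integral
    ((of_real (ln (b\<^sup>2)) * (cis (k * b) - 1) - of_real (ln (a\<^sup>2)) * (cis (k * a) - 1)
      - 2 * integral {a..b} (cis_quotient k)) / (\<i> * of_real k))) {a..b}"
proof -
  define H where "H y = of_real (ln (y\<^sup>2)) * (cis (k * y) - 1) / (\<i> * of_real k)" for y
  define q where "q y = 2 * cis_quotient k y / (\<i> * of_real k)" for y
  have cont: "continuous_on {a..b} H"
    unfolding continuous_on_eq_continuous_within
  proof
    fix y assume "y \<in> {a..b}"
    have "isCont H y"
    proof (cases "y = 0")
      case True
      have "(H \<longlongrightarrow> 0) (at 0)"
      proof (rule Lim_null_comparison)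
        have "norm (H y) \<le> 2 * (\<bar>y\<bar> * \<bar>ln (y\<^sup>2)\<bar>)" for y
        proof -
          have "norm (H y) = \<bar>ln (y\<^sup>2)\<bar> * cmod (cis (k * y) - 1) / k"
            using k by (simp add: H_def norm_mult norm_divide)
          also have "\<dots> \<le> \<bar>ln (y\<^sup>2)\<bar> * (2 * \<bar>k * y\<bar>) / k"
            using norm_cis_minus_one_le[of "k * y"] k by (intro divide_right_mono mult_left_mono) auto
          also have "\<dots> = 2 * (\<bar>y\<bar> * \<bar>ln (y\<^sup>2)\<bar>)" using k by (simp add: abs_mult)
          finally show ?thesis .
        qed
        then show "\<forall>\<^sub>F y in at 0. norm (H y) \<le> 2 * (\<bar>y\<bar> * \<bar>ln (y\<^sup>2)\<bar>)" by simp
        show "((\<lambda>y::real. 2 * (\<bar>y\<bar> * \<bar>ln (y\<^sup>2)\<bar>)) \<longlongrightarrow> 0) (at 0)"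
          using tendsto_mult_left[OF tendsto_mult_ln_square, of 2] by simp
      qed
      then show ?thesis using True by (simp add: isCont_def H_def)
    next
      case False
      then show ?thesis unfolding H_def cis_conv_exp using k by (intro continuous_intros) auto
    qed
    then show "continuous (at y within {a..b}) H" by (rule continuous_at_imp_continuous_at_within)
  qed
  have "((\<lambda>y. of_real (ln (y\<^sup>2)) * cis (k * y) + q y) has_integral (H b - H a)) {a..b}"
  proof (rule fundamental_theorem_of_calculus_interior_strong[of "{0}", OF _ _ _ cont])
    fix y assume y: "y \<in> {a<..<b} - {0}"
    have 1: "((\<lambda>y. complex_of_real (ln (y\<^sup>2))) has_vector_derivative of_real (2 / y)) (at y)"
    proof (rule has_vector_derivative_of_real)
      have "((\<lambda>y. ln (y\<^sup>2)) has_real_derivative 1 / y\<^sup>2 * (2 * y)) (at y)"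
      proof (rule DERIV_chain2[where f = ln])
        show "(ln has_real_derivative 1 / y\<^sup>2) (at (y\<^sup>2))" using y by (intro DERIV_ln_divide) simp
      qed (auto intro!: derivative_eq_intros)
      moreover have "1 / y\<^sup>2 * (2 * y) = 2 / y" using y by (simp add: power2_eq_square)
      ultimately show "((\<lambda>y. ln (y\<^sup>2)) has_real_derivative 2 / y) (at y)" by simp
    qed
    have 2: "((\<lambda>y. (cis (k * y) - 1) / (\<i> * of_real k)) has_vector_derivative cis (k * y)) (at y)"
    proof -
      have "((\<lambda>z. (exp (\<i> * (of_real k * z)) - 1) / (\<i> * of_real k)) has_field_derivative
          exp (\<i> * (of_real k * of_real y))) (at (of_real y))"
        using k by (auto intro!: derivative_eq_intros simp: field_simps)
      from has_vector_derivative_real_field[OF this] show ?thesis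
        by (simp add: cis_conv_exp)
    qed
    have "((\<lambda>y. of_real (ln (y\<^sup>2)) * ((cis (k * y) - 1) / (\<i> * of_real k))) has_vector_derivative
        of_real (ln (y\<^sup>2)) * cis (k * y) + of_real (2 / y) * ((cis (k * y) - 1) / (\<i> * of_real k))) (at y)"
      by (rule has_vector_derivative_mult[OF 1 2])
    then show "(H has_vector_derivative of_real (ln (y\<^sup>2)) * cis (k * y) + q y) (at y)"
      unfolding H_def[abs_def] q_def cis_quotient_def by (simp add: mult.commute)
  qed (use ab in auto)
  moreover have "(q has_integral (2 * integral {a..b} (cis_quotient k) / (\<i> * of_real k))) {a..b}"
    unfolding q_def[abs_def] using integral_cis_quotient(1)[of k a b] k ab
    by (intro has_integral_divide has_integral_mult_right integrable_integral) auto
  ultimately have "((\<lambda>y. (of_real (ln (y\<^sup>2)) * cis (k * y) + q y) - q y) has_integral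
     (H b - H a - 2 * integral {a..b} (cis_quotient k) / (\<i> * of_real k))) {a..b}"
    by (rule has_integral_diff)
  then show ?thesis by (simp add: H_def diff_divide_distrib)
qed

lemma log_moment_bound:
  assumes k: "k > 0" and ab: "a \<le> 0" "0 \<le> b"
  shows "k * cmod (integral {a..b} (\<lambda>y. of_real (ln (y\<^sup>2)) * cis (k * y))) \<le>
    2 * \<bar>ln (b\<^sup>2)\<bar> + 2 * \<bar>ln (a\<^sup>2)\<bar> + 16
    + 2 * \<bar>integral {0..-a} (cosc_kernel k) - integral {0..b} (cosc_kernel k)\<bar>"
proof -
  define D where "D = integral {a..b} (cis_quotient k)"
  have ge: "0 \<le> -a" using ab by simp
  have D: "cmod D \<le> \<bar>integral {0..-a} (cosc_kernel k) - integral {0..b} (cosc_kernel k)\<bar> + 8"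
  proof -
    have "cmod D \<le> \<bar>Re D\<bar> + \<bar>Im D\<bar>" by (rule cmod_le)
    then show ?thesis
      using abs_sinc_integral_le[OF k ab(2)] abs_sinc_integral_le[OF k ge]
      unfolding D_def integral_cis_quotient(2)[OF less_imp_le[OF k] ab] by simp
  qed
  have e: "cmod (complex_of_real x * (cis y - 1)) \<le> 2 * \<bar>x\<bar>" for x y
  proof -
    have "cmod (cis y - 1) \<le> 2" using norm_triangle_ineq4[of "cis y" 1] by simp
    then show ?thesis by (simp add: norm_mult mult_left_mono mult.commute)
  qed
  have "k * cmod (integral {a..b} (\<lambda>y. of_real (ln (y\<^sup>2)) * cis (k * y))) =
    cmod (of_real (ln (b\<^sup>2)) * (cis (k * b) - 1) - of_real (ln (a\<^sup>2)) * (cis (k * a) - 1) - 2 * D)"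
    unfolding integral_unique[OF log_moment_by_parts[OF assms]] D_def[symmetric]
    using k by (simp add: norm_divide norm_mult)
  also have "\<dots> \<le> 2 * \<bar>ln (b\<^sup>2)\<bar> + 2 * \<bar>ln (a\<^sup>2)\<bar> + 2 * cmod D"
    using norm_triangle_ineq4[of "of_real (ln (b\<^sup>2)) * (cis (k * b) - 1) - of_real (ln (a\<^sup>2)) * (cis (k * a) - 1)" "2 * D"]
      norm_triangle_ineq4[of "of_real (ln (b\<^sup>2)) * (cis (k * b) - 1)" "of_real (ln (a\<^sup>2)) * (cis (k * a) - 1)"]
      e[of "ln (b\<^sup>2)" "k * b"] e[of "ln (a\<^sup>2)" "k * a"] by (simp add: norm_mult)
  also have "\<dots> \<le> 2 * \<bar>ln (b\<^sup>2)\<bar> + 2 * \<bar>ln (a\<^sup>2)\<bar> + 2 * (\<bar>integral {0..-a} (cosc_kernel k) - integral {0..b} (cosc_kernel k)\<bar> + 8)"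
    using D by (intro add_left_mono mult_left_mono) auto
  finally show ?thesis by (simp only: distrib_left add_ac)
qed

section \<open>The change of variables\<close>
lemma cos_image_0_pi: "cos ` {0..pi} = {-1..1}"
proof
  show "{-1..1} \<subseteq> cos ` {0..pi}"
  proof
    fix x :: real assume "x \<in> {-1..1}"
    then have "x = cos (arccos x)" "arccos x \<in> {0..pi}" by (auto simp: arccos_lbound arccos_ubound)
    then show "x \<in> cos ` {0..pi}" by blast
  qed
qed auto

lemma inj_on_cos_0_pi: "inj_on cos {0..pi}"
  by (auto intro!: inj_onI cos_inj_pi)

lemma osc_as_exp: "osc k t = exp (\<i> * of_real k * of_real (cos t))"
  by (simp add: osc_def cis_conv_exp mult.assoc)

lemma log_kernel_sin_absolutely_integrable:
  assumes "s \<in> {0..pi}"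
  shows "(\<lambda>t. log_kernel s t * sin t) absolutely_integrable_on {0..pi}"
  using absolutely_integrable_mult_continuous_real[OF log_kernel_absolutely_integrable[OF assms], of sin]
  by (simp add: mult.commute continuous_intros)

lemma continuous_cos_lift:
  assumes "continuous_on {-1..1} f"
  shows "continuous_on S (cos_lift f)"
proof -
  have "continuous_on S (f \<circ> cos)"
    by (rule continuous_on_compose) (auto intro!: continuous_intros continuous_on_subset[OF assms])
  then show ?thesis by (simp add: cos_lift_def[abs_def] o_def)
qed

lemma log_osc_integral_eq:
  assumes s: "s \<in> {0..pi}" and f: "continuous_on {-1..1} f"
  shows "log_osc_integral (cos s) k f =
      integral {0..pi} (\<lambda>t. of_real (log_kernel s t * sin t) * (cos_lift f t * osc k t))"
    and "(\<lambda>t. of_real (log_kernel s t * sin t) * (cos_lift f t * osc k t)) absolutely_integrable_on {0..pi}"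
proof -
  define F where "F x = f x * of_real (ln ((x - cos s)\<^sup>2)) * exp (\<i> * of_real k * of_real x)" for x
  define R where "R t = of_real (log_kernel s t * sin t) * (cos_lift f t * osc k t)" for t
  have eq: "\<bar>- sin t\<bar> *\<^sub>R F (cos t) = R t" if "t \<in> {0..pi}" for t
    using sin_ge_zero[of t] that
    by (simp add: F_def R_def log_kernel_def osc_as_exp cos_lift_def scaleR_conv_of_real)
  have "R absolutely_integrable_on {0..pi}"
    unfolding R_def[abs_def]
    by (intro absolutely_integrable_mult_continuous log_kernel_sin_absolutely_integrable s
        continuous_intros continuous_cos_lift f)
  then show "(\<lambda>t. of_real (log_kernel s t * sin t) * (cos_lift f t * osc k t)) absolutely_integrable_on {0..pi}"
    by (simp add: R_def[abs_def])
  have "(\<lambda>t. \<bar>- sin t\<bar> *\<^sub>R F (cos t)) absolutely_integrable_on {0..pi}"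
    by (rule absolutely_integrable_spike[OF \<open>R absolutely_integrable_on {0..pi}\<close>, of "{}"]) (use eq in auto)
  moreover have "integral {0..pi} (\<lambda>t. \<bar>- sin t\<bar> *\<^sub>R F (cos t)) = integral {0..pi} R"
    by (rule integral_cong) (use eq in auto)
  moreover have "(cos has_real_derivative - sin t) (at t within {0..pi})" for t
    by (auto intro!: derivative_eq_intros)
  ultimately have F: "F absolutely_integrable_on cos ` {0..pi}" "integral (cos ` {0..pi}) F = integral {0..pi} R"
    using has_absolute_integral_change_of_variables_real[of "{0..pi}" cos "\<lambda>t. - sin t" F "integral {0..pi} R"]
    using inj_on_cos_0_pi by auto
  have "log_osc_integral (cos s) k f = integral {-1..1} F"
    unfolding log_osc_integral_def
    using set_lebesgue_integral_eq_integral(2)[OF F(1)] unfolding cos_image_0_pi F_def by simp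
  also have "\<dots> = integral {0..pi} R" using F(2) by (simp add: cos_image_0_pi)
  finally show "log_osc_integral (cos s) k f =
      integral {0..pi} (\<lambda>t. of_real (log_kernel s t * sin t) * (cos_lift f t * osc k t))"
    by (simp add: R_def[abs_def])
qed

definition log_moment :: "real \<Rightarrow> real \<Rightarrow> complex"
  where "log_moment s k = osc_integral k (\<lambda>t. log_kernel s t * sin t)"

text \<open>
  Substituting \<open>y = cos t - cos s\<close> moves the singularity to 0, at the cost of a unimodular factor.
\<close>
lemma norm_log_moment_eq:
  assumes s: "s \<in> {0..pi}"
  shows "cmod (log_moment s k) =
    cmod (integral {-1 - cos s..1 - cos s} (\<lambda>y. of_real (ln (y\<^sup>2)) * cis (k * y)))"
proof -
  define F where "F y = of_real (ln (y\<^sup>2)) * cis (k * y)" for y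
  define R where "R t = of_real (log_kernel s t * sin t) * (cis (- k * cos s) * osc k t)" for t
  define g where "g t = cos t - cos s" for t
  have eq: "\<bar>- sin t\<bar> *\<^sub>R F (g t) = R t" if "t \<in> {0..pi}" for t
    using sin_ge_zero[of t] that
    by (simp add: F_def R_def g_def log_kernel_def osc_def cis_mult scaleR_conv_of_real algebra_simps)
  have img: "g ` {0..pi} = {-1 - cos s..1 - cos s}"
  proof -
    have "g ` {0..pi} = (\<lambda>x. x - cos s) ` cos ` {0..pi}" by (auto simp: g_def)
    then show ?thesis by (simp add: cos_image_0_pi)
  qed
  have "R absolutely_integrable_on {0..pi}"
    unfolding R_def[abs_def]
    by (intro absolutely_integrable_mult_continuous log_kernel_sin_absolutely_integrable s continuous_intros)
  then have "(\<lambda>t. \<bar>- sin t\<bar> *\<^sub>R F (g t)) absolutely_integrable_on {0..pi}"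
    by (rule absolutely_integrable_spike[of _ _ "{}"]) (use eq in auto)
  moreover have "integral {0..pi} (\<lambda>t. \<bar>- sin t\<bar> *\<^sub>R F (g t)) = integral {0..pi} R"
    by (rule integral_cong) (use eq in auto)
  moreover have "inj_on g {0..pi}"
    using inj_on_cos_0_pi by (auto simp: inj_on_def g_def)
  moreover have "(g has_real_derivative - sin t) (at t within {0..pi})" for t
    unfolding g_def[abs_def] by (auto intro!: derivative_eq_intros)
  ultimately have F: "integral (g ` {0..pi}) F = integral {0..pi} R"
    using has_absolute_integral_change_of_variables_real[of "{0..pi}" g "\<lambda>t. - sin t" F "integral {0..pi} R"]
    by auto
  have "R = (\<lambda>t. cis (- k * cos s) * (of_real (log_kernel s t * sin t) * osc k t))"
    by (auto simp: R_def)
  then have "integral {0..pi} R = cis (- k * cos s) * log_moment s k"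
    by (simp add: log_moment_def)
  then show ?thesis using F unfolding img F_def[abs_def] by (simp add: norm_mult)
qed

lemma norm_log_moment_bound:
  assumes s: "s \<in> {0..pi}" and k: "k > 0"
  shows "k * cmod (log_moment s k) \<le>
    2 * \<bar>ln ((1 - cos s)\<^sup>2)\<bar> + 2 * \<bar>ln ((1 + cos s)\<^sup>2)\<bar> + 16
    + 2 * \<bar>integral {0..1 + cos s} (cosc_kernel k) - integral {0..1 - cos s} (cosc_kernel k)\<bar>"
proof -
  have 1: "(- 1 - cos s)\<^sup>2 = (1 + cos s)\<^sup>2" by (simp add: power2_eq_square algebra_simps)
  have 2: "- (- 1 - cos s) = 1 + cos s" by simp
  have "- 1 - cos s \<le> 0" "0 \<le> 1 - cos s" using cos_ge_minus_one[of s] cos_le_one[of s] by linarith+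
  from log_moment_bound[OF k this] show ?thesis
    unfolding norm_log_moment_eq[OF s] 1 2 .
qed

lemma log_moment_decay_interior:
  assumes s: "s \<in> {0<..<pi}"
  shows "\<exists>C\<ge>0. \<forall>k\<ge>1. k * cmod (log_moment s k) \<le> C"
proof -
  have s': "s \<in> {0..pi}" using s by auto
  have "-1 < cos s" "cos s < 1"
    using s cos_monotone_0_pi[of s pi] cos_monotone_0_pi[of 0 s] by auto
  then have pos: "0 < 1 + cos s" "0 < 1 - cos s" by auto
  define C where "C = 2 * \<bar>ln ((1 - cos s)\<^sup>2)\<bar> + 2 * \<bar>ln ((1 + cos s)\<^sup>2)\<bar> + 16
    + 2 * (2 * \<bar>ln ((1 - cos s) / (1 + cos s))\<bar>)"
  have "k * cmod (log_moment s k) \<le> C" if "k \<ge> 1" for k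
    using norm_log_moment_bound[OF s', of k] cosc_integral_difference_le[OF _ pos, of k] that
    unfolding C_def by simp
  moreover have "C \<ge> 0" by (simp add: C_def)
  ultimately show ?thesis by blast
qed

lemma log_moment_decay:
  assumes s: "s \<in> {0..pi}"
  shows "\<exists>C\<ge>0. \<forall>k\<ge>1. k * cmod (log_moment s k) \<le> C * (1 + ln k)"
proof -
  define B where "B = 2 * \<bar>ln ((1 - cos s)\<^sup>2)\<bar> + 2 * \<bar>ln ((1 + cos s)\<^sup>2)\<bar> + 16"
  have B: "B \<ge> 0" by (simp add: B_def)
  have "k * cmod (log_moment s k) \<le> (B + 12) * (1 + ln k)" if k: "k \<ge> 1" for k
  proof -
    have c: "0 \<le> 1 + cos s" "1 + cos s \<le> 2" "0 \<le> 1 - cos s" "1 - cos s \<le> 2"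
      using cos_ge_minus_one[of s] cos_le_one[of s] by linarith+
    have "k * cmod (log_moment s k) \<le> B + 2 * \<bar>integral {0..1 + cos s} (cosc_kernel k)
        - integral {0..1 - cos s} (cosc_kernel k)\<bar>"
      using norm_log_moment_bound[OF s, of k] k unfolding B_def by simp
    also have "\<dots> \<le> B + 2 * (3 * (1 + ln k) + 3 * (1 + ln k))"
      using abs_cosc_integral_le[OF k c(1,2)] abs_cosc_integral_le[OF k c(3,4)]
      by (intro add_left_mono mult_left_mono order.trans[OF abs_triangle_ineq4] add_mono) auto
    also have "\<dots> \<le> B * (1 + ln k) + 12 * (1 + ln k)"
      using B k by (simp add: mult_le_cancel_left1)
    finally show ?thesis by (simp add: distrib_right)
  qed
  then show ?thesis using B by (intro exI[of _ "B + 12"]) auto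
qed

section \<open>Chebyshev polynomials, aliasing and the error functional\<close>
text \<open>
  The Chebyshev polynomial in its trigonometric form. That it is a polynomial on \<open>[-1, 1]\<close> matters
  only for computing its interpolant.
\<close>
definition chebyshev :: "nat \<Rightarrow> real \<Rightarrow> complex"
  where "chebyshev n x = of_real (cos (real n * arccos x))"

lemma chebyshev_cos: "t \<in> {0..pi} \<Longrightarrow> chebyshev n (cos t) = of_real (cos (real n * t))"
  by (simp add: chebyshev_def arccos_cos)

lemma continuous_chebyshev: "continuous_on {-1..1} (chebyshev n)"
  unfolding chebyshev_def[abs_def] by (intro continuous_intros) auto

lemma norm_chebyshev_le: "cmod (chebyshev n x) \<le> 1"
  by (simp add: chebyshev_def)

lemma chebyshev_polynomial:
  "\<exists>p :: complex poly. degree p \<le> n \<and> (\<forall>t. poly p (of_real (cos t)) = of_real (cos (real n * t)))"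
proof (induction n rule: less_induct)
  case (less n)
  show ?case
  proof (cases "n \<le> 1")
    case True
    then consider "n = 0" | "n = 1" by linarith
    then show ?thesis
    proof cases
      case 1 then show ?thesis by (intro exI[of _ 1]) simp
    next
      case 2 then show ?thesis by (intro exI[of _ "[:0, 1:]"]) simp
    qed
  next
    case False
    then obtain m where n: "n = Suc (Suc m)" by (metis One_nat_def Suc_le_eq not_less old.nat.exhaust zero_less_Suc)
    obtain p where p: "degree p \<le> Suc m" "\<And>t. poly p (of_real (cos t)) = complex_of_real (cos (real (Suc m) * t))"
      using less.IH[of "Suc m"] n by blast
    obtain q where q: "degree q \<le> m" "\<And>t. poly q (of_real (cos t)) = complex_of_real (cos (real m * t))"
      using less.IH[of m] n by auto
    have "cos (real n * t) = 2 * cos t * cos (real (Suc m) * t) - cos (real m * t)" for t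
    proof -
      have "cos (real n * t) + cos (real m * t) = 2 * cos ((real n * t + real m * t) / 2) * cos ((real n * t - real m * t) / 2)"
        by (rule cos_plus_cos)
      moreover have "(real n * t + real m * t) / 2 = real (Suc m) * t" by (simp add: n algebra_simps)
      moreover have "(real n * t - real m * t) / 2 = t" by (simp add: n algebra_simps)
      ultimately show ?thesis by (simp only: mult.assoc mult.commute[of "cos t"])
    qed
    moreover have "degree (pCons 0 (smult 2 p) - q) \<le> n"
      using p(1) q(1) n by (intro degree_diff_le) (auto intro!: order.trans[OF degree_pCons_le])
    ultimately show ?thesis
      by (intro exI[of _ "pCons 0 (smult 2 p) - q"]) (simp add: p q mult_ac)
  qed
qed

text \<open>
  For \<open>n = 2 N q + j\<close> with \<open>-N \<le> j < N\<close> this is \<open>\<bar>j\<bar>\<close>: the frequency in \<open>{0..N}\<close> that takes the same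
  values at the nodes as the frequency \<open>n\<close>.
\<close>
definition alias_index :: "nat \<Rightarrow> nat \<Rightarrow> nat"
  where "alias_index N n = nat \<bar>int ((n + N) mod (2 * N)) - int N\<bar>"

lemma alias_index_le: "N \<ge> 1 \<Longrightarrow> alias_index N n \<le> N"
proof -
  assume "N \<ge> 1"
  then have "(n + N) mod (2 * N) < 2 * N" by simp
  then show ?thesis unfolding alias_index_def by linarith
qed

lemma alias_index_self: "n \<le> N \<Longrightarrow> N \<ge> 1 \<Longrightarrow> alias_index N n = n"
  by (cases "n = N") (auto simp: alias_index_def mult_2)

lemma cos_alias_index:
  assumes "N \<ge> 1"
  shows "cos (real n * (real j * pi / real N)) = cos (real (alias_index N n) * (real j * pi / real N))"
proof -
  define q m where "q = (n + N) div (2 * N)" and "m = (n + N) mod (2 * N)"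
  have "n + N = q * (2 * N) + m" unfolding q_def m_def by (rule div_mult_mod_eq[symmetric])
  then have n: "real n = real q * (2 * real N) + (real m - real N)"
  proof -
    have "real n + real N = real q * (2 * real N) + real m"
      using arg_cong[OF \<open>n + N = q * (2 * N) + m\<close>, of real] by simp
    then show ?thesis by simp
  qed
  define x where "x = real j * pi / real N"
  have "real n * x = (real m - real N) * x + 2 * pi * real (q * j)"
    unfolding n using assms by (simp add: x_def field_simps)
  then have "cos (real n * x) = cos ((real m - real N) * x)"
    using cos_int_2pin[of "int (q * j)"] sin_int_2pin[of "int (q * j)"] by (simp only: cos_add) simp
  also have "\<dots> = cos (\<bar>real m - real N\<bar> * x)"
  proof -
    have "cos (y * x) = cos (\<bar>y\<bar> * x)" for y by (cases "y \<ge> 0") simp_all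
    then show ?thesis .
  qed
  also have "\<bar>real m - real N\<bar> = real (alias_index N n)"
    unfolding alias_index_def m_def[symmetric] by linarith
  finally show ?thesis by (simp add: x_def)
qed

lemma chebyshev_at_node:
  assumes "N \<ge> 1" "j \<le> N"
  shows "chebyshev n (cheb_node N j) = of_real (cos (real n * (real j * pi / real N)))"
  unfolding cheb_node_def using assms by (intro chebyshev_cos) (auto simp: field_simps)

lemma chebyshev_alias_at_node:
  assumes "N \<ge> 1" "j \<le> N"
  shows "chebyshev n (cheb_node N j) = chebyshev (alias_index N n) (cheb_node N j)"
  unfolding chebyshev_at_node[OF assms] using cos_alias_index[OF assms(1)] by simp

lemma cheb_interpolant_unique:
  assumes "N \<ge> 1" "is_cheb_interpolant N f p"
  shows "cheb_interpolant N f = p"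
  unfolding cheb_interpolant_def using ex1_cheb_interpolant[OF assms(1)] assms(2) by (rule the1_equality)

lemma cheb_interpolant_is:
  assumes "N \<ge> 1" shows "is_cheb_interpolant N f (cheb_interpolant N f)"
  unfolding cheb_interpolant_def using ex1_cheb_interpolant[OF assms] by (rule theI')

lemma cheb_interpolant_node_expansion:
  assumes N: "N \<ge> 1"
  shows "cheb_interpolant N f = (\<Sum>j\<le>N. smult (f (cheb_node N j))
    (cheb_interpolant N (\<lambda>x. if x = cheb_node N j then 1 else 0)))"
proof (rule cheb_interpolant_unique[OF N])
  define l where "l j = cheb_interpolant N (\<lambda>x. if x = cheb_node N j then 1 else 0)" for j
  have l: "degree (l j) \<le> N" "n \<le> N \<Longrightarrow> poly (l j) (of_real (cheb_node N n)) = (if cheb_node N n = cheb_node N j then 1 else 0)" for j n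
    using cheb_interpolant_is[OF N, of "\<lambda>x. if x = cheb_node N j then 1 else 0"]
    unfolding l_def is_cheb_interpolant_def by auto
  have "poly (\<Sum>j\<le>N. smult (f (cheb_node N j)) (l j)) (of_real (cheb_node N n)) = f (cheb_node N n)" if n: "n \<le> N" for n
  proof -
    have "poly (\<Sum>j\<le>N. smult (f (cheb_node N j)) (l j)) (of_real (cheb_node N n)) =
        (\<Sum>j\<le>N. if j = n then f (cheb_node N j) else 0)"
      unfolding poly_sum using n l inj_onD[OF inj_on_cheb_node[OF N], of n]
      by (intro sum.cong) auto
    then show ?thesis using n by simp
  qed
  moreover have "degree (\<Sum>j\<le>N. smult (f (cheb_node N j)) (l j)) \<le> N"
    using l by (intro degree_sum_le) (auto intro: order.trans[OF degree_smult_le])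
  ultimately show "is_cheb_interpolant N f (\<Sum>j\<le>N. smult (f (cheb_node N j)) (l j))"
    unfolding is_cheb_interpolant_def by simp
qed

lemma log_osc_integral_cong:
  assumes "\<And>x. x \<in> {-1..1} \<Longrightarrow> f x = g x"
  shows "log_osc_integral \<alpha> k f = log_osc_integral \<alpha> k g"
  unfolding log_osc_integral_def using assms
  by (intro set_lebesgue_integral_cong) auto

lemma continuous_poly_of_real: "continuous_on S (\<lambda>x::real. poly p (complex_of_real x))"
  by (intro continuous_intros)

definition rule_weight :: "real \<Rightarrow> real \<Rightarrow> nat \<Rightarrow> nat \<Rightarrow> complex"
  where "rule_weight s k N j = log_osc_integral (cos s) k
    (\<lambda>x. poly (cheb_interpolant N (\<lambda>y. if y = cheb_node N j then 1 else 0)) (of_real x))"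

definition rule_error :: "real \<Rightarrow> real \<Rightarrow> nat \<Rightarrow> (real \<Rightarrow> complex) \<Rightarrow> complex"
  where "rule_error s k N f = log_osc_integral (cos s) k f - log_osc_rule (cos s) k N f"

abbreviation cheb_error :: "real \<Rightarrow> real \<Rightarrow> nat \<Rightarrow> nat \<Rightarrow> complex"
  where "cheb_error s k N n \<equiv> rule_error s k N (chebyshev n)"

context
  fixes s k :: real
  assumes s: "s \<in> {0..pi}"
begin

lemma log_osc_integral_add_mult:
  assumes "continuous_on {-1..1} f" "continuous_on {-1..1} g"
  shows "log_osc_integral (cos s) k (\<lambda>x. f x + c * g x) =
    log_osc_integral (cos s) k f + c * log_osc_integral (cos s) k g"
proof -
  have "continuous_on {-1..1} (\<lambda>x. f x + c * g x)"
    using assms by (intro continuous_intros)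
  note eq = log_osc_integral_eq(1)[OF s this, of k]
  note int = integrable_of_absolutely[OF log_osc_integral_eq(2)[OF s assms(1), of k]]
    integrable_of_absolutely[OF log_osc_integral_eq(2)[OF s assms(2), of k]]
  show ?thesis
    unfolding eq log_osc_integral_eq(1)[OF s assms(1)] log_osc_integral_eq(1)[OF s assms(2)]
    using integral_add[OF int(1) integrable_on_mult_right[OF int(2), of c]]
    by (simp add: cos_lift_def algebra_simps)
qed

lemma log_osc_integral_sum:
  assumes "continuous_on {-1..1} f" "\<And>n. continuous_on {-1..1} (g n)" "finite A"
  shows "log_osc_integral (cos s) k (\<lambda>x. f x + (\<Sum>n\<in>A. c n * g n x)) =
    log_osc_integral (cos s) k f + (\<Sum>n\<in>A. c n * log_osc_integral (cos s) k (g n))"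
  using assms(3)
proof (induction A rule: finite_induct)
  case (insert a A)
  have "continuous_on {-1..1} (\<lambda>x. f x + (\<Sum>n\<in>A. c n * g n x))"
    using assms by (intro continuous_intros)
  from log_osc_integral_add_mult[OF this assms(2)[of a], of "c a"] insert show ?case
    by (simp add: algebra_simps)
qed simp

lemma log_osc_integral_zero: "log_osc_integral (cos s) k (\<lambda>_. 0) = 0"
  by (simp add: log_osc_integral_def)

lemma log_osc_rule_eq_weighted_sum:
  assumes N: "N \<ge> 1"
  shows "log_osc_rule (cos s) k N f = (\<Sum>j\<le>N. f (cheb_node N j) * rule_weight s k N j)"
  using log_osc_integral_sum[of "\<lambda>_. 0" "\<lambda>j x. poly (cheb_interpolant N (\<lambda>y. if y = cheb_node N j then 1 else 0)) (of_real x)"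
    "{..N}" "\<lambda>j. f (cheb_node N j)"] continuous_poly_of_real
  unfolding log_osc_rule_def cheb_interpolant_node_expansion[OF N, of f]
  by (simp add: poly_sum rule_weight_def log_osc_integral_zero)

lemma rule_error_diff_sum:
  assumes "N \<ge> 1" "continuous_on {-1..1} f" "\<And>n. continuous_on {-1..1} (g n)" "finite A"
  shows "rule_error s k N (\<lambda>x. f x - (\<Sum>n\<in>A. c n * g n x)) = rule_error s k N f - (\<Sum>n\<in>A. c n * rule_error s k N (g n))"
proof -
  have 1: "log_osc_integral (cos s) k (\<lambda>x. f x - (\<Sum>n\<in>A. c n * g n x)) =
    log_osc_integral (cos s) k f - (\<Sum>n\<in>A. c n * log_osc_integral (cos s) k (g n))"
    using log_osc_integral_sum[OF assms(2-4), of "\<lambda>n. - c n"] by (simp add: sum_negf)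
  have 2: "log_osc_rule (cos s) k N (\<lambda>x. f x - (\<Sum>n\<in>A. c n * g n x)) =
    log_osc_rule (cos s) k N f - (\<Sum>n\<in>A. c n * log_osc_rule (cos s) k N (g n))"
  proof -
    have "(\<Sum>j\<le>N. (\<Sum>n\<in>A. c n * g n (cheb_node N j)) * rule_weight s k N j) =
        (\<Sum>j\<le>N. \<Sum>n\<in>A. c n * (g n (cheb_node N j) * rule_weight s k N j))"
      by (simp only: sum_distrib_right mult.assoc)
    also have "\<dots> = (\<Sum>n\<in>A. \<Sum>j\<le>N. c n * (g n (cheb_node N j) * rule_weight s k N j))"
      by (rule sum.swap)
    also have "\<dots> = (\<Sum>n\<in>A. c n * (\<Sum>j\<le>N. g n (cheb_node N j) * rule_weight s k N j))"
      by (simp only: sum_distrib_left)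
    finally show ?thesis
      unfolding log_osc_rule_eq_weighted_sum[OF assms(1)] by (simp only: left_diff_distrib sum_subtractf)
  qed
  show ?thesis unfolding rule_error_def 1 2 by (simp only: right_diff_distrib sum_subtractf) simp
qed

text \<open>
  A bound depending on \<open>N\<close> is enough: it only serves to exchange the error functional with a
  uniformly convergent series.
\<close>
lemma rule_error_bounded:
  assumes N: "N \<ge> 1"
  shows "\<exists>C. \<forall>f b. continuous_on {-1..1} f \<longrightarrow> (\<forall>x\<in>{-1..1}. cmod (f x) \<le> b) \<longrightarrow> cmod (rule_error s k N f) \<le> C * b"
proof (intro exI allI impI)
  fix f :: "real \<Rightarrow> complex" and b assume f: "continuous_on {-1..1} f" and b: "\<forall>x\<in>{-1..1}. cmod (f x) \<le> b"
  let ?w = "\<lambda>t. log_kernel s t * sin t"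
  note w = log_kernel_sin_absolutely_integrable[OF s]
  have "cmod (log_osc_integral (cos s) k f) \<le> integral {0..pi} (\<lambda>t. \<bar>?w t\<bar> * b)"
    unfolding log_osc_integral_eq(1)[OF s f]
  proof (rule integral_norm_bound_integral)
    show "(\<lambda>t. \<bar>?w t\<bar> * b) integrable_on {0..pi}"
      using w by (intro integrable_on_mult_left) (simp add: absolutely_integrable_on_def)
    fix t assume "t \<in> {0..pi}"
    have "cmod (cos_lift f t) \<le> b" using b by (simp add: cos_lift_def)
    then show "norm (of_real (?w t) * (cos_lift f t * osc k t)) \<le> \<bar>?w t\<bar> * b"
      by (simp add: norm_mult mult_left_mono del: of_real_mult)
  qed (rule integrable_of_absolutely[OF log_osc_integral_eq(2)[OF s f]])
  moreover have "cmod (log_osc_rule (cos s) k N f) \<le> (\<Sum>j\<le>N. cmod (rule_weight s k N j)) * b"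
    unfolding log_osc_rule_eq_weighted_sum[OF N] sum_distrib_right
  proof (rule order.trans[OF norm_sum], rule sum_mono)
    fix j
    have "cheb_node N j \<in> {-1..1}" by (simp add: cheb_node_def)
    then show "cmod (f (cheb_node N j) * rule_weight s k N j) \<le> cmod (rule_weight s k N j) * b"
      using b by (simp add: norm_mult mult.commute mult_right_mono)
  qed
  ultimately show "cmod (rule_error s k N f) \<le> (integral {0..pi} (\<lambda>t. \<bar>?w t\<bar>) + (\<Sum>j\<le>N. cmod (rule_weight s k N j))) * b"
    unfolding rule_error_def by (intro order.trans[OF norm_triangle_ineq4]) (simp add: distrib_right)
qed

lemma rule_error_uniform_series:
  assumes N: "N \<ge> 1" and f: "continuous_on {-1..1} f" and c: "summable (\<lambda>n. cmod (c n))"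
    and eq: "\<And>x. x \<in> {-1..1} \<Longrightarrow> (\<lambda>n. c n * chebyshev n x) sums f x"
  shows "(\<lambda>n. c n * cheb_error s k N n) sums rule_error s k N f"
proof -
  obtain C where C: "\<And>f b. continuous_on {-1..1} f \<Longrightarrow> (\<forall>x\<in>{-1..1}. cmod (f x) \<le> b) \<Longrightarrow> cmod (rule_error s k N f) \<le> C * b"
    using rule_error_bounded[OF N] by blast
  define tail where "tail M = (\<Sum>n. cmod (c (n + M)))" for M
  have tail: "tail \<longlonglongrightarrow> 0"
    unfolding tail_def by (rule suminf_exist_split2[OF c])
  have "norm (rule_error s k N f - (\<Sum>n<M. c n * cheb_error s k N n)) \<le> C * tail M" for M
  proof -
    have "cmod (f x - (\<Sum>n<M. c n * chebyshev n x)) \<le> tail M" if x: "x \<in> {-1..1}" for x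
    proof -
      have sm: "summable (\<lambda>n. c n * chebyshev n x)" using eq[OF x] by (rule sums_summable)
      have bnd: "cmod (c n * chebyshev n x) \<le> cmod (c n)" for n
        using mult_left_mono[OF norm_chebyshev_le, of "cmod (c n)"] by (simp add: norm_mult)
      have "f x - (\<Sum>n<M. c n * chebyshev n x) = (\<Sum>n. c (n + M) * chebyshev (n + M) x)"
        using suminf_minus_initial_segment[OF sm, of M] sums_unique[OF eq[OF x]] by simp
      also have "cmod \<dots> \<le> tail M"
        unfolding tail_def using bnd summable_ignore_initial_segment[OF c]
        by (intro norm_suminf_le) auto
      finally show ?thesis .
    qed
    then have "cmod (rule_error s k N (\<lambda>x. f x - (\<Sum>n<M. c n * chebyshev n x))) \<le> C * tail M"
      using f by (intro C) (auto intro!: continuous_intros continuous_chebyshev)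
    then show ?thesis
      using rule_error_diff_sum[OF N f continuous_chebyshev, of "{..<M}" c] by simp
  qed
  note bound = this
  have "(\<lambda>M. C * tail M) \<longlonglongrightarrow> 0" using tendsto_mult_right_zero[OF tail] .
  from Lim_null_comparison[OF always_eventually[OF allI[OF bound]] this]
  have "(\<lambda>M. rule_error s k N f - (\<Sum>n<M. c n * cheb_error s k N n)) \<longlonglongrightarrow> 0" .
  then have "(\<lambda>M. rule_error s k N f - (rule_error s k N f - (\<Sum>n<M. c n * cheb_error s k N n))) \<longlonglongrightarrow> rule_error s k N f - 0"
    by (intro tendsto_intros)
  then show ?thesis by (simp add: sums_def)
qed

lemma log_osc_rule_chebyshev:
  assumes N: "N \<ge> 1"
  shows "log_osc_rule (cos s) k N (chebyshev n) = log_osc_integral (cos s) k (chebyshev (alias_index N n))"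
proof -
  obtain p :: "complex poly" where p: "degree p \<le> alias_index N n"
    "\<And>t. poly p (of_real (cos t)) = of_real (cos (real (alias_index N n) * t))"
    using chebyshev_polynomial by blast
  have px: "poly p (of_real x) = chebyshev (alias_index N n) x" if "x \<in> {-1..1}" for x
    using p(2)[of "arccos x"] that by (simp add: chebyshev_def)
  have "poly p (of_real (cheb_node N j)) = chebyshev n (cheb_node N j)" if "j \<le> N" for j
  proof -
    have "cheb_node N j \<in> {-1..1}" by (simp add: cheb_node_def)
    then show ?thesis using px chebyshev_alias_at_node[OF N that, of n] by simp
  qed
  then have "cheb_interpolant N (chebyshev n) = p"
    using p(1) alias_index_le[OF N, of n]
    by (intro cheb_interpolant_unique[OF N]) (simp add: is_cheb_interpolant_def)
  then show ?thesis unfolding log_osc_rule_def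
    by (intro log_osc_integral_cong) (simp add: px)
qed

lemma log_osc_integral_chebyshev:
  "log_osc_integral (cos s) k (chebyshev n) =
    integral {0..pi} (\<lambda>t. of_real (cos (real n * t)) * (of_real (log_kernel s t * sin t) * osc k t))"
  unfolding log_osc_integral_eq(1)[OF s continuous_chebyshev]
  by (rule integral_cong) (simp add: cos_lift_def chebyshev_cos)

lemma rule_error_chebyshev:
  assumes N: "N \<ge> 1"
  shows "cheb_error s k N n =
    log_osc_integral (cos s) k (chebyshev n) - log_osc_integral (cos s) k (chebyshev (alias_index N n))"
  by (simp add: rule_error_def log_osc_rule_chebyshev[OF N])

end

section \<open>Cosine series\<close>
lemma fourier_coeff_cos_lift:
  assumes f: "continuous_on {-1..1} f"
  shows "fourier_coeff (cos_lift f) n =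
    1 / of_real pi * integral {0..pi} (\<lambda>t. cos_lift f t * of_real (cos (of_int n * t)))"
proof -
  define h where "h t = cos_lift f t * exp (- \<i> * of_int n * of_real t)" for t
  have conth: "continuous_on S h" for S
    unfolding h_def by (intro continuous_intros continuous_cos_lift f)
  have int: "h integrable_on {a..b}" for a b using conth by (rule integrable_continuous_real)
  have "set_integrable lebesgue {-pi..pi} h"
    by (rule absolutely_integrable_continuous_real[OF conth])
  then have "(LINT t:{-pi..pi}|lebesgue. h t) = integral {-pi..pi} h"
    by (rule set_lebesgue_integral_eq_integral(2))
  also have "\<dots> = integral {-pi..0} h + integral {0..pi} h"
    using int by (intro Henstock_Kurzweil_Integration.integral_combine[symmetric]) auto
  also have "integral {-pi..0} h = integral {0..pi} (\<lambda>t. h (- t))"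
    using Henstock_Kurzweil_Integration.integral_reflect_real[of pi 0 "\<lambda>t. h (- t)"] by simp
  also have "integral {0..pi} (\<lambda>t. h (- t)) + integral {0..pi} h = integral {0..pi} (\<lambda>t. h (- t) + h t)"
    by (intro integral_add[symmetric] int integrable_continuous_real continuous_on_compose2[OF conth[of UNIV]])
       (auto intro!: continuous_intros)
  also have "(\<lambda>t. h (- t) + h t) = (\<lambda>t. 2 * (cos_lift f t * of_real (cos (of_int n * t))))"
  proof
    fix t
    have "exp (- \<i> * of_int n * of_real t) = cis (- (of_int n * t))"
      and "exp (- \<i> * of_int n * of_real (- t)) = cis (of_int n * t)"
      by (simp_all add: cis_conv_exp mult.assoc)
    then show "h (- t) + h t = 2 * (cos_lift f t * of_real (cos (of_int n * t)))"
      unfolding h_def cos_lift_def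
      by (simp add: complex_eq_iff algebra_simps)
  qed
  finally show ?thesis unfolding fourier_coeff_def h_def by simp
qed

lemma integral_cos_multiple:
  "integral {0..pi} (\<lambda>t. cos (real_of_int n * t)) = (if n = 0 then pi else 0)"
proof (cases "n = 0")
  case False
  have "((\<lambda>t. cos (of_int n * t)) has_integral (sin (of_int n * pi) / of_int n - sin (of_int n * 0) / of_int n)) {0..pi}"
  proof (rule fundamental_theorem_of_calculus)
    fix t :: real
    have "((\<lambda>t. sin (of_int n * t) / of_int n) has_real_derivative cos (of_int n * t)) (at t within {0..pi})"
      using False by (auto intro!: derivative_eq_intros)
    then show "((\<lambda>t. sin (of_int n * t) / of_int n) has_vector_derivative cos (of_int n * t)) (at t within {0..pi})"
      by (simp add: has_real_derivative_iff_has_vector_derivative)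
  qed simp
  then have "((\<lambda>t. cos (real_of_int n * t)) has_integral 0) {0..pi}"
    by (simp add: sin_npi_int mult.commute)
  then show ?thesis using False by (simp add: integral_unique)
qed simp

lemma integral_cos_cos:
  "integral {0..pi} (\<lambda>t. cos (real m * t) * cos (real n * t)) =
    (if m = n then (if m = 0 then pi else pi / 2) else 0)"
proof -
  have *: "cos (real m * t) * cos (real n * t) =
      (cos (of_int (int m - int n) * t) + cos (of_int (int m + int n) * t)) / 2" for t
    by (simp add: cos_times_cos left_diff_distrib distrib_right)
  have int: "(\<lambda>t. cos (real_of_int l * t)) integrable_on {0..pi}" for l
    by (intro integrable_continuous_real continuous_intros)
  have "integral {0..pi} (\<lambda>t. cos (real m * t) * cos (real n * t)) =
     (integral {0..pi} (\<lambda>t. cos (of_int (int m - int n) * t)) + integral {0..pi} (\<lambda>t. cos (of_int (int m + int n) * t))) / 2"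
    unfolding * by (simp only: integral_divide integral_add[OF int int])
  then show ?thesis unfolding integral_cos_multiple by auto
qed

lemma integral_sin_sin:
  assumes "m > 0" "n > 0"
  shows "integral {0..pi} (\<lambda>t. sin (real m * t) * sin (real n * t)) = (if m = n then pi / 2 else 0)"
proof -
  have *: "sin (real m * t) * sin (real n * t) =
      (cos (of_int (int m - int n) * t) - cos (of_int (int m + int n) * t)) / 2" for t
    by (simp add: sin_times_sin left_diff_distrib distrib_right)
  have int: "(\<lambda>t. cos (real_of_int l * t)) integrable_on {0..pi}" for l
    by (intro integrable_continuous_real continuous_intros)
  have "integral {0..pi} (\<lambda>t. sin (real m * t) * sin (real n * t)) =
     (integral {0..pi} (\<lambda>t. cos (of_int (int m - int n) * t)) - integral {0..pi} (\<lambda>t. cos (of_int (int m + int n) * t))) / 2"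
    unfolding * by (simp only: integral_divide integral_diff[OF int int])
  then show ?thesis unfolding integral_cos_multiple using assms by auto
qed

text \<open>
  The moments against \<open>cos (n t)\<close> determine those against powers of \<open>cos t\<close>, so by Weierstrass \<open>h\<close> is
  orthogonal to functions uniformly close to itself, and the integral of its square is 0.
\<close>
lemma zero_if_cos_moments_zero_real:
  fixes h :: "real \<Rightarrow> real"
  assumes h: "continuous_on {-1..1} h"
    and mom: "\<And>n. integral {0..pi} (\<lambda>t. h (cos t) * cos (real n * t)) = 0"
    and x: "x \<in> {-1..1}"
  shows "h x = 0"
proof -
  have conth: "continuous_on S (\<lambda>t. h (cos t))" for S
    by (rule continuous_on_compose2[OF h]) (auto intro!: continuous_intros)
  \<comment> \<open>The factor \<open>cos (n t)\<close> keeps the induction on the power going: \<open>2 cos t cos (n t)\<close> is a sum of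
    two such factors.\<close>
  have pow: "integral {0..pi} (\<lambda>t. h (cos t) * (cos t ^ j * cos (real n * t))) = 0" for j n
  proof (induction j arbitrary: n)
    case 0
    show ?case using mom[of n] by simp
  next
    case (Suc j)
    define g where "g n t = h (cos t) * (cos t ^ j * cos (real n * t))" for n t
    have gi: "g n integrable_on {0..pi}" for n
      unfolding g_def by (intro integrable_continuous_real continuous_intros conth)
    show ?case
    proof (cases n)
      case 0
      then show ?thesis using Suc[of 1] by (simp add: mult_ac)
    next
      case (Suc m)
      have "h (cos t) * (cos t ^ Suc j * cos (real n * t)) = (g (Suc n) t + g m t) / 2" for t
      proof -
        have "cos (real (Suc n) * t) + cos (real m * t) =
            2 * cos ((real (Suc n) * t + real m * t) / 2) * cos ((real (Suc n) * t - real m * t) / 2)"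
          by (rule cos_plus_cos)
        moreover have "(real (Suc n) * t + real m * t) / 2 = real n * t" by (simp add: Suc algebra_simps)
        moreover have "(real (Suc n) * t - real m * t) / 2 = t" by (simp add: Suc algebra_simps)
        ultimately have "cos (real (Suc n) * t) + cos (real m * t) = 2 * cos (real n * t) * cos t" by (simp only:)
        then show ?thesis unfolding g_def
          by (simp only: distrib_left[symmetric] power_Suc) simp
      qed
      then have "integral {0..pi} (\<lambda>t. h (cos t) * (cos t ^ Suc j * cos (real n * t))) =
          (integral {0..pi} (g (Suc n)) + integral {0..pi} (g m)) / 2"
        by (simp only: integral_divide integral_add[OF gi gi])
      then show ?thesis using Suc.IH[of "Suc n"] Suc.IH[of m] unfolding g_def by simp
    qed
  qed
  define H where "H = integral {0..pi} (\<lambda>t. \<bar>h (cos t)\<bar>)"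
  have "integral {0..pi} (\<lambda>t. (h (cos t))\<^sup>2) \<le> e * H" if "e > 0" for e
  proof -
    obtain g where g: "real_polynomial_function g" "\<And>x. x \<in> {-1..1} \<Longrightarrow> \<bar>h x - g x\<bar> < e"
      using Stone_Weierstrass_real_polynomial_function[of "{-1..1}" h e] h \<open>e > 0\<close> by auto
    obtain a m where gsum: "g = (\<lambda>x. \<Sum>i\<le>m. a i * x ^ i)"
      using g(1) real_polynomial_function_iff_sum by blast
    have ci: "(\<lambda>t. h (cos t) * (cos t ^ i * cos (real 0 * t))) integrable_on {0..pi}" for i
      by (intro integrable_continuous_real continuous_intros conth)
    have "integral {0..pi} (\<lambda>t. h (cos t) * g (cos t)) =
        integral {0..pi} (\<lambda>t. \<Sum>i\<le>m. a i * (h (cos t) * (cos t ^ i * cos (real 0 * t))))"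
      unfolding gsum by (simp add: sum_distrib_left mult_ac)
    also have "\<dots> = (\<Sum>i\<le>m. integral {0..pi} (\<lambda>t. a i * (h (cos t) * (cos t ^ i * cos (real 0 * t)))))"
      by (rule integral_sum) (use ci in \<open>auto intro!: integrable_on_mult_right\<close>)
    also have "\<dots> = 0" unfolding integral_mult_right pow by simp
    finally have zero: "integral {0..pi} (\<lambda>t. h (cos t) * g (cos t)) = 0" .
    have contg: "continuous_on S (\<lambda>t. g (cos t))" for S
      unfolding gsum by (intro continuous_intros)
    have "integral {0..pi} (\<lambda>t. (h (cos t))\<^sup>2) = integral {0..pi} (\<lambda>t. h (cos t) * (h (cos t) - g (cos t)))"
      using zero integral_diff[of "\<lambda>t. h (cos t) * h (cos t)" "{0..pi}" "\<lambda>t. h (cos t) * g (cos t)"]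
      by (simp add: right_diff_distrib power2_eq_square integrable_continuous_real continuous_on_mult conth contg)
    also have "\<dots> \<le> integral {0..pi} (\<lambda>t. e * \<bar>h (cos t)\<bar>)"
    proof (rule integral_le)
      fix t
      have "h (cos t) * (h (cos t) - g (cos t)) \<le> \<bar>h (cos t)\<bar> * \<bar>h (cos t) - g (cos t)\<bar>"
        by (metis abs_ge_self abs_mult)
      also have "\<dots> \<le> \<bar>h (cos t)\<bar> * e" using g(2)[of "cos t"] by (intro mult_left_mono) auto
      finally show "h (cos t) * (h (cos t) - g (cos t)) \<le> e * \<bar>h (cos t)\<bar>" by (simp add: mult.commute)
    qed (intro integrable_continuous_real continuous_intros conth contg)+
    also have "\<dots> = e * H" by (simp add: H_def)
    finally show ?thesis .
  qed
  note le = this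
  have "integral {0..pi} (\<lambda>t. (h (cos t))\<^sup>2) \<le> 0"
  proof (rule field_le_epsilon)
    fix e :: real assume "e > 0"
    have H: "H \<ge> 0" unfolding H_def
      by (intro integral_nonneg integrable_continuous_real continuous_intros conth) auto
    have "e / (H + 1) * H \<le> e" using \<open>e > 0\<close> H by (simp add: field_simps)
    then show "integral {0..pi} (\<lambda>t. (h (cos t))\<^sup>2) \<le> 0 + e"
      using le[of "e / (H + 1)"] \<open>e > 0\<close> H by simp
  qed
  moreover have cont2: "continuous_on (cbox 0 pi) (\<lambda>t. (h (cos t))\<^sup>2)" by (intro continuous_intros conth)
  moreover have "0 \<le> integral {0..pi} (\<lambda>t. (h (cos t))\<^sup>2)"
    using cont2 by (intro integral_nonneg integrable_continuous_real) auto
  ultimately have "((\<lambda>t. (h (cos t))\<^sup>2) has_integral 0) (cbox 0 pi)"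
    using integrable_integral[OF integrable_continuous[OF cont2]] by simp
  then have "(h (cos (arccos x)))\<^sup>2 = 0"
    using cont2 x by (intro has_integral_0_cbox_imp_0[of 0 pi "\<lambda>t. (h (cos t))\<^sup>2" "arccos x"])
       (auto simp: arccos_lbound arccos_ubound dest: order.strict_trans2[OF pi_gt_zero])
  then show ?thesis using x by simp
qed

lemma zero_if_cos_moments_zero:
  fixes d :: "real \<Rightarrow> complex"
  assumes d: "continuous_on {-1..1} d"
    and mom: "\<And>n. integral {0..pi} (\<lambda>t. cos_lift d t * of_real (cos (real n * t))) = 0"
    and x: "x \<in> {-1..1}"
  shows "d x = 0"
proof -
  have hi: "((\<lambda>t. cos_lift d t * of_real (cos (real n * t))) has_integral 0) {0..pi}" for n
  proof -
    have "(\<lambda>t. cos_lift d t * of_real (cos (real n * t))) integrable_on {0..pi}"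
      by (intro integrable_continuous_real continuous_intros continuous_cos_lift d)
    then show ?thesis using mom[of n] by (metis integrable_integral)
  qed
  have "Re (d x) = 0"
  proof (rule zero_if_cos_moments_zero_real[OF _ _ x])
    show "continuous_on {-1..1} (\<lambda>x. Re (d x))" by (intro continuous_intros d)
    show "integral {0..pi} (\<lambda>t. Re (d (cos t)) * cos (real n * t)) = 0" for n
      using has_integral_Re[OF hi[of n]] by (simp add: integral_unique cos_lift_def)
  qed
  moreover have "Im (d x) = 0"
  proof (rule zero_if_cos_moments_zero_real[OF _ _ x])
    show "continuous_on {-1..1} (\<lambda>x. Im (d x))" by (intro continuous_intros d)
    show "integral {0..pi} (\<lambda>t. Im (d (cos t)) * cos (real n * t)) = 0" for n
      using has_integral_Im[OF hi[of n]] by (simp add: integral_unique cos_lift_def)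
  qed
  ultimately show ?thesis by (simp add: complex_eq_iff)
qed

text \<open>
  The series converges uniformly, its sum has the same cosine coefficients as \<open>f\<close>, and a continuous
  function is determined by them. The factor 2 collects the frequencies \<open>n\<close> and \<open>-n\<close>.
\<close>
lemma cosine_series_sums:
  fixes c :: "nat \<Rightarrow> complex"
  assumes f: "continuous_on {-1..1} f"
    and c: "c = (\<lambda>n. (if n = 0 then 1 else 2) * fourier_coeff (cos_lift f) (int n))"
    and sm: "summable (\<lambda>n. cmod (c n))"
    and x: "x \<in> {-1..1}"
  shows "(\<lambda>n. c n * chebyshev n x) sums f x"
proof -
  define S where "S M x = (\<Sum>n<M. c n * chebyshev n x)" for M x
  define g where "g x = (\<Sum>n. c n * chebyshev n x)" for x
  have bnd: "cmod (c n * chebyshev n x) \<le> cmod (c n)" for n x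
    using mult_left_mono[OF norm_chebyshev_le, of "cmod (c n)"] by (simp add: norm_mult)
  have unif: "uniform_limit {-1..1} S g sequentially"
    unfolding S_def g_def by (rule Weierstrass_m_test[OF bnd sm])
  have contS: "continuous_on {-1..1} (S M)" for M
    unfolding S_def by (intro continuous_intros continuous_chebyshev)
  have contg: "continuous_on {-1..1} g"
    by (rule uniform_limit_theorem[OF _ unif]) (auto simp: contS)
  define d where "d x = f x - g x" for x
  have contd: "continuous_on {-1..1} d" unfolding d_def by (intro continuous_intros f contg)
  have "integral {0..pi} (\<lambda>t. cos_lift d t * of_real (cos (real m * t))) = 0" for m
  proof -
    have "cmod (integral {0..pi} (\<lambda>t. cos_lift d t * of_real (cos (real m * t)))) \<le> 0 + e" if "e > 0" for e
    proof -
      from uniform_limitD[OF unif, of "e / pi"] that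
      have "\<forall>\<^sub>F M in sequentially. \<forall>x\<in>{-1..1}. dist (S M x) (g x) < e / pi" by simp
      then obtain M where M: "m < M" "\<And>x. x \<in> {-1..1} \<Longrightarrow> dist (S M x) (g x) < e / pi"
        using eventually_conj[OF eventually_gt_at_top[of m]] eventually_happens' trivial_limit_sequentially by (metis (mono_tags, lifting))
      have i1: "(\<lambda>t. cos_lift h t * of_real (cos (real m * t))) integrable_on {0..pi}"
        if "continuous_on {-1..1} h" for h
        using that by (intro integrable_continuous_real continuous_intros continuous_cos_lift)
      have "integral {0..pi} (\<lambda>t. cos_lift (S M) t * of_real (cos (real m * t))) =
          integral {0..pi} (\<lambda>t. \<Sum>n<M. c n * of_real (cos (real n * t) * cos (real m * t)))"
        by (rule integral_cong) (simp add: cos_lift_def S_def chebyshev_cos sum_distrib_right mult.assoc)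
      also have "\<dots> = (\<Sum>n<M. integral {0..pi} (\<lambda>t. c n * of_real (cos (real n * t) * cos (real m * t))))"
        by (rule integral_sum) (auto intro!: integrable_continuous_real continuous_intros)
      also have "\<dots> = (\<Sum>n<M. c n * of_real (integral {0..pi} (\<lambda>t. cos (real n * t) * cos (real m * t))))"
      proof (rule sum.cong[OF refl])
        fix n
        have "((\<lambda>t. cos (real n * t) * cos (real m * t)) has_integral
            integral {0..pi} (\<lambda>t. cos (real n * t) * cos (real m * t))) {0..pi}"
          by (intro integrable_integral integrable_continuous_real continuous_intros)
        from has_integral_mult_right[OF has_integral_of_real[OF this], of "c n"]
        show "integral {0..pi} (\<lambda>t. c n * of_real (cos (real n * t) * cos (real m * t))) =
            c n * of_real (integral {0..pi} (\<lambda>t. cos (real n * t) * cos (real m * t)))"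
          by (rule integral_unique)
      qed
      also have "\<dots> = (\<Sum>n<M. if n = m then c m * of_real (if m = 0 then pi else pi / 2) else 0)"
        by (rule sum.cong) (auto simp: integral_cos_cos)
      also have "\<dots> = c m * of_real (if m = 0 then pi else pi / 2)"
        using M(1) by simp
      also have "\<dots> = integral {0..pi} (\<lambda>t. cos_lift f t * of_real (cos (real m * t)))"
        unfolding c fourier_coeff_cos_lift[OF f] by simp
      finally have eq: "integral {0..pi} (\<lambda>t. cos_lift (S M) t * of_real (cos (real m * t))) =
          integral {0..pi} (\<lambda>t. cos_lift f t * of_real (cos (real m * t)))" .
      have "integral {0..pi} (\<lambda>t. cos_lift d t * of_real (cos (real m * t))) =
          integral {0..pi} (\<lambda>t. (cos_lift (S M) t - cos_lift g t) * of_real (cos (real m * t)))"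
        using integral_diff[OF i1[OF f] i1[OF contg]] integral_diff[OF i1[OF contS[of M]] i1[OF contg]] eq
        by (simp add: d_def cos_lift_def left_diff_distrib)
      also have "cmod \<dots> \<le> integral {0..pi} (\<lambda>t. e / pi)"
      proof (rule integral_norm_bound_integral)
        fix t
        have "cmod (cos_lift (S M) t - cos_lift g t) * \<bar>cos (real m * t)\<bar> \<le> e / pi * 1"
          using M(2)[of "cos t"] that
          by (intro mult_mono) (auto simp: dist_norm cos_lift_def less_imp_le)
        then show "cmod ((cos_lift (S M) t - cos_lift g t) * of_real (cos (real m * t))) \<le> e / pi"
          by (simp add: norm_mult)
      qed (auto intro!: integrable_continuous_real continuous_intros continuous_cos_lift contS contg)
      also have "\<dots> = e" by simp
      finally show ?thesis by simp
    qed
    then have "cmod (integral {0..pi} (\<lambda>t. cos_lift d t * of_real (cos (real m * t)))) \<le> 0"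
      by (rule field_le_epsilon)
    then show ?thesis by simp
  qed
  from zero_if_cos_moments_zero[OF contd this x] have "f x = g x" by (simp add: d_def)
  moreover have "summable (\<lambda>n. c n * chebyshev n x)"
    using summable_comparison_test'[OF sm, of 0 "\<lambda>n. c n * chebyshev n x"] bnd by simp
  ultimately show ?thesis unfolding g_def by (simp add: summable_sums)
qed

section \<open>Reduction to Chebyshev polynomials\<close>
lemma sobolev_partial_sum_le:
  assumes "\<phi> \<in> per_sobolev r" "finite A" "0 \<notin> A"
  shows "(\<Sum>n\<in>A. real n powr (2 * r) * (cmod (fourier_coeff \<phi> (int n)))\<^sup>2) \<le> (per_sobolev_norm r \<phi>)\<^sup>2"
proof -
  define w where "w n = \<bar>real_of_int n\<bar> powr (2 * r) * (cmod (fourier_coeff \<phi> n))\<^sup>2" for n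
  have sm: "w summable_on {n. n \<noteq> 0}" using assms(1) unfolding per_sobolev_def w_def by simp
  have "(\<Sum>n\<in>A. real n powr (2 * r) * (cmod (fourier_coeff \<phi> (int n)))\<^sup>2) = sum w (int ` A)"
    by (simp add: sum.reindex w_def)
  also have "\<dots> \<le> infsum w {n. n \<noteq> 0}"
    using assms by (intro finite_sum_le_infsum sm) (auto simp: w_def)
  also have "\<dots> \<le> (per_sobolev_norm r \<phi>)\<^sup>2"
  proof -
    have "infsum w {n. n \<noteq> 0} \<ge> 0" by (rule infsum_nonneg) (simp add: w_def)
    then show ?thesis unfolding per_sobolev_norm_def w_def[symmetric]
      by (subst real_sqrt_pow2) (auto intro!: add_nonneg_nonneg)
  qed
  finally show ?thesis .
qed

lemma per_sobolev_norm_nonneg: "per_sobolev_norm r \<phi> \<ge> 0"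
  unfolding per_sobolev_norm_def
  by (intro real_sqrt_ge_zero add_nonneg_nonneg infsum_nonneg) auto

lemma summable_fourier_coeff:
  assumes "\<phi> \<in> per_sobolev r" "r \<ge> 1"
  shows "summable (\<lambda>n. cmod (fourier_coeff \<phi> (int n)))"
proof -
  define F where "F n = cmod (fourier_coeff \<phi> (int n))" for n
  have sq: "summable (\<lambda>n. 1 / real (Suc n) ^ 2)"
    using inverse_power_summable[of 2, where 'a = real] summable_Suc_iff[of "\<lambda>n. inverse (real n ^ 2)"] by (simp add: inverse_eq_divide)
  have "summable (\<lambda>n. real (Suc n) powr (2 * r) * (F (Suc n))\<^sup>2)"
  proof (rule summableI_nonneg_bounded)
    fix M
    have "(\<Sum>n<M. real (Suc n) powr (2 * r) * (F (Suc n))\<^sup>2) =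
        (\<Sum>n\<in>Suc ` {..<M}. real n powr (2 * r) * (F n)\<^sup>2)"
      by (simp add: sum.reindex)
    also have "\<dots> \<le> (per_sobolev_norm r \<phi>)\<^sup>2"
      unfolding F_def by (rule sobolev_partial_sum_le[OF assms(1)]) auto
    finally show "(\<Sum>n<M. real (Suc n) powr (2 * r) * (F (Suc n))\<^sup>2) \<le> (per_sobolev_norm r \<phi>)\<^sup>2" .
  qed simp
  from summable_add[OF sq this]
  have "summable (\<lambda>n. 1 / real (Suc n) ^ 2 + real (Suc n) powr (2 * r) * (F (Suc n))\<^sup>2)" .
  then have "summable (\<lambda>n. F (Suc n))"
  proof (rule summable_comparison_test'[where N = 0])
    fix n
    define u where "u = real (Suc n)"
    have u: "u \<ge> 1" by (simp add: u_def)
    \<comment> \<open>The arithmetic-geometric mean inequality splits \<open>F (Suc n)\<close> into two summable parts.\<close>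
    have "0 \<le> (1 / u - u * F (Suc n))\<^sup>2" by simp
    also have "\<dots> = 1 / u ^ 2 + u ^ 2 * (F (Suc n))\<^sup>2 - 2 * F (Suc n)"
      using u by (simp add: power2_diff power_divide power_mult_distrib)
    finally have "2 * F (Suc n) \<le> 1 / u ^ 2 + u ^ 2 * (F (Suc n))\<^sup>2" by simp
    also have "u ^ 2 = u powr 2" using u by simp
    also have "u powr 2 * (F (Suc n))\<^sup>2 \<le> u powr (2 * r) * (F (Suc n))\<^sup>2"
      using u assms(2) by (intro mult_right_mono powr_mono) auto
    also have "u powr 2 = u ^ 2" using u by simp
    finally have "2 * F (Suc n) \<le> 1 / u ^ 2 + u powr (2 * r) * (F (Suc n))\<^sup>2" by simp
    moreover have "0 \<le> F (Suc n)" by (simp add: F_def)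
    ultimately show "norm (F (Suc n)) \<le> 1 / real (Suc n) ^ 2 + real (Suc n) powr (2 * r) * (F (Suc n))\<^sup>2"
      unfolding u_def by simp
  qed
  then have "summable F" by (simp only: summable_Suc_iff)
  then show ?thesis by (simp add: F_def[abs_def])
qed

lemma powr_square: "(x powr r)\<^sup>2 = x powr (2 * r)" for x :: real
  unfolding power2_eq_square powr_add[symmetric] by simp

text \<open>
  Factoring \<open>N powr (-r)\<close> out of the weights leaves \<open>(N / n) powr r\<close>, which only grows when \<open>r\<close> is
  lowered to \<open>r0\<close>. This is what makes the final constants independent of \<open>r\<close>.
\<close>
lemma weighted_cauchy_schwarz:
  fixes a e :: "nat \<Rightarrow> complex"
  assumes N: "N \<ge> 1" and r: "r0 \<le> r" and "P \<ge> 0" "K \<ge> 0"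
    and a: "(\<Sum>n\<in>{N<..<M}. real n powr (2 * r) * (cmod (a n))\<^sup>2) \<le> P\<^sup>2"
    and e: "(\<Sum>n\<in>{N<..<M}. (real N / real n) powr (2 * r0) * (cmod (e n))\<^sup>2) \<le> K\<^sup>2"
  shows "cmod (\<Sum>n\<in>{N<..<M}. a n * e n) \<le> K * real N powr (- r) * P"
proof -
  define A where "A n = real n powr r * cmod (a n)" for n
  define E where "E n = (real N / real n) powr r * cmod (e n)" for n
  have ae: "cmod (a n * e n) = real N powr (- r) * (A n * E n)" if "n \<in> {N<..<M}" for n
  proof -
    have n: "real n > 0" "real N > 0" using that N by auto
    have "real n powr r * (real N / real n) powr r = (real n * (real N / real n)) powr r"
      by (simp only: powr_mult)
    also have "real n * (real N / real n) = real N" using n by simp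
    finally have "real N powr (- r) * (real n powr r * (real N / real n) powr r) = 1"
      using n by (simp add: powr_minus)
    then have "cmod (a n * e n) = (real N powr (- r) * (real n powr r * (real N / real n) powr r)) * (cmod (a n) * cmod (e n))"
      by (simp add: norm_mult)
    then show ?thesis unfolding A_def E_def by (simp only: mult_ac)
  qed
  have A2: "(\<Sum>n\<in>{N<..<M}. (A n)\<^sup>2) \<le> P\<^sup>2"
  proof -
    have "(A n)\<^sup>2 = real n powr (2 * r) * (cmod (a n))\<^sup>2" for n
      by (simp add: A_def power_mult_distrib powr_square)
    then show ?thesis using a by simp
  qed
  have E2: "(\<Sum>n\<in>{N<..<M}. (E n)\<^sup>2) \<le> K\<^sup>2"
  proof (rule order.trans[OF sum_mono e])
    fix n assume n: "n \<in> {N<..<M}"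
    have "(E n)\<^sup>2 = (real N / real n) powr (2 * r) * (cmod (e n))\<^sup>2"
      by (simp add: E_def power_mult_distrib powr_square)
    also have "\<dots> \<le> (real N / real n) powr (2 * r0) * (cmod (e n))\<^sup>2"
      using n N r by (intro mult_right_mono powr_mono') auto
    finally show "(E n)\<^sup>2 \<le> (real N / real n) powr (2 * r0) * (cmod (e n))\<^sup>2" .
  qed
  have "(\<Sum>n\<in>{N<..<M}. A n * E n)\<^sup>2 \<le> (\<Sum>n\<in>{N<..<M}. (A n)\<^sup>2) * (\<Sum>n\<in>{N<..<M}. (E n)\<^sup>2)"
    by (rule Cauchy_Schwarz_ineq_sum)
  also have "\<dots> \<le> P\<^sup>2 * K\<^sup>2" by (rule mult_mono[OF A2 E2]) (simp_all add: sum_nonneg)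
  also have "\<dots> = (P * K)\<^sup>2" by (rule power_mult_distrib[symmetric])
  finally have le: "(\<Sum>n\<in>{N<..<M}. A n * E n) \<le> P * K"
    by (rule power2_le_imp_le) (use assms(3,4) in simp)
  have "cmod (\<Sum>n\<in>{N<..<M}. a n * e n) \<le> (\<Sum>n\<in>{N<..<M}. cmod (a n * e n))" by (rule norm_sum)
  also have "\<dots> = real N powr (- r) * (\<Sum>n\<in>{N<..<M}. A n * E n)"
    unfolding sum_distrib_left by (rule sum.cong[OF refl ae])
  also have "\<dots> \<le> real N powr (- r) * (P * K)"
    by (rule mult_left_mono[OF le]) simp
  finally show ?thesis by (simp add: mult_ac)
qed

abbreviation error_energy :: "real \<Rightarrow> real \<Rightarrow> nat \<Rightarrow> real \<Rightarrow> nat \<Rightarrow> real"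
  where "error_energy s k N r M \<equiv>
    (\<Sum>n\<in>{N<..<M}. (real N / real n) powr (2 * r) * (cmod (cheb_error s k N n))\<^sup>2)"

lemma rule_error_bound_from_chebyshev:
  assumes s: "s \<in> {0..pi}" and N: "N \<ge> 1" and r: "1 \<le> r" "r0 \<le> r" and f: "lift_in_sobolev r f"
    and K: "K \<ge> 0" "\<And>M. error_energy s k N r0 M \<le> K\<^sup>2"
  shows "cmod (rule_error s k N f) \<le> 2 * K * real N powr (- r) * per_sobolev_norm r (cos_lift f)"
proof -
  define F where "F n = fourier_coeff (cos_lift f) (int n)" for n
  define c where "c n = (if n = 0 then 1 else 2) * F n" for n
  define e where "e n = cheb_error s k N n" for n
  have cont: "continuous_on {-1..1} f" and sob: "cos_lift f \<in> per_sobolev r"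
    using f by (auto simp: lift_in_sobolev_def)
  have F: "summable (\<lambda>n. cmod (F n))" unfolding F_def by (rule summable_fourier_coeff[OF sob r(1)])
  have c: "summable (\<lambda>n. cmod (c n))"
    by (rule summable_comparison_test'[OF summable_mult[OF F, of 2], of 0]) (auto simp: c_def norm_mult)
  have "(\<lambda>n. c n * e n) sums rule_error s k N f"
    unfolding e_def
    by (rule rule_error_uniform_series[OF s N cont c])
       (rule cosine_series_sums[OF cont _ c], auto simp: c_def F_def)
  then have lim: "(\<lambda>M. cmod (\<Sum>n<M. c n * e n)) \<longlonglongrightarrow> cmod (rule_error s k N f)"
    unfolding sums_def by (rule tendsto_norm)
  have "cmod (\<Sum>n<M. c n * e n) \<le> 2 * K * real N powr (- r) * per_sobolev_norm r (cos_lift f)" for M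
  proof -
    have "(\<Sum>n<M. c n * e n) = (\<Sum>n\<in>{N<..<M}. c n * e n)"
    proof (rule sum.mono_neutral_right)
      show "\<forall>n\<in>{..<M} - {N<..<M}. c n * e n = 0"
        using N by (auto simp: e_def rule_error_chebyshev[OF s N] alias_index_self)
    qed auto
    also have "\<dots> = 2 * (\<Sum>n\<in>{N<..<M}. F n * e n)"
      unfolding sum_distrib_left by (rule sum.cong) (auto simp: c_def)
    also have "cmod \<dots> = 2 * cmod (\<Sum>n\<in>{N<..<M}. F n * e n)" by (simp add: norm_mult)
    also have "\<dots> \<le> 2 * (K * real N powr (- r) * per_sobolev_norm r (cos_lift f))"
      unfolding F_def using K
      by (intro mult_left_mono weighted_cauchy_schwarz[OF N r(2) per_sobolev_norm_nonneg]
          sobolev_partial_sum_le[OF sob]) (auto simp: e_def)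
    finally show ?thesis by simp
  qed
  then show ?thesis by (intro LIMSEQ_le_const2[OF lim]) auto
qed

section \<open>Sums over aliased frequencies and Bessel's inequality\<close>
lemma alias_index_block:
  assumes "N \<ge> 1" "i < 2 * N"
  shows "alias_index N ((2 * Q + 1) * N + i) = nat \<bar>int i - int N\<bar>"
proof -
  have "(2 * Q + 1) * N + i + N = i + (Q + 1) * (2 * N)" by simp
  then have "((2 * Q + 1) * N + i + N) mod (2 * N) = i" using assms by (simp only: mod_mult_self1) simp
  then show ?thesis by (simp add: alias_index_def)
qed

text \<open>
  Within a period of \<open>2 N\<close> frequencies the alias index runs down from \<open>N\<close> to 0 and up to \<open>N - 1\<close>.
\<close>
lemma alias_block_sum_le:
  fixes a :: "nat \<Rightarrow> real"
  assumes N: "N \<ge> 1" and a: "\<And>m. a m \<ge> 0" "(\<Sum>m\<le>N. a m) \<le> B"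
  shows "(\<Sum>n\<in>{(2*Q+1)*N..<(2*Q+3)*N}. a (alias_index N n)) \<le> 2 * B"
proof -
  have "(\<Sum>n\<in>{(2*Q+1)*N..<(2*Q+3)*N}. a (alias_index N n)) = (\<Sum>i<2*N. a (alias_index N ((2*Q+1)*N + i)))"
    by (rule sum.reindex_bij_witness[of _ "\<lambda>i. (2*Q+1)*N + i" "\<lambda>n. n - (2*Q+1)*N"]) (auto simp: algebra_simps)
  also have "\<dots> = (\<Sum>i<2*N. a (nat \<bar>int i - int N\<bar>))"
    by (intro sum.cong arg_cong[of _ _ a] alias_index_block N) auto
  also have "\<dots> = (\<Sum>i\<in>{..<N}. a (nat \<bar>int i - int N\<bar>)) + (\<Sum>i\<in>{N..<2*N}. a (nat \<bar>int i - int N\<bar>))"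
    by (subst sum.union_disjoint[symmetric]) (auto intro!: sum.cong)
  also have "(\<Sum>i\<in>{..<N}. a (nat \<bar>int i - int N\<bar>)) = (\<Sum>m\<in>{1..N}. a m)"
    by (rule sum.reindex_bij_witness[of _ "\<lambda>m. N - m" "\<lambda>i. N - i"]) (auto intro!: arg_cong[of _ _ a])
  also have "(\<Sum>i\<in>{N..<2*N}. a (nat \<bar>int i - int N\<bar>)) = (\<Sum>m\<in>{..<N}. a m)"
    by (rule sum.reindex_bij_witness[of _ "\<lambda>m. N + m" "\<lambda>i. i - N"]) (auto intro!: arg_cong[of _ _ a])
  also have "(\<Sum>m\<in>{1..N}. a m) \<le> (\<Sum>m\<le>N. a m)" using a by (intro sum_mono2) auto
  also have "(\<Sum>m\<in>{..<N}. a m) \<le> (\<Sum>m\<le>N. a m)" using a by (intro sum_mono2) auto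
  finally show ?thesis using a(2) by linarith
qed

text \<open>
  The frequencies in block \<open>Q\<close> are at least \<open>(2 Q + 1) N\<close>, so the blocks contribute at most \<open>2 B\<close> times
  the convergent series of \<open>1 / (2 Q + 1)\<^sup>2\<close>.
\<close>
lemma alias_sum_le:
  fixes a :: "nat \<Rightarrow> real"
  assumes N: "N \<ge> 1" and a: "\<And>m. a m \<ge> 0" "(\<Sum>m\<le>N. a m) \<le> B"
  shows "(\<Sum>n\<in>{N<..<M}. (real N / real n)\<^sup>2 * a (alias_index N n)) \<le> 4 * B"
proof -
  define g where "g n = (real N / real n)\<^sup>2 * a (alias_index N n)" for n
  have g: "g n \<ge> 0" for n using a by (simp add: g_def)
  have B: "B \<ge> 0" by (rule order.trans[OF sum_nonneg a(2)]) (rule a(1))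
  have block: "(\<Sum>n\<in>{(2*Q+1)*N..<(2*Q+3)*N}. g n) \<le> 2 * B / (2 * real Q + 1)\<^sup>2" for Q
  proof -
    have "(\<Sum>n\<in>{(2*Q+1)*N..<(2*Q+3)*N}. g n) \<le>
        (\<Sum>n\<in>{(2*Q+1)*N..<(2*Q+3)*N}. (1 / (2 * real Q + 1))\<^sup>2 * a (alias_index N n))"
      unfolding g_def
    proof (intro sum_mono mult_right_mono power_mono a)
      fix n assume n: "n \<in> {(2*Q+1)*N..<(2*Q+3)*N}"
      then have "real ((2*Q+1)*N) \<le> real n" by (simp only: of_nat_le_iff) simp
      then have le: "(2 * real Q + 1) * real N \<le> real n" by (simp add: algebra_simps)
      have "0 < (2 * real Q + 1) * real N" using N by simp
      then have "0 < real n" using le by linarith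
      then show "real N / real n \<le> 1 / (2 * real Q + 1)"
        using le by (simp add: field_simps)
    qed auto
    also have "\<dots> = (1 / (2 * real Q + 1))\<^sup>2 * (\<Sum>n\<in>{(2*Q+1)*N..<(2*Q+3)*N}. a (alias_index N n))"
      by (simp add: sum_distrib_left)
    also have "\<dots> \<le> (1 / (2 * real Q + 1))\<^sup>2 * (2 * B)"
      by (intro mult_left_mono alias_block_sum_le[OF N a]) auto
    finally show ?thesis by (simp add: power_divide)
  qed
  \<comment> \<open>The subtracted \<open>1 / Suc Q\<close> makes the bound on the partial sums inductive.\<close>
  have "(\<Sum>n\<in>{N..<(2*Suc Q+1)*N}. g n) \<le> 2 * B * (2 - 1 / real (Suc Q))" for Q
  proof (induction Q)
    case 0
    show ?case using block[of 0] by simp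
  next
    case (Suc Q)
    have "(\<Sum>n\<in>{N..<(2*Suc (Suc Q)+1)*N}. g n) =
        (\<Sum>n\<in>{N..<(2*Suc Q+1)*N}. g n) + (\<Sum>n\<in>{(2*Suc Q+1)*N..<(2*Suc Q+3)*N}. g n)"
      by (subst sum.atLeastLessThan_concat) (auto simp: algebra_simps)
    also have "\<dots> \<le> 2 * B * (2 - 1 / real (Suc Q)) + 2 * B / (2 * real (Suc Q) + 1)\<^sup>2"
      by (intro add_mono Suc block)
    also have "\<dots> = 2 * B * (2 - 1 / real (Suc Q) + 1 / (2 * real (Suc Q) + 1)\<^sup>2)"
      by (simp add: algebra_simps)
    also have "\<dots> \<le> 2 * B * (2 - 1 / real (Suc (Suc Q)))"
    proof (intro mult_left_mono)
      define q where "q = real (Suc Q)"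
      have q: "q > 0" by (simp add: q_def)
      have "1 / (2 * q + 1)\<^sup>2 \<le> 1 / (q * (q + 1))"
        using q by (intro frac_le) (auto simp: power2_eq_square algebra_simps intro!: add_pos_nonneg)
      also have "\<dots> = 1 / q - 1 / (q + 1)" using q by (simp add: field_simps)
      finally show "2 - 1 / real (Suc Q) + 1 / (2 * real (Suc Q) + 1)\<^sup>2 \<le> 2 - 1 / real (Suc (Suc Q))"
        unfolding q_def by (simp add: add.commute)
    qed (use B in auto)
    finally show ?case .
  qed
  note bnd = this[of M]
  have "M \<le> (2 * Suc M + 1) * N"
    using mult_le_mono[of M "2 * Suc M + 1" 1 N] N by simp
  then have "(\<Sum>n\<in>{N<..<M}. g n) \<le> (\<Sum>n\<in>{N..<(2*Suc M+1)*N}. g n)"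
    using g by (intro sum_mono2) auto
  also have "\<dots> \<le> 2 * B * (2 - 1 / real (Suc M))" by (rule bnd)
  also have "\<dots> \<le> 2 * B * 2" using B by (intro mult_left_mono) auto
  finally show ?thesis unfolding g_def by simp
qed

text \<open>
  Expand the integral of \<open>(h - p / \<pi>)\<^sup>2 \<ge> 0\<close>, where \<open>p\<close> is the combination of the \<open>\<phi> n\<close> whose
  coefficients are the integrals of \<open>\<phi> n * h\<close>. An upper bound on the norms of the \<open>\<phi> n\<close> is
  enough, so the constant function and the other cosines are treated alike.
\<close>
lemma bessel_inequality:
  fixes \<phi> :: "nat \<Rightarrow> real \<Rightarrow> real" and h :: "real \<Rightarrow> real"
  assumes A: "finite A"
    and cont: "\<And>n. continuous_on {0..pi} (\<phi> n)"
    and orth: "\<And>m n. m \<in> A \<Longrightarrow> n \<in> A \<Longrightarrow> m \<noteq> n \<Longrightarrow> integral {0..pi} (\<lambda>t. \<phi> m t * \<phi> n t) = 0"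
    and norm: "\<And>n. n \<in> A \<Longrightarrow> integral {0..pi} (\<lambda>t. \<phi> n t * \<phi> n t) \<le> pi"
    and h: "h absolutely_integrable_on {0..pi}" "(\<lambda>t. (h t)\<^sup>2) absolutely_integrable_on {0..pi}"
  shows "(\<Sum>n\<in>A. (integral {0..pi} (\<lambda>t. \<phi> n t * h t))\<^sup>2) \<le> pi * integral {0..pi} (\<lambda>t. (h t)\<^sup>2)"
proof -
  define c where "c n = integral {0..pi} (\<lambda>t. \<phi> n t * h t)" for n
  define p where "p t = (\<Sum>n\<in>A. c n * \<phi> n t)" for t
  define C where "C = (\<Sum>n\<in>A. (c n)\<^sup>2)"
  have contp: "continuous_on {0..pi} p" unfolding p_def by (intro continuous_intros cont)
  have \<phi>h: "(\<lambda>t. \<phi> n t * h t) integrable_on {0..pi}" for n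
    by (intro integrable_of_absolutely absolutely_integrable_mult_continuous_real h cont)
  have ph: "(\<lambda>t. p t * h t) integrable_on {0..pi}"
    by (intro integrable_of_absolutely absolutely_integrable_mult_continuous_real h contp)
  have pp: "(\<lambda>t. p t * p t) integrable_on {0..pi}"
    by (intro integrable_continuous_real continuous_intros contp)
  have hh: "(\<lambda>t. (h t)\<^sup>2) integrable_on {0..pi}" using h(2) by (rule integrable_of_absolutely)
  have iph: "integral {0..pi} (\<lambda>t. p t * h t) = C"
  proof -
    have "integral {0..pi} (\<lambda>t. p t * h t) = integral {0..pi} (\<lambda>t. \<Sum>n\<in>A. c n * (\<phi> n t * h t))"
      by (simp add: p_def sum_distrib_right mult.assoc)
    also have "\<dots> = (\<Sum>n\<in>A. integral {0..pi} (\<lambda>t. c n * (\<phi> n t * h t)))"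
      by (rule integral_sum[OF A]) (intro integrable_on_mult_right \<phi>h)
    also have "\<dots> = C" by (simp add: C_def c_def power2_eq_square)
    finally show ?thesis .
  qed
  have ipp: "integral {0..pi} (\<lambda>t. p t * p t) \<le> pi * C"
  proof -
    have i\<phi>: "(\<lambda>t. \<phi> m t * \<phi> n t) integrable_on {0..pi}" for m n
      by (intro integrable_continuous_real continuous_intros cont)
    have "integral {0..pi} (\<lambda>t. p t * p t) = integral {0..pi} (\<lambda>t. \<Sum>m\<in>A. \<Sum>n\<in>A. (c m * c n) * (\<phi> m t * \<phi> n t))"
      unfolding p_def sum_product by (simp add: mult_ac)
    also have "\<dots> = (\<Sum>m\<in>A. integral {0..pi} (\<lambda>t. \<Sum>n\<in>A. (c m * c n) * (\<phi> m t * \<phi> n t)))"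
      by (rule integral_sum[OF A]) (intro integrable_sum A integrable_on_mult_right i\<phi>)
    also have "\<dots> = (\<Sum>m\<in>A. \<Sum>n\<in>A. integral {0..pi} (\<lambda>t. (c m * c n) * (\<phi> m t * \<phi> n t)))"
      by (intro sum.cong refl integral_sum A integrable_on_mult_right i\<phi>)
    also have "\<dots> = (\<Sum>m\<in>A. \<Sum>n\<in>A. if n = m then (c m)\<^sup>2 * integral {0..pi} (\<lambda>t. \<phi> m t * \<phi> m t) else 0)"
      by (intro sum.cong refl) (auto simp: orth power2_eq_square)
    also have "\<dots> = (\<Sum>m\<in>A. (c m)\<^sup>2 * integral {0..pi} (\<lambda>t. \<phi> m t * \<phi> m t))"
      using A by simp
    also have "\<dots> \<le> (\<Sum>m\<in>A. (c m)\<^sup>2 * pi)"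
      by (intro sum_mono mult_left_mono norm) auto
    finally show ?thesis by (simp add: C_def sum_distrib_left mult.commute)
  qed
  have "0 \<le> integral {0..pi} (\<lambda>t. (h t)\<^sup>2 - 2 / pi * (p t * h t) + 1 / pi\<^sup>2 * (p t * p t))"
  proof (rule integral_nonneg)
    show "(\<lambda>t. (h t)\<^sup>2 - 2 / pi * (p t * h t) + 1 / pi\<^sup>2 * (p t * p t)) integrable_on {0..pi}"
      by (intro integrable_add integrable_diff integrable_on_mult_right hh ph pp)
    fix t
    have "(h t)\<^sup>2 - 2 / pi * (p t * h t) + 1 / pi\<^sup>2 * (p t * p t) = (h t - p t / pi)\<^sup>2"
      by (simp add: power2_diff power_divide) (simp add: power2_eq_square field_simps)
    then show "0 \<le> (h t)\<^sup>2 - 2 / pi * (p t * h t) + 1 / pi\<^sup>2 * (p t * p t)" by simp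
  qed
  also have "\<dots> = integral {0..pi} (\<lambda>t. (h t)\<^sup>2) - 2 / pi * C + 1 / pi\<^sup>2 * integral {0..pi} (\<lambda>t. p t * p t)"
    using hh ph pp by (simp only: integral_add integral_diff integrable_diff integrable_on_mult_right
        integral_mult_right iph)
  also have "\<dots> \<le> integral {0..pi} (\<lambda>t. (h t)\<^sup>2) - 2 / pi * C + 1 / pi\<^sup>2 * (pi * C)"
    by (intro add_left_mono mult_left_mono ipp) auto
  also have "\<dots> = integral {0..pi} (\<lambda>t. (h t)\<^sup>2) - C / pi"
    by (simp add: power2_eq_square field_simps)
  finally have "C / pi \<le> integral {0..pi} (\<lambda>t. (h t)\<^sup>2)" by simp
  then have "C \<le> pi * integral {0..pi} (\<lambda>t. (h t)\<^sup>2)" by (simp add: field_simps)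
  then show ?thesis by (simp add: C_def c_def)
qed

text \<open>
  The oscillating factor has modulus 1, so the bound does not depend on \<open>k\<close>.
\<close>
lemma bessel_inequality_osc:
  fixes \<phi> :: "nat \<Rightarrow> real \<Rightarrow> real" and w :: "real \<Rightarrow> real"
  assumes A: "finite A"
    and cont: "\<And>n. continuous_on {0..pi} (\<phi> n)"
    and orth: "\<And>m n. m \<in> A \<Longrightarrow> n \<in> A \<Longrightarrow> m \<noteq> n \<Longrightarrow> integral {0..pi} (\<lambda>t. \<phi> m t * \<phi> n t) = 0"
    and norm: "\<And>n. n \<in> A \<Longrightarrow> integral {0..pi} (\<lambda>t. \<phi> n t * \<phi> n t) \<le> pi"
    and w: "w absolutely_integrable_on {0..pi}" "(\<lambda>t. (w t)\<^sup>2) absolutely_integrable_on {0..pi}"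
  shows "(\<Sum>n\<in>A. (cmod (osc_integral k (\<lambda>t. \<phi> n t * w t)))\<^sup>2) \<le>
    pi * integral {0..pi} (\<lambda>t. (w t)\<^sup>2)"
proof -
  define u v where "u t = cos (k * cos t) * w t" and "v t = sin (k * cos t) * w t" for t
  have uv: "u absolutely_integrable_on {0..pi}" "v absolutely_integrable_on {0..pi}"
    unfolding u_def v_def
    by (intro absolutely_integrable_mult_continuous_real w continuous_intros)+
  have uv2: "(\<lambda>t. (u t)\<^sup>2) absolutely_integrable_on {0..pi}" "(\<lambda>t. (v t)\<^sup>2) absolutely_integrable_on {0..pi}"
    unfolding u_def v_def power_mult_distrib
    by (intro absolutely_integrable_mult_continuous_real w continuous_intros)+
  have eq: "(cmod (osc_integral k (\<lambda>t. \<phi> n t * w t)))\<^sup>2 =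
      (integral {0..pi} (\<lambda>t. \<phi> n t * u t))\<^sup>2 + (integral {0..pi} (\<lambda>t. \<phi> n t * v t))\<^sup>2" for n
  proof -
    define I where "I = osc_integral k (\<lambda>t. \<phi> n t * w t)"
    have "(\<lambda>t. of_real (\<phi> n t * w t) * osc k t) absolutely_integrable_on {0..pi}"
      by (intro osc_absolutely_integrable absolutely_integrable_mult_continuous_real w cont)
    then have I: "((\<lambda>t. of_real (\<phi> n t * w t) * osc k t) has_integral I) {0..pi}"
      unfolding I_def by (intro integrable_integral integrable_of_absolutely)
    have "integral {0..pi} (\<lambda>t. \<phi> n t * u t) = Re I"
      using integral_unique[OF has_integral_Re[OF I]] by (simp add: u_def osc_def mult_ac)
    moreover have "integral {0..pi} (\<lambda>t. \<phi> n t * v t) = Im I"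
      using integral_unique[OF has_integral_Im[OF I]] by (simp add: v_def osc_def mult_ac)
    ultimately show ?thesis unfolding I_def[symmetric] by (simp add: cmod_power2)
  qed
  have "(\<Sum>n\<in>A. (cmod (osc_integral k (\<lambda>t. \<phi> n t * w t)))\<^sup>2) \<le>
      pi * integral {0..pi} (\<lambda>t. (u t)\<^sup>2) + pi * integral {0..pi} (\<lambda>t. (v t)\<^sup>2)"
    unfolding eq sum.distrib
    by (intro add_mono bessel_inequality[OF A cont orth norm] uv uv2)
  also have "\<dots> = pi * integral {0..pi} (\<lambda>t. (u t)\<^sup>2 + (v t)\<^sup>2)"
    using integral_add[OF uv2[THEN integrable_of_absolutely]] by (simp add: distrib_left)
  also have "(\<lambda>t. (u t)\<^sup>2 + (v t)\<^sup>2) = (\<lambda>t. (w t)\<^sup>2)"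
  proof
    fix t
    have "(u t)\<^sup>2 + (v t)\<^sup>2 = ((cos (k * cos t))\<^sup>2 + (sin (k * cos t))\<^sup>2) * (w t)\<^sup>2"
      by (simp only: u_def v_def power_mult_distrib distrib_right)
    then show "(u t)\<^sup>2 + (v t)\<^sup>2 = (w t)\<^sup>2" by simp
  qed
  finally show ?thesis .
qed

section \<open>Estimates of first order in the wave number\<close>
definition alias_diff :: "nat \<Rightarrow> nat \<Rightarrow> real \<Rightarrow> real"
  where "alias_diff N n t = cos (real n * t) - cos (real (alias_index N n) * t)"

definition alias_diff' :: "nat \<Rightarrow> nat \<Rightarrow> real \<Rightarrow> real"
  where "alias_diff' N n t = real (alias_index N n) * sin (real (alias_index N n) * t) - real n * sin (real n * t)"

lemma alias_diff_derivative: "(alias_diff N n has_real_derivative alias_diff' N n t) (at t)"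
  unfolding alias_diff_def[abs_def] alias_diff'_def by (auto intro!: derivative_eq_intros)

lemma continuous_alias_diff: "continuous_on S (alias_diff N n)" "continuous_on S (alias_diff' N n)"
  unfolding alias_diff_def[abs_def] alias_diff'_def[abs_def] by (intro continuous_intros)+

lemma abs_alias_diff_le: "\<bar>alias_diff N n t\<bar> \<le> 2"
  using abs_cos_le_one[of "real n * t"] abs_cos_le_one[of "real (alias_index N n) * t"]
  unfolding alias_diff_def by linarith

lemma abs_alias_diff'_le:
  assumes "N \<ge> 1" "N \<le> n"
  shows "\<bar>alias_diff' N n t\<bar> \<le> 2 * real n"
proof -
  have "\<bar>real m * sin (real m * t)\<bar> \<le> real n" if "m \<le> n" for m
  proof -
    have "\<bar>real m * sin (real m * t)\<bar> \<le> real m * 1"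
      unfolding abs_mult by (intro mult_mono) auto
    then show ?thesis using that by simp
  qed
  from this[of n] this[of "alias_index N n"] show ?thesis
    using alias_index_le[OF assms(1), of n] assms(2) unfolding alias_diff'_def by simp
qed

lemma alias_diff_node: "N \<ge> 1 \<Longrightarrow> alias_diff N n (real j * pi / real N) = 0"
  using cos_alias_index[of N n j] by (simp add: alias_diff_def)

lemma alias_diff_0 [simp]: "alias_diff N n 0 = 0"
  by (simp add: alias_diff_def)

lemma alias_diff_pi: "N \<ge> 1 \<Longrightarrow> alias_diff N n pi = 0"
  using alias_diff_node[of N n N] by simp

lemma rule_error_chebyshev_eq:
  assumes s: "s \<in> {0..pi}" and N: "N \<ge> 1"
  shows "cheb_error s k N n =
    osc_integral k (\<lambda>t. alias_diff N n t * log_kernel s t * sin t)"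
proof -
  have "(\<lambda>t. of_real (cos (real m * t)) * (of_real (log_kernel s t * sin t) * osc k t)) integrable_on {0..pi}" for m
  proof -
    have "(\<lambda>t. of_real (cos (real m * t) * (log_kernel s t * sin t)) * osc k t) absolutely_integrable_on {0..pi}"
      by (intro osc_absolutely_integrable absolutely_integrable_mult_continuous_real
          log_kernel_sin_absolutely_integrable s continuous_intros)
    then show ?thesis using integrable_of_absolutely by (fastforce simp: mult.assoc)
  qed
  from integral_diff[OF this[of n] this[of "alias_index N n"]] show ?thesis
    unfolding rule_error_chebyshev[OF s N] log_osc_integral_chebyshev[OF s]
    by (simp add: alias_diff_def algebra_simps)
qed

lemma weight_one_square: "(real N / real n) powr (2 * 1) = (real N / real n)\<^sup>2"
  by (cases "N = 0 \<or> n = 0") (auto simp: powr_numeral)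

text \<open>
  The same constant serves all \<open>k\<close>, \<open>N\<close> and \<open>M\<close>; a bound on the single errors would lose a factor
  \<open>N powr (1/2)\<close> here.
\<close>
lemma chebyshev_errors_square_summable:
  assumes s: "s \<in> {0..pi}"
  shows "\<exists>B\<ge>0. \<forall>k N M. N \<ge> 1 \<longrightarrow> error_energy s k N 1 M \<le> B\<^sup>2"
proof -
  define w where "w t = log_kernel s t * sin t" for t
  have w: "w absolutely_integrable_on {0..pi}"
    unfolding w_def by (rule log_kernel_sin_absolutely_integrable[OF s])
  have w2: "(\<lambda>t. (w t)\<^sup>2) absolutely_integrable_on {0..pi}"
  proof -
    have "(\<lambda>t. (sin t)\<^sup>2 * (log_kernel s t)\<^sup>2) absolutely_integrable_on {0..pi}"
      by (intro absolutely_integrable_mult_continuous_real log_kernel_square_absolutely_integrable s continuous_intros)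
    then show ?thesis by (simp add: w_def power_mult_distrib mult.commute)
  qed
  define B0 where "B0 = pi * integral {0..pi} (\<lambda>t. (w t)\<^sup>2)"
  have B0: "B0 \<ge> 0" unfolding B0_def using w2 by (intro mult_nonneg_nonneg integral_nonneg integrable_of_absolutely) auto
  have bound: "error_energy s k N 1 M \<le> 10 * B0"
    if N: "N \<ge> 1" for k N M
  proof -
    define J where "J n = log_osc_integral (cos s) k (chebyshev n)" for n
    have J: "J n = osc_integral k (\<lambda>t. cos (real n * t) * w t)" for n
      unfolding J_def log_osc_integral_chebyshev[OF s] w_def by (simp add: mult.assoc)
    have bessel: "(\<Sum>n\<in>A. (cmod (J n))\<^sup>2) \<le> B0" if "finite A" for A
      unfolding J B0_def
      by (rule bessel_inequality_osc[OF that _ _ _ w w2])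
         (auto intro!: continuous_intros simp: integral_cos_cos)
    have "error_energy s k N 1 M
        \<le> (\<Sum>n\<in>{N<..<M}. 2 * (cmod (J n))\<^sup>2 + 2 * ((real N / real n)\<^sup>2 * (cmod (J (alias_index N n)))\<^sup>2))"
    proof (rule sum_mono)
      fix n assume n: "n \<in> {N<..<M}"
      have q: "(real N / real n)\<^sup>2 \<le> 1" using n by (simp add: power_le_one)
      have "(cmod (J n - J (alias_index N n)))\<^sup>2 \<le> (cmod (J n) + cmod (J (alias_index N n)))\<^sup>2"
        by (intro power_mono norm_triangle_ineq4) auto
      also have "\<dots> \<le> 2 * (cmod (J n))\<^sup>2 + 2 * (cmod (J (alias_index N n)))\<^sup>2"
        using sum_squares_bound[of "cmod (J n)" "cmod (J (alias_index N n))"]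
        by (simp add: power2_sum)
      finally have "(real N / real n)\<^sup>2 * (cmod (J n - J (alias_index N n)))\<^sup>2 \<le>
          (real N / real n)\<^sup>2 * (2 * (cmod (J n))\<^sup>2 + 2 * (cmod (J (alias_index N n)))\<^sup>2)"
        by (rule mult_left_mono) simp
      also have "\<dots> \<le> 2 * (cmod (J n))\<^sup>2 + 2 * ((real N / real n)\<^sup>2 * (cmod (J (alias_index N n)))\<^sup>2)"
        using mult_right_mono[OF q, of "2 * (cmod (J n))\<^sup>2"] by (simp add: algebra_simps)
      finally show "(real N / real n) powr (2 * 1) * (cmod (cheb_error s k N n))\<^sup>2 \<le>
        2 * (cmod (J n))\<^sup>2 + 2 * ((real N / real n)\<^sup>2 * (cmod (J (alias_index N n)))\<^sup>2)"
        unfolding rule_error_chebyshev[OF s N] J_def[symmetric] weight_one_square .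
    qed
    also have "\<dots> = 2 * (\<Sum>n\<in>{N<..<M}. (cmod (J n))\<^sup>2) +
        2 * (\<Sum>n\<in>{N<..<M}. (real N / real n)\<^sup>2 * (cmod (J (alias_index N n)))\<^sup>2)"
      by (simp add: sum.distrib sum_distrib_left)
    also have "\<dots> \<le> 2 * B0 + 2 * (4 * B0)"
      by (intro add_mono mult_left_mono bessel alias_sum_le[OF N]) auto
    finally show ?thesis by simp
  qed
  then show ?thesis using B0 by (intro exI[of _ "sqrt (10 * B0)"]) auto
qed

text \<open>
  Interpolates between \<open>\<bar>B t - B s\<bar> \<le> b\<close> and \<open>\<bar>B t - B s\<bar> \<le> K * \<bar>t - s\<bar>\<close>, using
  \<open>min 1 z \<le> z powr (1/4)\<close>. Any exponent strictly between 0 and \<open>1/2\<close> would do below: it has to be positive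
  to remove the pole, and its double must stay below 1 for the sum over \<open>n\<close> to converge.
\<close>
lemma increment_quotient_integral_le:
  fixes b K :: real
  assumes s: "s \<in> {0..pi}" and der: "\<And>t. (B has_real_derivative B' t) (at t)"
    and B': "continuous_on UNIV B'" "\<And>t. t \<in> {0..pi} \<Longrightarrow> \<bar>B' t\<bar> \<le> K"
    and b: "\<And>t. \<bar>B t - B s\<bar> \<le> b" and Kb: "0 < b" "0 \<le> K"
  shows "integral {0..pi} (\<lambda>t. \<bar>(B t - B s) * sin t / (cos t - cos s)\<bar>) \<le>
    pi * b * (K / b) powr (1/4) * integral {0..pi} (\<lambda>t. \<bar>t - s\<bar> powr (- (3/4)))"
proof -
  have int: "(\<lambda>t. \<bar>t - s\<bar> powr (- (3/4))) integrable_on {0..pi}"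
    using dist_powr_absolutely_integrable[of "3/4" s] s by (intro integrable_of_absolutely) auto
  have "integral {0..pi} (\<lambda>t. \<bar>(B t - B s) * sin t / (cos t - cos s)\<bar>) \<le>
    integral {0..pi} (\<lambda>t. pi * b * (K / b) powr (1/4) * \<bar>t - s\<bar> powr (- (3/4)))"
  proof (rule integral_le)
    show "(\<lambda>t. \<bar>(B t - B s) * sin t / (cos t - cos s)\<bar>) integrable_on {0..pi}"
      using increment_quotient_absolutely_integrable[OF s der B'(1,2)]
      by (simp add: absolutely_integrable_on_def)
    show "(\<lambda>t. pi * b * (K / b) powr (1/4) * \<bar>t - s\<bar> powr (- (3/4))) integrable_on {0..pi}"
      by (intro integrable_on_mult_right int)
    fix t assume t: "t \<in> {0..pi}"
    define u where "u = \<bar>t - s\<bar>"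
    define D where "D = sin t / \<bar>cos t - cos s\<bar>"
    have D0: "D \<ge> 0" using t by (simp add: D_def sin_ge_zero)
    have uD: "u * D \<le> pi" using dist_sin_over_cos_diff_le[OF t s] by (simp add: u_def D_def)
    have eq: "\<bar>(B t - B s) * sin t / (cos t - cos s)\<bar> = \<bar>B t - B s\<bar> * D"
      using t by (simp add: D_def abs_mult sin_ge_zero)
    show "\<bar>(B t - B s) * sin t / (cos t - cos s)\<bar> \<le> pi * b * (K / b) powr (1/4) * \<bar>t - s\<bar> powr (- (3/4))"
    proof (cases "t = s")
      case False
      then have u: "u > 0" by (simp add: u_def)
      have "\<bar>B t - B s\<bar> \<le> b * (K / b * u) powr (1/4)"
      proof (cases "1 \<le> K / b * u")
        case True
        then have "1 \<le> (K / b * u) powr (1/4)" by (rule ge_one_powr_ge_zero) simp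
        then have "b * 1 \<le> b * (K / b * u) powr (1/4)" using Kb by (intro mult_left_mono) auto
        then show ?thesis using b[of t] by simp
      next
        case False
        have n: "0 \<le> K / b * u" using Kb u by simp
        have "\<bar>B t - B s\<bar> \<le> K * u"
          unfolding u_def by (rule increment_bound[OF s der B'(1,2) t s])
        also have "\<dots> = b * (K / b * u)" using Kb by simp
        also have "(K / b * u) \<le> (K / b * u) powr (1/4)"
        proof -
          have "(K / b * u) powr 1 \<le> (K / b * u) powr (1/4)"
            using False n by (intro powr_mono') auto
          moreover have "(K / b * u) powr 1 = K / b * u" using n by (simp only: powr_one_gt_zero_iff abs_of_nonneg powr_one)
          ultimately show ?thesis by simp
        qed
        then have "b * (K / b * u) \<le> b * (K / b * u) powr (1/4)" using Kb by (intro mult_left_mono) auto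
        finally show ?thesis .
      qed
      then have "\<bar>B t - B s\<bar> * D \<le> b * (K / b * u) powr (1/4) * (pi / u)"
        using uD u D0 Kb by (intro mult_mono) (auto simp: field_simps)
      also have "(K / b * u) powr (1/4) = (K / b) powr (1/4) * u powr (1/4)"
        by (simp only: powr_mult)
      also have "b * ((K / b) powr (1/4) * u powr (1/4)) * (pi / u) =
          pi * b * (K / b) powr (1/4) * (u powr (1/4) / u)" by simp
      also have "u powr (1/4) / u = u powr (- (3/4))"
      proof -
        have "u powr (1/4) / u powr 1 = u powr (1/4 - 1)" by (rule powr_diff[symmetric])
        then show ?thesis using u by simp
      qed
      finally show ?thesis unfolding eq u_def .
    qed simp
  qed
  also have "\<dots> = pi * b * (K / b) powr (1/4) * integral {0..pi} (\<lambda>t. \<bar>t - s\<bar> powr (- (3/4)))"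
    by simp
  finally show ?thesis .
qed

definition sine_moment :: "real \<Rightarrow> real \<Rightarrow> nat \<Rightarrow> complex"
  where "sine_moment s k n = osc_integral k (\<lambda>t. sin (real n * t) * log_kernel s t)"

lemma sine_moment_bessel:
  assumes s: "s \<in> {0..pi}" and A: "finite A"
  shows "(\<Sum>n\<in>A. (cmod (sine_moment s k n))\<^sup>2) \<le> pi * integral {0..pi} (\<lambda>t. (log_kernel s t)\<^sup>2)"
proof -
  have "(\<Sum>n\<in>A. (cmod (sine_moment s k n))\<^sup>2) = (\<Sum>n\<in>A - {0}. (cmod (sine_moment s k n))\<^sup>2)"
    using A by (intro sum.mono_neutral_right) (auto simp: sine_moment_def)
  also have "\<dots> \<le> pi * integral {0..pi} (\<lambda>t. (log_kernel s t)\<^sup>2)"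
    unfolding sine_moment_def using A
    by (intro bessel_inequality_osc log_kernel_absolutely_integrable log_kernel_square_absolutely_integrable s)
       (auto intro!: continuous_intros simp: integral_sin_sin)
  finally show ?thesis .
qed

text \<open>
  Only the first summand admits an integration by parts; the second has the full singularity, but
  its integral no longer involves \<open>n\<close>.
\<close>
lemma rule_error_chebyshev_split:
  assumes s: "s \<in> {0..pi}" and N: "N \<ge> 1"
  shows "cheb_error s k N n =
    osc_integral k (\<lambda>t. (alias_diff N n t - alias_diff N n s) * log_kernel s t * sin t)
    + of_real (alias_diff N n s) * log_moment s k"
proof -
  have 1: "(\<lambda>t. of_real (log_kernel s t * sin t) * osc k t) integrable_on {0..pi}"
    by (intro integrable_of_absolutely osc_absolutely_integrable log_kernel_sin_absolutely_integrable s)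
  have "(\<lambda>t. of_real ((alias_diff N n t - alias_diff N n s) * (log_kernel s t * sin t)) * osc k t) integrable_on {0..pi}"
    by (intro integrable_of_absolutely osc_absolutely_integrable absolutely_integrable_mult_continuous_real
        log_kernel_sin_absolutely_integrable s continuous_intros continuous_alias_diff)
  from integral_add[OF this integrable_on_mult_right[OF 1, of "of_real (alias_diff N n s)"]]
  have "integral {0..pi} (\<lambda>t. of_real ((alias_diff N n t - alias_diff N n s) * (log_kernel s t * sin t)) * osc k t
        + of_real (alias_diff N n s) * (of_real (log_kernel s t * sin t) * osc k t)) =
      osc_integral k (\<lambda>t. (alias_diff N n t - alias_diff N n s) * log_kernel s t * sin t)
      + of_real (alias_diff N n s) * log_moment s k"
    by (simp only: integral_mult_right log_moment_def mult.assoc)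
  moreover have "of_real ((alias_diff N n t - alias_diff N n s) * (log_kernel s t * sin t)) * osc k t
        + of_real (alias_diff N n s) * (of_real (log_kernel s t * sin t) * osc k t) =
      of_real (alias_diff N n t * log_kernel s t * sin t) * osc k t" for t
    by (simp add: left_diff_distrib mult.assoc)
  ultimately show ?thesis unfolding rule_error_chebyshev_eq[OF s N] by simp
qed

text \<open>
  The terms that grow like \<open>n\<close> are kept as sine moments, because at Sobolev order 1 it takes
  their square summability to sum them over \<open>n\<close>.
\<close>
lemma chebyshev_error_first_order:
  assumes s: "s \<in> {0..pi}"
  shows "\<exists>D\<ge>0. \<forall>k\<ge>1. \<forall>N\<ge>1. \<forall>n>N. k * cmod (cheb_error s k N n) \<le>
    real n * cmod (sine_moment s k n) + real (alias_index N n) * cmod (sine_moment s k (alias_index N n))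
      + D * real n powr (1/4)"
proof -
  define I where "I = integral {0..pi} (\<lambda>t. \<bar>t - s\<bar> powr (- (3/4)))"
  have I: "I \<ge> 0" unfolding I_def using dist_powr_absolutely_integrable[of "3/4" s] s
    by (intro integral_nonneg integrable_of_absolutely) auto
  \<comment> \<open>At the end points the kernel moment decays more slowly than \<open>1/k\<close>, but there the value that
    multiplies it is 0.\<close>
  obtain C where C: "C \<ge> 0" "\<And>k N n. k \<ge> 1 \<Longrightarrow> N \<ge> 1 \<Longrightarrow> \<bar>alias_diff N n s\<bar> * (k * cmod (log_moment s k)) \<le> C"
  proof (cases "s \<in> {0<..<pi}")
    case True
    from log_moment_decay_interior[OF this] obtain C where
      C: "C \<ge> 0" "\<And>k. k \<ge> 1 \<Longrightarrow> k * cmod (log_moment s k) \<le> C" by blast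
    have "\<bar>alias_diff N n s\<bar> * (k * cmod (log_moment s k)) \<le> 2 * C" if "k \<ge> 1" for k N n
      using abs_alias_diff_le C(2)[OF that] that by (intro mult_mono) auto
    then show ?thesis using C(1) that[of "2 * C"] by simp
  next
    case False
    then have "s = 0 \<or> s = pi" using s by auto
    then have "alias_diff N n s = 0" if "N \<ge> 1" for N n
      using alias_diff_pi[OF that] by auto
    then show ?thesis using that[of 0] by simp
  qed
  define D where "D = C + 2 * \<bar>log_kernel s 0\<bar> + 2 * \<bar>log_kernel s pi\<bar> + 8 * pi * I"
  have D: "D \<ge> 0" unfolding D_def using C(1) I by simp
  show ?thesis
  proof (intro exI[of _ D] conjI allI impI D)
    fix k :: real and N n :: nat assume k: "1 \<le> k" and N: "1 \<le> N" and n: "N < n"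
    define m where "m = alias_index N n"
    define Q where "Q = alias_diff N n"
    define Q' where "Q' = alias_diff' N n"
    have der: "(Q has_real_derivative Q' t) (at t)" for t unfolding Q_def Q'_def by (rule alias_diff_derivative)
    have cQ': "continuous_on S Q'" for S unfolding Q'_def by (rule continuous_alias_diff)
    have K: "\<bar>Q' t\<bar> \<le> 2 * real n" for t unfolding Q'_def using N n by (intro abs_alias_diff'_le) auto
    note pre = s der cQ' K
    define g where "g = log_ibp_deriv s Q Q'"
    define dq where "dq t = (Q t - Q s) * sin t / (cos t - cos s)" for t
    have n1: "1 \<le> real n powr (1/4)" using n by (intro ge_one_powr_ge_zero) auto
    have Qs: "\<bar>Q t\<bar> \<le> 2" for t unfolding Q_def by (rule abs_alias_diff_le)
    have ibp: "k * cmod (osc_integral k (\<lambda>t. (Q t - Q s) * log_kernel s t * sin t)) \<le>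
        \<bar>(Q 0 - Q s) * log_kernel s 0\<bar> + \<bar>(Q pi - Q s) * log_kernel s pi\<bar>
        + cmod (osc_integral k g)"
      unfolding g_def using k
      by (intro norm_osc_integral_by_parts[of "{s}"] increment_times_log_kernel_continuous[OF pre]
          increment_times_log_kernel_derivative[OF pre] log_ibp_deriv_absolutely_integrable[OF pre]) auto
    have b0: "\<bar>(Q 0 - Q s) * log_kernel s 0\<bar> \<le> 2 * \<bar>log_kernel s 0\<bar>"
      using Qs[of s] by (simp add: Q_def abs_mult mult_right_mono)
    have b1: "\<bar>(Q pi - Q s) * log_kernel s pi\<bar> \<le> 2 * \<bar>log_kernel s pi\<bar>"
      using Qs[of s] alias_diff_pi[OF N] by (simp add: Q_def abs_mult mult_right_mono)
    have dq: "dq absolutely_integrable_on {0..pi}"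
      unfolding dq_def by (rule increment_quotient_absolutely_integrable[OF pre])
    have dqle: "cmod (osc_integral k dq) \<le> 4 * pi * I * real n powr (1/4)"
    proof -
      have "cmod (osc_integral k dq) \<le> integral {0..pi} (\<lambda>t. \<bar>dq t\<bar>)"
        by (rule norm_osc_integral_le[OF dq])
      also have "\<dots> \<le> pi * 4 * (2 * real n / 4) powr (1/4) * I"
        unfolding dq_def I_def
      proof (rule increment_quotient_integral_le[OF s der cQ' K])
        show "\<bar>Q t - Q s\<bar> \<le> 4" for t using Qs[of t] Qs[of s] by linarith
      qed auto
      also have "(2 * real n / 4) powr (1/4) \<le> real n powr (1/4)" by (intro powr_mono2) auto
      then have "pi * 4 * (2 * real n / 4) powr (1/4) * I \<le> pi * 4 * real n powr (1/4) * I"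
        using I by (intro mult_left_mono mult_right_mono) auto
      finally show ?thesis by (simp add: mult_ac)
    qed
    have sint: "(\<lambda>t. of_real (sin (real j * t) * log_kernel s t) * osc k t) integrable_on {0..pi}" for j
      by (intro integrable_of_absolutely osc_absolutely_integrable absolutely_integrable_mult_continuous_real
          log_kernel_absolutely_integrable s continuous_intros)
    have dqint: "(\<lambda>t. of_real (dq t) * osc k t) integrable_on {0..pi}"
      by (intro integrable_of_absolutely osc_absolutely_integrable dq)
    have "(\<lambda>t. of_real (g t) * osc k t) = (\<lambda>t. of_real (real m) * (of_real (sin (real m * t) * log_kernel s t) * osc k t)
        - of_real (real n) * (of_real (sin (real n * t) * log_kernel s t) * osc k t)
        - 2 * (of_real (dq t) * osc k t))"
    proof
      fix t
      have "g t = real m * (sin (real m * t) * log_kernel s t) - real n * (sin (real n * t) * log_kernel s t) - 2 * dq t"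
        unfolding g_def log_ibp_deriv_def dq_def Q'_def alias_diff'_def m_def by (simp add: algebra_simps)
      then show "of_real (g t) * osc k t = of_real (real m) * (of_real (sin (real m * t) * log_kernel s t) * osc k t)
        - of_real (real n) * (of_real (sin (real n * t) * log_kernel s t) * osc k t)
        - 2 * (of_real (dq t) * osc k t)"
        by (simp add: left_diff_distrib mult.assoc)
    qed
    then have eq: "osc_integral k g =
        of_real (real m) * sine_moment s k m - of_real (real n) * sine_moment s k n
        - 2 * osc_integral k dq"
      using integral_diff[OF integrable_diff[OF integrable_on_mult_right[OF sint] integrable_on_mult_right[OF sint]]
          integrable_on_mult_right[OF dqint]]
        integral_diff[OF integrable_on_mult_right[OF sint] integrable_on_mult_right[OF sint]]
      by (simp only: sine_moment_def integral_mult_right)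
    have gle: "cmod (osc_integral k g) \<le>
        real m * cmod (sine_moment s k m) + real n * cmod (sine_moment s k n) + 2 * (4 * pi * I * real n powr (1/4))"
    proof -
      have tri: "cmod (x - y - 2 * z) \<le> cmod x + cmod y + 2 * cmod z" for x y z :: complex
        using norm_triangle_ineq4[of "x - y" "2 * z"] norm_triangle_ineq4[of x y] by (simp add: norm_mult)
      show ?thesis unfolding eq
        by (rule order.trans[OF tri]) (use dqle in \<open>simp add: norm_mult mult_ac\<close>)
    qed
    have "k * cmod (cheb_error s k N n) \<le>
        k * cmod (osc_integral k (\<lambda>t. (Q t - Q s) * log_kernel s t * sin t))
        + k * (\<bar>Q s\<bar> * cmod (log_moment s k))"
      unfolding rule_error_chebyshev_split[OF s N] Q_def[symmetric] distrib_left[symmetric] using k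
      by (intro mult_left_mono order.trans[OF norm_triangle_ineq]) (auto simp: norm_mult)
    also have "k * (\<bar>Q s\<bar> * cmod (log_moment s k)) \<le> C"
      using C(2)[OF k N, of n] by (simp add: Q_def mult_ac)
    finally have "k * cmod (cheb_error s k N n) \<le>
        real n * cmod (sine_moment s k n) + real m * cmod (sine_moment s k m)
        + ((C + 2 * \<bar>log_kernel s 0\<bar> + 2 * \<bar>log_kernel s pi\<bar>) * 1 + 8 * pi * I * real n powr (1/4))"
      using ibp b0 b1 gle by simp
    also have "(C + 2 * \<bar>log_kernel s 0\<bar> + 2 * \<bar>log_kernel s pi\<bar>) * 1 \<le>
        (C + 2 * \<bar>log_kernel s 0\<bar> + 2 * \<bar>log_kernel s pi\<bar>) * real n powr (1/4)"
      using n1 C(1) by (intro mult_left_mono) auto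
    finally show "k * cmod (cheb_error s k N n) \<le>
        real n * cmod (sine_moment s k n) + real (alias_index N n) * cmod (sine_moment s k (alias_index N n))
        + D * real n powr (1/4)"
      unfolding m_def D_def by (simp add: algebra_simps)
  qed
qed

lemma chebyshev_errors_square_summable_first_order:
  assumes s: "s \<in> {0..pi}"
  shows "\<exists>B\<ge>0. \<forall>k\<ge>1. \<forall>N\<ge>1. \<forall>M. error_energy s k N 1 M \<le> (B * real N / k)\<^sup>2"
proof -
  obtain D where D: "D \<ge> 0" "\<And>k N n. k \<ge> 1 \<Longrightarrow> N \<ge> 1 \<Longrightarrow> n > N \<Longrightarrow> k * cmod (cheb_error s k N n) \<le>
    real n * cmod (sine_moment s k n) + real (alias_index N n) * cmod (sine_moment s k (alias_index N n))
      + D * real n powr (1/4)"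
    using chebyshev_error_first_order[OF s] by blast
  define B1 where "B1 = pi * integral {0..pi} (\<lambda>t. (log_kernel s t)\<^sup>2)"
  have zeta: "summable (\<lambda>n. real n powr (- (3/2)))" by (subst summable_real_powr_iff) simp
  define Z where "Z = (\<Sum>n. real n powr (- (3/2)))"
  have Z: "(\<Sum>n\<in>A. real n powr (- (3/2))) \<le> Z" if "finite A" for A
    unfolding Z_def by (rule sum_le_suminf[OF zeta that]) simp
  have B1: "B1 \<ge> 0" using order.trans[OF sum_nonneg sine_moment_bessel[OF s, of "{}" 0]] by (simp add: B1_def)
  have Z0: "Z \<ge> 0" using Z[of "{}"] by simp
  define W where "W = 3 * (5 * B1 + D\<^sup>2 * Z)"
  have W: "W \<ge> 0" unfolding W_def using B1 Z0 by simp
  have "error_energy s k N 1 M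
      \<le> (sqrt W * real N / k)\<^sup>2" if k: "k \<ge> 1" and N: "N \<ge> 1" for k N M
  proof -
    define S where "S n = cmod (sine_moment s k n)" for n
    have S: "(\<Sum>n\<in>A. (S n)\<^sup>2) \<le> B1" if "finite A" for A
      unfolding S_def B1_def by (rule sine_moment_bessel[OF s that])
    have "(real N / real n) powr (2 * 1) * (cmod (cheb_error s k N n))\<^sup>2 \<le>
        (3 * (real N)\<^sup>2 / k\<^sup>2) * ((S n)\<^sup>2 + (real N / real n)\<^sup>2 * (S (alias_index N n))\<^sup>2 + D\<^sup>2 * real n powr (- (3/2)))"
      if n: "n \<in> {N<..<M}" for n
    proof -
      define m where "m = alias_index N n"
      define e where "e = cmod (cheb_error s k N n)"
      have n0: "real n > 0" using n by auto
      have mN: "real m \<le> real N" using alias_index_le[OF N] by (simp add: m_def)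
      have "k * e \<le> real n * S n + real m * S m + D * real n powr (1/4)"
        using D(2)[OF k N, of n] n unfolding e_def S_def m_def by simp
      also have "\<dots> \<le> real n * S n + real N * S m + D * real n powr (1/4)"
        using mN by (intro add_mono mult_right_mono) (auto simp: S_def)
      finally have "(k * e)\<^sup>2 \<le> (real n * S n + real N * S m + D * real n powr (1/4))\<^sup>2"
        using k by (intro power_mono) (auto simp: e_def)
      also have "\<dots> \<le> 3 * ((real n * S n)\<^sup>2 + (real N * S m)\<^sup>2 + (D * real n powr (1/4))\<^sup>2)"
      proof -
        have "(x + y + z)\<^sup>2 \<le> 3 * (x\<^sup>2 + y\<^sup>2 + z\<^sup>2)" for x y z :: real
          using sum_squares_bound[of x y] sum_squares_bound[of y z] sum_squares_bound[of x z]
          by (simp add: power2_eq_square algebra_simps)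
        then show ?thesis .
      qed
      also have "(D * real n powr (1/4))\<^sup>2 = D\<^sup>2 * real n powr (1/2)"
        by (simp add: power_mult_distrib powr_square)
      also have "real n powr (1/2) = (real n)\<^sup>2 * real n powr (- (3/2))"
        using n0 by (simp add: powr_add[symmetric] flip: powr_numeral)
      also have "3 * ((real n * S n)\<^sup>2 + (real N * S m)\<^sup>2 + D\<^sup>2 * ((real n)\<^sup>2 * real n powr (- (3/2)))) =
          (real n)\<^sup>2 * (3 * ((S n)\<^sup>2 + (real N / real n)\<^sup>2 * (S m)\<^sup>2 + D\<^sup>2 * real n powr (- (3/2))))"
        using n0 by (simp add: power_mult_distrib power_divide distrib_left)
      finally have "k\<^sup>2 * e\<^sup>2 \<le> (real n)\<^sup>2 * (3 * ((S n)\<^sup>2 + (real N / real n)\<^sup>2 * (S m)\<^sup>2 + D\<^sup>2 * real n powr (- (3/2))))"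
        by (simp add: power_mult_distrib)
      then have "e\<^sup>2 \<le> ((real n)\<^sup>2 * (3 * ((S n)\<^sup>2 + (real N / real n)\<^sup>2 * (S m)\<^sup>2 + D\<^sup>2 * real n powr (- (3/2))))) / k\<^sup>2"
        using k by (simp add: pos_le_divide_eq mult.commute)
      then have "(real N / real n)\<^sup>2 * e\<^sup>2 \<le> (real N / real n)\<^sup>2 *
          (((real n)\<^sup>2 * (3 * ((S n)\<^sup>2 + (real N / real n)\<^sup>2 * (S m)\<^sup>2 + D\<^sup>2 * real n powr (- (3/2))))) / k\<^sup>2)"
        by (rule mult_left_mono) simp
      also have "\<dots> = (3 * (real N)\<^sup>2 / k\<^sup>2) * ((S n)\<^sup>2 + (real N / real n)\<^sup>2 * (S m)\<^sup>2 + D\<^sup>2 * real n powr (- (3/2)))"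
      proof -
        have "(real N / real n)\<^sup>2 * (((real n)\<^sup>2 * (3 * X)) / k\<^sup>2) = (3 * (real N)\<^sup>2 / k\<^sup>2) * X" for X
          using n0 by (simp add: power_divide)
        then show ?thesis .
      qed
      finally show ?thesis unfolding e_def m_def weight_one_square .
    qed
    then have "error_energy s k N 1 M \<le>
      (\<Sum>n\<in>{N<..<M}. (3 * (real N)\<^sup>2 / k\<^sup>2) * ((S n)\<^sup>2 + (real N / real n)\<^sup>2 * (S (alias_index N n))\<^sup>2 + D\<^sup>2 * real n powr (- (3/2))))"
      by (rule sum_mono)
    also have "\<dots> = (3 * (real N)\<^sup>2 / k\<^sup>2) * ((\<Sum>n\<in>{N<..<M}. (S n)\<^sup>2) +
        (\<Sum>n\<in>{N<..<M}. (real N / real n)\<^sup>2 * (S (alias_index N n))\<^sup>2) + D\<^sup>2 * (\<Sum>n\<in>{N<..<M}. real n powr (- (3/2))))"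
      by (simp only: sum_distrib_left[symmetric] sum.distrib)
    also have "\<dots> \<le> (3 * (real N)\<^sup>2 / k\<^sup>2) * (B1 + 4 * B1 + D\<^sup>2 * Z)"
      by (intro mult_left_mono add_mono S Z alias_sum_le[OF N]) auto
    also have "\<dots> = (sqrt W * real N / k)\<^sup>2"
      using W by (simp add: W_def power_divide power_mult_distrib)
    finally show ?thesis .
  qed
  then show ?thesis using W by (intro exI[of _ "sqrt W"]) auto
qed

section \<open>Estimates of second order in the wave number\<close>
text \<open>
  The Chebyshev polynomials of the second kind, \<open>sin (n t) / sin t\<close>, by a recursion from which
  bounds and derivatives can be read off without division.
\<close>
primrec sin_quotient :: "nat \<Rightarrow> real \<Rightarrow> real" where
  "sin_quotient 0 t = 0"
| "sin_quotient (Suc n) t = cos t * sin_quotient n t + cos (real n * t)"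

primrec sin_quotient' :: "nat \<Rightarrow> real \<Rightarrow> real" where
  "sin_quotient' 0 t = 0"
| "sin_quotient' (Suc n) t = cos t * sin_quotient' n t - sin t * sin_quotient n t - real n * sin (real n * t)"

lemma sin_quotient_times_sin: "sin_quotient n t * sin t = sin (real n * t)"
proof (induction n)
  case (Suc n)
  have "sin_quotient (Suc n) t * sin t = cos t * (sin_quotient n t * sin t) + cos (real n * t) * sin t"
    by (simp add: algebra_simps)
  also have "\<dots> = sin (real n * t + t)" by (simp only: Suc sin_add) simp
  also have "real n * t + t = real (Suc n) * t" by (simp add: algebra_simps)
  finally show ?case .
qed simp

lemma sin_quotient_derivative: "(sin_quotient n has_real_derivative sin_quotient' n t) (at t)"
proof (induction n)
  case 0
  have "sin_quotient 0 = (\<lambda>_. 0)" by (rule ext) simp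
  then show ?case by simp
next
  case (Suc n)
  have "sin_quotient (Suc n) = (\<lambda>t. cos t * sin_quotient n t + cos (real n * t))" by (rule ext) simp
  then show ?case by (auto intro!: derivative_eq_intros Suc)
qed

lemma continuous_sin_quotient: "continuous_on S (sin_quotient n)"
  by (meson DERIV_isCont sin_quotient_derivative continuous_at_imp_continuous_on)

lemma continuous_sin_quotient': "continuous_on S (sin_quotient' n)"
proof (induction n)
  case 0
  have "sin_quotient' 0 = (\<lambda>_. 0)" by (rule ext) simp
  then show ?case by simp
next
  case (Suc n)
  have "sin_quotient' (Suc n) = (\<lambda>t. cos t * sin_quotient' n t - sin t * sin_quotient n t - real n * sin (real n * t))"
    by (rule ext) simp
  then show ?case by (auto intro!: continuous_intros Suc continuous_sin_quotient)
qed

lemma abs_mult_le_of_abs_le_one: "\<bar>a\<bar> \<le> 1 \<Longrightarrow> \<bar>b\<bar> \<le> c \<Longrightarrow> \<bar>a * b\<bar> \<le> c" for a b c :: real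
  using mult_mono[of "\<bar>a\<bar>" 1 "\<bar>b\<bar>" c] by (simp add: abs_mult)

lemma abs_sin_quotient_le: "\<bar>sin_quotient n t\<bar> \<le> real n"
proof (induction n)
  case (Suc n)
  have "\<bar>cos t * sin_quotient n t\<bar> \<le> real n" by (rule abs_mult_le_of_abs_le_one[OF abs_cos_le_one Suc])
  then show ?case
    using abs_cos_le_one[of "real n * t"] abs_triangle_ineq[of "cos t * sin_quotient n t" "cos (real n * t)"]
    unfolding sin_quotient.simps of_nat_Suc by linarith
qed simp

lemma abs_sin_quotient'_le: "\<bar>sin_quotient' n t\<bar> \<le> (real n)\<^sup>2"
proof (induction n)
  case (Suc n)
  have 1: "\<bar>cos t * sin_quotient' n t\<bar> \<le> (real n)\<^sup>2" by (rule abs_mult_le_of_abs_le_one[OF abs_cos_le_one Suc])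
  have 2: "\<bar>sin t * sin_quotient n t\<bar> \<le> real n" by (rule abs_mult_le_of_abs_le_one[OF abs_sin_le_one abs_sin_quotient_le])
  have 3: "\<bar>sin (real n * t) * real n\<bar> \<le> real n" by (rule abs_mult_le_of_abs_le_one[OF abs_sin_le_one]) simp
  have "\<bar>sin_quotient' (Suc n) t\<bar> \<le> (real n)\<^sup>2 + real n + real n"
    using 1 2 3 unfolding sin_quotient'.simps by (simp only: mult.commute[of "real n"])
  also have "\<dots> \<le> (real (Suc n))\<^sup>2" by (simp add: power2_eq_square algebra_simps)
  finally show ?case .
qed simp

text \<open>
  The derivative with respect to \<open>x = cos t\<close> of the polynomial \<open>alias_diff\<close>.
\<close>
definition alias_slope :: "nat \<Rightarrow> nat \<Rightarrow> real \<Rightarrow> real"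
  where "alias_slope N n t = real n * sin_quotient n t - real (alias_index N n) * sin_quotient (alias_index N n) t"

definition alias_slope' :: "nat \<Rightarrow> nat \<Rightarrow> real \<Rightarrow> real"
  where "alias_slope' N n t = real n * sin_quotient' n t - real (alias_index N n) * sin_quotient' (alias_index N n) t"

lemma alias_diff'_eq_slope: "alias_diff' N n t = - (sin t * alias_slope N n t)"
proof -
  have "alias_diff' N n t = real (alias_index N n) * (sin_quotient (alias_index N n) t * sin t)
      - real n * (sin_quotient n t * sin t)"
    by (simp only: alias_diff'_def sin_quotient_times_sin)
  then show ?thesis by (simp add: alias_slope_def algebra_simps)
qed

lemma alias_slope_derivative: "(alias_slope N n has_real_derivative alias_slope' N n t) (at t)"
  unfolding alias_slope_def[abs_def] alias_slope'_def
  by (auto intro!: derivative_eq_intros sin_quotient_derivative)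

lemma continuous_alias_slope: "continuous_on S (alias_slope N n)" "continuous_on S (alias_slope' N n)"
  unfolding alias_slope_def[abs_def] alias_slope'_def[abs_def]
  by (intro continuous_intros continuous_sin_quotient continuous_sin_quotient')+

lemma abs_alias_slope_le:
  assumes "N \<ge> 1" "N < n"
  shows "\<bar>alias_slope N n t\<bar> \<le> 2 * real n ^ 2" and "\<bar>alias_slope' N n t\<bar> \<le> 2 * real n ^ 3"
proof -
  have mn: "real (alias_index N n) \<le> real n" using alias_index_le[OF assms(1), of n] assms(2) by simp
  have b: "\<bar>real m * sin_quotient m t\<bar> \<le> real n ^ 2" "\<bar>real m * sin_quotient' m t\<bar> \<le> real n ^ 3" if "real m \<le> real n" for m
  proof -
    have "\<bar>real m * sin_quotient m t\<bar> \<le> real n * real n"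
      unfolding abs_mult using that order.trans[OF abs_sin_quotient_le that] by (intro mult_mono) auto
    then show "\<bar>real m * sin_quotient m t\<bar> \<le> real n ^ 2" by (simp add: power2_eq_square)
    have "(real m)\<^sup>2 \<le> (real n)\<^sup>2" using that by (intro power_mono) auto
    then have "\<bar>real m * sin_quotient' m t\<bar> \<le> real n * (real n)\<^sup>2"
      unfolding abs_mult using that order.trans[OF abs_sin_quotient'_le] by (intro mult_mono) auto
    then show "\<bar>real m * sin_quotient' m t\<bar> \<le> real n ^ 3" by (simp add: power2_eq_square power3_eq_cube)
  qed
  show "\<bar>alias_slope N n t\<bar> \<le> 2 * real n ^ 2"
    using b(1)[OF mn] b(1)[of n] unfolding alias_slope_def by linarith
  show "\<bar>alias_slope' N n t\<bar> \<le> 2 * real n ^ 3"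
    using b(2)[OF mn] b(2)[of n] unfolding alias_slope'_def by linarith
qed

text \<open>
  The divided difference of \<open>alias_diff\<close> as a function of \<open>cos t\<close>, at a zero \<open>s\<close>; its value at \<open>t = s\<close> is
  the limit.
\<close>
definition alias_quotient :: "real \<Rightarrow> nat \<Rightarrow> nat \<Rightarrow> real \<Rightarrow> real"
  where "alias_quotient s N n t =
    (if t = s then alias_slope N n s else alias_diff N n t / (cos t - cos s))"

definition alias_quotient' :: "real \<Rightarrow> nat \<Rightarrow> nat \<Rightarrow> real \<Rightarrow> real"
  where "alias_quotient' s N n t =
    (alias_diff N n t / (cos t - cos s) - alias_slope N n t) * sin t / (cos t - cos s)"

text \<open>
  Cauchy's mean value theorem. Comparing with \<open>cos\<close> instead of the identity covers the end points,
  where \<open>alias_diff\<close> and \<open>cos t - cos s\<close> both vanish to second order.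
\<close>
lemma alias_quotient_mean_value:
  assumes s: "s \<in> {0..pi}" and t: "t \<in> {0..pi}" and zero: "alias_diff N n s = 0"
  shows "\<exists>\<xi>\<in>{min s t..max s t}. alias_quotient s N n t = alias_slope N n \<xi>"
proof -
  have mv: "\<exists>\<xi>. a < \<xi> \<and> \<xi> < b \<and> alias_diff N n b - alias_diff N n a = (cos b - cos a) * alias_slope N n \<xi>"
    if ab: "a < b" "a \<in> {0..pi}" "b \<in> {0..pi}" for a b
  proof -
    have "\<exists>\<xi>>a. \<xi> < b \<and> (alias_diff N n b - alias_diff N n a) * (- sin \<xi>) = (cos b - cos a) * alias_diff' N n \<xi>"
      using alias_diff_derivative
      by (intro GMVT'[OF ab(1)]) (auto intro: DERIV_isCont)
    then obtain \<xi> where \<xi>: "a < \<xi>" "\<xi> < b"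
      "(alias_diff N n b - alias_diff N n a) * (- sin \<xi>) = (cos b - cos a) * alias_diff' N n \<xi>" by blast
    have "sin \<xi> > 0" using \<xi> ab by (intro sin_gt_zero) auto
    moreover from \<xi>(3) have "(alias_diff N n b - alias_diff N n a) * sin \<xi> = (cos b - cos a) * alias_slope N n \<xi> * sin \<xi>"
      unfolding alias_diff'_eq_slope by (simp add: mult_ac)
    ultimately have "alias_diff N n b - alias_diff N n a = (cos b - cos a) * alias_slope N n \<xi>" by simp
    then show ?thesis using \<xi> by blast
  qed
  consider "t = s" | "s < t" | "t < s" by linarith
  then show ?thesis
  proof cases
    case 1 then show ?thesis by (auto simp: alias_quotient_def)
  next
    case 2
    from mv[OF 2 s t] obtain \<xi> where "s < \<xi>" "\<xi> < t" "alias_diff N n t = (cos t - cos s) * alias_slope N n \<xi>"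
      using zero by auto
    then show ?thesis using 2 cos_diff_nonzero[OF t s] by (intro bexI[of _ \<xi>]) (auto simp: alias_quotient_def)
  next
    case 3
    from mv[OF 3 t s] obtain \<xi> where \<xi>: "t < \<xi>" "\<xi> < s" "- alias_diff N n t = (cos s - cos t) * alias_slope N n \<xi>"
      using zero by auto
    then have "alias_diff N n t = (cos t - cos s) * alias_slope N n \<xi>" by (simp add: algebra_simps)
    then show ?thesis using \<xi> 3 cos_diff_nonzero[OF t s] by (intro bexI[of _ \<xi>]) (auto simp: alias_quotient_def)
  qed
qed

text \<open>
  All bounds follow from those on the slope and its derivative at the intermediate point, which is no
  farther from \<open>s\<close> and \<open>t\<close> than these are from each other.
\<close>
lemma alias_quotient_bounds:
  assumes s: "s \<in> {0..pi}" and N: "N \<ge> 1" and n: "N < n" and zero: "alias_diff N n s = 0" and t: "t \<in> {0..pi}"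
  shows "\<bar>alias_quotient s N n t\<bar> \<le> 2 * real n ^ 2"
    and "\<bar>alias_quotient s N n t - alias_slope N n s\<bar> \<le> 2 * real n ^ 3 * \<bar>t - s\<bar>"
    and "\<bar>alias_quotient s N n t - alias_slope N n t\<bar> \<le> 2 * real n ^ 3 * \<bar>t - s\<bar>"
    and "\<bar>alias_quotient' s N n t\<bar> \<le> 2 * real n ^ 3 * pi"
proof -
  obtain \<xi> where \<xi>: "\<xi> \<in> {min s t..max s t}" "alias_quotient s N n t = alias_slope N n \<xi>"
    using alias_quotient_mean_value[OF s t zero] by blast
  have \<xi>I: "\<xi> \<in> {0..pi}" and dist: "\<bar>\<xi> - s\<bar> \<le> \<bar>t - s\<bar>" "\<bar>\<xi> - t\<bar> \<le> \<bar>t - s\<bar>"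
    using \<xi>(1) s t by auto
  have lip: "\<bar>alias_slope N n x - alias_slope N n y\<bar> \<le> 2 * real n ^ 3 * \<bar>x - y\<bar>" if "x \<in> {0..pi}" "y \<in> {0..pi}" for x y
    by (rule increment_bound[OF s alias_slope_derivative continuous_alias_slope(2) abs_alias_slope_le(2)[OF N n] that])
  show "\<bar>alias_quotient s N n t\<bar> \<le> 2 * real n ^ 2" unfolding \<xi>(2) by (rule abs_alias_slope_le[OF N n])
  show "\<bar>alias_quotient s N n t - alias_slope N n s\<bar> \<le> 2 * real n ^ 3 * \<bar>t - s\<bar>"
    unfolding \<xi>(2) using lip[OF \<xi>I s] mult_left_mono[OF dist(1), of "2 * real n ^ 3"] by simp
  show 3: "\<bar>alias_quotient s N n t - alias_slope N n t\<bar> \<le> 2 * real n ^ 3 * \<bar>t - s\<bar>"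
    unfolding \<xi>(2) using lip[OF \<xi>I t] mult_left_mono[OF dist(2), of "2 * real n ^ 3"] by simp
  show "\<bar>alias_quotient' s N n t\<bar> \<le> 2 * real n ^ 3 * pi"
  proof (cases "t = s")
    case False
    then have "alias_quotient' s N n t = (alias_quotient s N n t - alias_slope N n t) * sin t / (cos t - cos s)"
      by (simp add: alias_quotient'_def alias_quotient_def)
    then have "\<bar>alias_quotient' s N n t\<bar> = \<bar>alias_quotient s N n t - alias_slope N n t\<bar> * (sin t / \<bar>cos t - cos s\<bar>)"
      using t by (simp add: abs_mult sin_ge_zero)
    also have "\<dots> \<le> 2 * real n ^ 3 * \<bar>t - s\<bar> * (sin t / \<bar>cos t - cos s\<bar>)"
      using t by (intro mult_right_mono 3) (simp add: sin_ge_zero)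
    also have "\<dots> = 2 * real n ^ 3 * (\<bar>t - s\<bar> * sin t / \<bar>cos t - cos s\<bar>)" by simp
    also have "\<dots> \<le> 2 * real n ^ 3 * pi"
      by (intro mult_left_mono dist_sin_over_cos_diff_le s t) auto
    finally show ?thesis .
  qed (simp add: alias_quotient'_def)
qed

lemma alias_quotient_derivative:
  assumes "cos t \<noteq> cos s"
  shows "(alias_quotient s N n has_real_derivative alias_quotient' s N n t) (at t)"
proof -
  have c: "cos t - cos s \<noteq> 0" using assms by simp
  have "((\<lambda>t. alias_diff N n t / (cos t - cos s)) has_real_derivative
      (alias_diff' N n t * (cos t - cos s) - alias_diff N n t * (- sin t)) / ((cos t - cos s) * (cos t - cos s))) (at t)"
    using c by (intro DERIV_divide alias_diff_derivative) (auto intro!: derivative_eq_intros)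
  moreover have "(alias_diff' N n t * (cos t - cos s) - alias_diff N n t * (- sin t)) / ((cos t - cos s) * (cos t - cos s))
      = alias_quotient' s N n t"
  proof -
    have "(- (y * V) * c - q * (- y)) / (c * c) = (q / c - V) * y / c" if "c \<noteq> 0" for y V q c :: real
      using that by (simp add: field_simps)
    from this[OF c] show ?thesis unfolding alias_diff'_eq_slope alias_quotient'_def .
  qed
  ultimately have "((\<lambda>t. alias_diff N n t / (cos t - cos s)) has_real_derivative alias_quotient' s N n t) (at t)"
    by simp
  moreover have "open {u. cos u \<noteq> cos s}"
    by (intro open_Collect_neq continuous_intros)
  ultimately show ?thesis
    by (rule has_field_derivative_transform_within_open) (use assms in \<open>auto simp: alias_quotient_def\<close>)
qed

lemma continuous_alias_quotient:
  assumes s: "s \<in> {0..pi}" and N: "N \<ge> 1" and n: "N < n" and zero: "alias_diff N n s = 0"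
  shows "continuous_on {0..pi} (alias_quotient s N n)"
  unfolding continuous_on_eq_continuous_within
proof
  fix t assume t: "t \<in> {0..pi}"
  show "continuous (at t within {0..pi}) (alias_quotient s N n)"
  proof (cases "t = s")
    case True
    have "((\<lambda>t. 2 * real n ^ 3 * \<bar>t - s\<bar>) \<longlongrightarrow> 2 * real n ^ 3 * \<bar>s - s\<bar>) (at s within {0..pi})"
      by (intro tendsto_intros)
    then have lim: "((\<lambda>t. 2 * real n ^ 3 * \<bar>t - s\<bar>) \<longlongrightarrow> 0) (at s within {0..pi})" by simp
    have "\<forall>\<^sub>F t in at s within {0..pi}. norm (alias_quotient s N n t - alias_slope N n s) \<le> 2 * real n ^ 3 * \<bar>t - s\<bar>"
      using alias_quotient_bounds(2)[OF assms] by (auto simp: eventually_at_filter)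
    from Lim_null_comparison[OF this lim]
    have "(alias_quotient s N n \<longlongrightarrow> alias_slope N n s) (at s within {0..pi})"
      by (rule LIM_zero_cancel)
    then show ?thesis by (simp add: continuous_within True alias_quotient_def)
  next
    case False
    then have "isCont (alias_quotient s N n) t"
      using cos_diff_nonzero[OF t s] by (intro DERIV_isCont[OF alias_quotient_derivative]) auto
    then show ?thesis by (rule continuous_at_imp_continuous_at_within)
  qed
qed

lemma alias_quotient'_absolutely_integrable:
  assumes "s \<in> {0..pi}" "N \<ge> 1" "N < n" "alias_diff N n s = 0"
  shows "alias_quotient' s N n absolutely_integrable_on {0..pi}"
proof (rule absolutely_integrable_bounded_real)
  have [measurable]: "alias_diff N n \<in> borel_measurable borel" "alias_slope N n \<in> borel_measurable borel"
    by (auto intro!: borel_measurable_continuous_onI continuous_alias_diff continuous_alias_slope)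
  show "alias_quotient' s N n \<in> borel_measurable borel"
    unfolding alias_quotient'_def[abs_def] by measurable
qed (rule alias_quotient_bounds(4)[OF assms])

text \<open>
  The right-hand side has the factor \<open>sin t\<close> that a further integration by parts needs.
\<close>
lemma log_ibp_deriv_alias_diff:
  assumes zero: "alias_diff N n s = 0" and "t \<noteq> s"
  shows "log_ibp_deriv s (alias_diff N n) (alias_diff' N n) t =
    - ((alias_slope N n t - alias_slope N n s) * log_kernel s t * sin t
       + alias_slope N n s * (log_kernel s t * sin t) + 2 * (alias_quotient s N n t * sin t))"
proof -
  have "(alias_diff N n t - alias_diff N n s) * sin t / (cos t - cos s) = alias_quotient s N n t * sin t"
    using assms by (simp add: alias_quotient_def)
  then show ?thesis unfolding log_ibp_deriv_def alias_diff'_eq_slope by (simp add: algebra_simps)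
qed

text \<open>
  The first integration by parts produces three integrals with the factor \<open>sin t\<close>: the increment of the
  slope times the kernel and the divided difference, both of which are integrated by parts once
  more, and the value of the slope at \<open>s\<close> times the kernel moment. Each derivative costs a factor \<open>n\<close>,
  and dividing by \<open>sin t\<close> another one.
\<close>
lemma chebyshev_error_second_order:
  assumes s: "s \<in> {0..pi}" and C: "C \<ge> 0" "\<And>k. k \<ge> 1 \<Longrightarrow> k * cmod (log_moment s k) \<le> C * (1 + (cos s)\<^sup>2 * ln k)"
  shows "\<exists>D\<ge>0. \<forall>k\<ge>1. \<forall>N\<ge>1. \<forall>n>N. alias_diff N n s = 0 \<longrightarrow>
    k\<^sup>2 * cmod (cheb_error s k N n) \<le> D * real n ^ 3 * (1 + (cos s)\<^sup>2 * ln k)"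
proof -
  define I where "I = integral {0..pi} (\<lambda>t. \<bar>log_kernel s t\<bar>)"
  have I: "I \<ge> 0" unfolding I_def using log_kernel_absolutely_integrable[OF s]
    by (intro integral_nonneg) (auto simp: absolutely_integrable_on_def)
  define D where "D = 2 * (256 + I + 2 * pi\<^sup>2) + 2 * C + 2 * (4 + 2 * pi\<^sup>2)"
  have D: "D \<ge> 0" unfolding D_def using C(1) I by simp
  show ?thesis
  proof (intro exI[of _ D] conjI allI impI D)
    fix k :: real and N n :: nat
    assume k: "1 \<le> k" and N: "1 \<le> N" and n: "N < n" and zero: "alias_diff N n s = 0"
    define X where "X = 1 + (cos s)\<^sup>2 * ln k"
    have X: "X \<ge> 1" unfolding X_def using k by simp
    define K where "K = 2 * real n ^ 3"
    have n23: "real n ^ 2 \<le> real n ^ 3" using n by (intro power_increasing) auto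
    have K0: "K \<ge> 0" by (simp add: K_def)
    have preQ: "s \<in> {0..pi}" "\<And>t. (alias_diff N n has_real_derivative alias_diff' N n t) (at t)"
      "continuous_on UNIV (alias_diff' N n)" "\<And>t. t \<in> {0..pi} \<Longrightarrow> \<bar>alias_diff' N n t\<bar> \<le> 2 * real n"
      using s alias_diff_derivative continuous_alias_diff abs_alias_diff'_le[OF N] n by auto
    have preV: "s \<in> {0..pi}" "\<And>t. (alias_slope N n has_real_derivative alias_slope' N n t) (at t)"
      "continuous_on UNIV (alias_slope' N n)" "\<And>t. t \<in> {0..pi} \<Longrightarrow> \<bar>alias_slope' N n t\<bar> \<le> K"
      using s alias_slope_derivative continuous_alias_slope abs_alias_slope_le(2)[OF N n] by (auto simp: K_def)
    define V where "V = alias_slope N n"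
    define P where "P = alias_quotient s N n"
    define IV where "IV = osc_integral k (\<lambda>t. (V t - V s) * log_kernel s t * sin t)"
    define IP where "IP = osc_integral k (\<lambda>t. P t * sin t)"
    define g where "g = log_ibp_deriv s (alias_diff N n) (alias_diff' N n)"
    have Vint: "(\<lambda>t. of_real ((V t - V s) * log_kernel s t * sin t) * osc k t) integrable_on {0..pi}"
      unfolding V_def
      by (intro integrable_continuous_real continuous_intros increment_times_log_kernel_continuous[OF preV])
    have Pint: "(\<lambda>t. of_real (P t * sin t) * osc k t) integrable_on {0..pi}"
      unfolding P_def
      by (intro integrable_continuous_real continuous_intros continuous_alias_quotient[OF s N n zero])
    have Lint: "(\<lambda>t. of_real (log_kernel s t * sin t) * osc k t) integrable_on {0..pi}"
      by (intro integrable_of_absolutely osc_absolutely_integrable log_kernel_sin_absolutely_integrable s)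
    have "osc_integral k g =
        integral {0..pi} (\<lambda>t. - (of_real ((V t - V s) * log_kernel s t * sin t) * osc k t
          + of_real (V s) * (of_real (log_kernel s t * sin t) * osc k t)
          + 2 * (of_real (P t * sin t) * osc k t)))"
    \<comment> \<open>The integrands differ at \<open>s\<close>, where only the divided difference takes the limit value.\<close>
    proof (rule integral_spike[of "{s}"])
      fix t assume "t \<in> {0..pi} - {s}"
      then have "g t = - ((V t - V s) * log_kernel s t * sin t + V s * (log_kernel s t * sin t) + 2 * (P t * sin t))"
        unfolding g_def V_def P_def by (intro log_ibp_deriv_alias_diff[OF zero]) auto
      then show "- (of_real ((V t - V s) * log_kernel s t * sin t) * osc k t
          + of_real (V s) * (of_real (log_kernel s t * sin t) * osc k t)
          + 2 * (of_real (P t * sin t) * osc k t)) = of_real (g t) * osc k t"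
        by (simp only: of_real_minus of_real_add of_real_mult of_real_numeral) (simp add: algebra_simps)
    qed simp
    also have "\<dots> = - (IV + of_real (V s) * log_moment s k + 2 * IP)"
      unfolding IV_def IP_def log_moment_def
      by (simp only: integral_neg integral_add[OF integrable_add[OF Vint integrable_on_mult_right[OF Lint]] integrable_on_mult_right[OF Pint]]
        integral_add[OF Vint integrable_on_mult_right[OF Lint]] integral_mult_right)
    finally have geq: "osc_integral k g = - (IV + of_real (V s) * log_moment s k + 2 * IP)" .
    have "k * cmod (osc_integral k (\<lambda>t. (alias_diff N n t - alias_diff N n s) * log_kernel s t * sin t)) \<le>
        \<bar>(alias_diff N n 0 - alias_diff N n s) * log_kernel s 0\<bar> + \<bar>(alias_diff N n pi - alias_diff N n s) * log_kernel s pi\<bar>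
        + cmod (osc_integral k g)"
      unfolding g_def using k
      by (intro norm_osc_integral_by_parts[of "{s}"] increment_times_log_kernel_continuous[OF preQ]
          increment_times_log_kernel_derivative[OF preQ] log_ibp_deriv_absolutely_integrable[OF preQ]) auto
    then have 1: "k * cmod (cheb_error s k N n) \<le> cmod (IV + of_real (V s) * log_moment s k + 2 * IP)"
      unfolding rule_error_chebyshev_eq[OF s N] geq norm_minus_cancel using zero alias_diff_pi[OF N] by simp
    have tri: "cmod (x + y + 2 * z) \<le> cmod x + cmod y + 2 * cmod z" for x y z :: complex
      using norm_triangle_ineq[of "x + y" "2 * z"] norm_triangle_ineq[of x y] by (simp add: norm_mult)
    have IV: "k * cmod IV \<le> K * (256 + I + 2 * pi\<^sup>2)"
    proof -
      have "k * cmod IV \<le> \<bar>(V 0 - V s) * log_kernel s 0\<bar> + \<bar>(V pi - V s) * log_kernel s pi\<bar>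
          + cmod (osc_integral k (log_ibp_deriv s V (alias_slope' N n)))"
        unfolding IV_def V_def using k
        by (intro norm_osc_integral_by_parts[of "{s}"] increment_times_log_kernel_continuous[OF preV]
            increment_times_log_kernel_derivative[OF preV] log_ibp_deriv_absolutely_integrable[OF preV]) auto
      moreover have "cmod (osc_integral k (log_ibp_deriv s V (alias_slope' N n))) \<le> K * (I + 2 * pi\<^sup>2)"
        unfolding V_def I_def
        by (rule order.trans[OF norm_osc_integral_le integral_abs_log_ibp_deriv_le[OF preV]])
           (rule log_ibp_deriv_absolutely_integrable[OF preV])
      moreover have "\<bar>(V 0 - V s) * log_kernel s 0\<bar> \<le> 128 * K" "\<bar>(V pi - V s) * log_kernel s pi\<bar> \<le> 128 * K"
        unfolding V_def by (intro abs_increment_times_log_kernel_le_const[OF preV]; simp)+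
      ultimately show ?thesis by (simp add: algebra_simps)
    qed
    have IP: "k * cmod IP \<le> 4 * real n ^ 2 + K * pi\<^sup>2"
    proof -
      have "k * cmod IP \<le> \<bar>P 0\<bar> + \<bar>P pi\<bar> + cmod (osc_integral k (alias_quotient' s N n))"
        unfolding IP_def P_def using k cos_diff_nonzero[OF _ s]
        by (intro norm_osc_integral_by_parts[of "{s}"] continuous_alias_quotient[OF s N n zero]
            alias_quotient_derivative alias_quotient'_absolutely_integrable[OF s N n zero]) auto
      moreover have "cmod (osc_integral k (alias_quotient' s N n)) \<le> K * pi * pi"
      proof -
        have "cmod (osc_integral k (alias_quotient' s N n)) \<le> integral {0..pi} (\<lambda>t. \<bar>alias_quotient' s N n t\<bar>)"
          by (rule norm_osc_integral_le[OF alias_quotient'_absolutely_integrable[OF s N n zero]])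
        also have "\<dots> \<le> integral {0..pi} (\<lambda>t. K * pi)"
          using alias_quotient'_absolutely_integrable[OF s N n zero] alias_quotient_bounds(4)[OF s N n zero]
          by (intro integral_le) (auto simp: absolutely_integrable_on_def K_def)
        finally show ?thesis by (simp add: mult_ac)
      qed
      moreover have "\<bar>P 0\<bar> \<le> 2 * real n ^ 2" "\<bar>P pi\<bar> \<le> 2 * real n ^ 2"
        unfolding P_def by (intro alias_quotient_bounds(1)[OF s N n zero]; simp)+
      ultimately show ?thesis by (simp add: power2_eq_square algebra_simps)
    qed
    have VL: "k * cmod (of_real (V s) * log_moment s k) \<le> 2 * real n ^ 2 * (C * X)"
    proof -
      have "\<bar>V s\<bar> * (k * cmod (log_moment s k)) \<le> 2 * real n ^ 2 * (C * X)"
        unfolding V_def X_def using k by (intro mult_mono abs_alias_slope_le[OF N n] C(2)) auto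
      then show ?thesis by (simp add: norm_mult mult_ac)
    qed
    have "k\<^sup>2 * cmod (cheb_error s k N n) = k * (k * cmod (cheb_error s k N n))"
      by (simp add: power2_eq_square)
    also have "\<dots> \<le> k * (cmod IV + cmod (of_real (V s) * log_moment s k) + 2 * cmod IP)"
      using k by (intro mult_left_mono order.trans[OF 1 tri]) auto
    also have "\<dots> = k * cmod IV + k * cmod (of_real (V s) * log_moment s k) + 2 * (k * cmod IP)"
      by (simp add: algebra_simps)
    also have "\<dots> \<le> K * (256 + I + 2 * pi\<^sup>2) + 2 * real n ^ 2 * (C * X) + 2 * (4 * real n ^ 2 + K * pi\<^sup>2)"
      by (intro add_mono mult_left_mono IV VL IP) auto
    also have "\<dots> \<le> (real n ^ 3 * (2 * (256 + I + 2 * pi\<^sup>2))) * X + 2 * real n ^ 3 * (C * X) + (real n ^ 3 * (2 * (4 + 2 * pi\<^sup>2))) * X"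
    proof (intro add_mono mult_right_mono)
      have mX: "z \<le> z * X" if "z \<ge> 0" for z using mult_left_mono[OF X that] by simp
      have "K * (256 + I + 2 * pi\<^sup>2) = real n ^ 3 * (2 * (256 + I + 2 * pi\<^sup>2))" by (simp add: K_def)
      then show "K * (256 + I + 2 * pi\<^sup>2) \<le> real n ^ 3 * (2 * (256 + I + 2 * pi\<^sup>2)) * X"
        using mX[of "real n ^ 3 * (2 * (256 + I + 2 * pi\<^sup>2))"] I by simp
      have "2 * (4 * real n ^ 2 + K * pi\<^sup>2) \<le> 2 * (4 * real n ^ 3 + K * pi\<^sup>2)" using n23 by simp
      also have "\<dots> = real n ^ 3 * (2 * (4 + 2 * pi\<^sup>2))" by (simp add: K_def algebra_simps)
      also have "\<dots> \<le> real n ^ 3 * (2 * (4 + 2 * pi\<^sup>2)) * X" by (intro mX) simp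
      finally show "2 * (4 * real n ^ 2 + K * pi\<^sup>2) \<le> real n ^ 3 * (2 * (4 + 2 * pi\<^sup>2)) * X" .
    qed (use n23 C(1) X in auto)
    also have "\<dots> = D * real n ^ 3 * X" by (simp add: D_def algebra_simps)
    finally show "k\<^sup>2 * cmod (cheb_error s k N n) \<le> D * real n ^ 3 * (1 + (cos s)\<^sup>2 * ln k)"
      by (simp add: X_def)
  qed
qed

section \<open>The error estimates\<close>
text \<open>
  Both assumptions say \<open>e \<le> a / max 1 k ^ j\<close>, and \<open>1 + k \<le> 2 * max 1 k\<close>.
\<close>
lemma frequency_decay_combine:
  fixes e a k :: real
  assumes k: "k \<ge> 0" and a: "a \<ge> 0"
    and large: "k \<ge> 1 \<Longrightarrow> e \<le> a / k ^ j" and small: "k < 1 \<Longrightarrow> e \<le> a"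
  shows "e \<le> 2 ^ j * a * (1 + k) powr (- real j)"
proof -
  have "e \<le> a * (1 / max 1 k) ^ j"
    using large small by (auto simp: max_def power_divide)
  also have "\<dots> \<le> a * (2 / (1 + k)) ^ j"
    using k a by (intro mult_left_mono power_mono) (auto simp: max_def field_simps)
  also have "(2 / (1 + k)) ^ j = 2 ^ j * (1 + k) powr (- real j)"
    using k by (simp add: power_divide powr_minus_divide powr_realpow)
  finally show ?thesis by (simp add: mult_ac)
qed

lemma rule_error_bound_zeroth_order:
  assumes s: "s \<in> {0..pi}"
  shows "\<exists>C\<ge>0. \<forall>r\<ge>1. \<forall>k. \<forall>N\<ge>1. \<forall>f. lift_in_sobolev r f \<longrightarrow>
    cmod (rule_error s k N f) \<le> C * real N powr (- r) * per_sobolev_norm r (cos_lift f)"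
proof -
  obtain B where B: "B \<ge> 0" "\<And>k N M. N \<ge> 1 \<Longrightarrow> error_energy s k N 1 M \<le> B\<^sup>2"
    using chebyshev_errors_square_summable[OF s] by blast
  have "cmod (rule_error s k N f) \<le> 2 * B * real N powr (- r) * per_sobolev_norm r (cos_lift f)"
    if "r \<ge> 1" "N \<ge> 1" "lift_in_sobolev r f" for r k N f
    using rule_error_bound_from_chebyshev[OF s that(2,1,1,3) B(1) B(2)[OF that(2)]] .
  then show ?thesis using B(1) by (intro exI[of _ "2 * B"]) auto
qed

lemma rule_error_bound_first_order:
  assumes s: "s \<in> {0..pi}"
  shows "\<exists>C\<ge>0. \<forall>r\<ge>1. \<forall>k\<ge>0. \<forall>N\<ge>1. \<forall>f. lift_in_sobolev r f \<longrightarrow>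
    cmod (rule_error s k N f) \<le> C * (1 + k) powr (- 1) * real N powr (1 - r) * per_sobolev_norm r (cos_lift f)"
proof -
  obtain C0 where C0: "C0 \<ge> 0" "\<And>r k N f. r \<ge> 1 \<Longrightarrow> N \<ge> 1 \<Longrightarrow> lift_in_sobolev r f \<Longrightarrow>
      cmod (rule_error s k N f) \<le> C0 * real N powr (- r) * per_sobolev_norm r (cos_lift f)"
    using rule_error_bound_zeroth_order[OF s] by blast
  obtain B where B: "B \<ge> 0" "\<And>k N M. k \<ge> 1 \<Longrightarrow> N \<ge> 1 \<Longrightarrow> error_energy s k N 1 M \<le> (B * real N / k)\<^sup>2"
    using chebyshev_errors_square_summable_first_order[OF s] by blast
  have "cmod (rule_error s k N f) \<le> 2 ^ 1 * (C0 + 2 * B) * (1 + k) powr (- 1) * real N powr (1 - r) * per_sobolev_norm r (cos_lift f)"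
    if r: "r \<ge> 1" and k: "k \<ge> 0" and N: "N \<ge> 1" and f: "lift_in_sobolev r f" for r k N f
  proof -
    define Y where "Y = real N powr (1 - r) * per_sobolev_norm r (cos_lift f)"
    have Y: "Y \<ge> 0" by (simp add: Y_def per_sobolev_norm_nonneg)
    have Nr: "real N powr (1 - r) = real N * real N powr (- r)"
      using N by (simp add: powr_diff powr_minus field_simps)
    have "cmod (rule_error s k N f) \<le> 2 ^ 1 * ((C0 + 2 * B) * Y) * (1 + k) powr (- real 1)"
    proof (rule frequency_decay_combine[OF k])
      show "0 \<le> (C0 + 2 * B) * Y" using C0(1) B(1) Y by simp
      assume k1: "k \<ge> 1"
      have "cmod (rule_error s k N f) \<le> 2 * (B * real N / k) * real N powr (- r) * per_sobolev_norm r (cos_lift f)"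
        using B(1) k1 by (intro rule_error_bound_from_chebyshev[OF s N r r f _ B(2)[OF k1 N]]) auto
      also have "\<dots> = 2 * B * Y / k ^ 1" by (simp add: Y_def Nr)
      also have "\<dots> \<le> (C0 + 2 * B) * Y / k ^ 1"
        using C0(1) Y k by (intro divide_right_mono mult_right_mono) auto
      finally show "cmod (rule_error s k N f) \<le> (C0 + 2 * B) * Y / k ^ 1" .
    next
      have "cmod (rule_error s k N f) \<le> C0 * (1 * real N powr (- r) * per_sobolev_norm r (cos_lift f))"
        using C0(2)[OF r N f, of k] by (simp add: mult.assoc)
      also have "\<dots> \<le> C0 * Y"
        unfolding Y_def Nr using C0(1) N
        by (intro mult_left_mono mult_right_mono per_sobolev_norm_nonneg) auto
      also have "\<dots> \<le> (C0 + 2 * B) * Y" using B(1) Y by (intro mult_right_mono) auto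
      finally show "cmod (rule_error s k N f) \<le> (C0 + 2 * B) * Y" .
    qed
    then show ?thesis by (simp only: Y_def mult_ac of_nat_1)
  qed
  then show ?thesis using C0(1) B(1) by (intro exI[of _ "2 ^ 1 * (C0 + 2 * B)"]) auto
qed

text \<open>
  At order \<open>7/2 + \<epsilon>\<close> the squared weights are \<open>n powr (-7 - 2 \<epsilon>)\<close>, so errors of the size of \<open>n\<^sup>3\<close> leave the
  convergent series of \<open>n powr (-1 - 2 \<epsilon>)\<close>.
\<close>
lemma rule_error_bound_second_order:
  assumes s: "s \<in> {0..pi}" and \<epsilon>: "\<epsilon> > 0"
    and decay: "\<exists>C\<ge>0. \<forall>k\<ge>1. k * cmod (log_moment s k) \<le> C * (1 + (cos s)\<^sup>2 * ln k)"
  shows "\<exists>C\<ge>0. \<forall>k\<ge>0. \<forall>r N f. N \<ge> 1 \<longrightarrow> (\<forall>n. alias_diff N n s = 0) \<longrightarrow> r > 7/2 + \<epsilon> \<longrightarrow> lift_in_sobolev r f \<longrightarrow>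
    cmod (rule_error s k N f) \<le> C * (1 + k) powr (- 2) * (1 + (cos s)\<^sup>2 * log_plus k) * real N powr (7/2 + \<epsilon> - r)
      * per_sobolev_norm r (cos_lift f)"
proof -
  obtain C0 where C0: "C0 \<ge> 0" "\<And>r k N f. r \<ge> 1 \<Longrightarrow> N \<ge> 1 \<Longrightarrow> lift_in_sobolev r f \<Longrightarrow>
      cmod (rule_error s k N f) \<le> C0 * real N powr (- r) * per_sobolev_norm r (cos_lift f)"
    using rule_error_bound_zeroth_order[OF s] by blast
  obtain D where D: "D \<ge> 0" "\<And>k N n. k \<ge> 1 \<Longrightarrow> N \<ge> 1 \<Longrightarrow> n > N \<Longrightarrow> alias_diff N n s = 0 \<Longrightarrow>
    k\<^sup>2 * cmod (cheb_error s k N n) \<le> D * real n ^ 3 * (1 + (cos s)\<^sup>2 * ln k)"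
    using chebyshev_error_second_order[OF s] decay by metis
  have zeta: "summable (\<lambda>n. real n powr (- (1 + 2 * \<epsilon>)))" by (subst summable_real_powr_iff) (use \<epsilon> in simp)
  define Z where "Z = (\<Sum>n. real n powr (- (1 + 2 * \<epsilon>)))"
  have Z: "(\<Sum>n\<in>A. real n powr (- (1 + 2 * \<epsilon>))) \<le> Z" if "finite A" for A
    unfolding Z_def by (rule sum_le_suminf[OF zeta that]) simp
  have Z0: "Z \<ge> 0" using Z[of "{}"] by simp
  define B where "B = D * sqrt Z"
  have B: "B \<ge> 0" using D(1) Z0 by (simp add: B_def)
  have "cmod (rule_error s k N f) \<le> 2\<^sup>2 * (C0 + 2 * B) * (1 + k) powr (- 2) * (1 + (cos s)\<^sup>2 * log_plus k)
      * real N powr (7/2 + \<epsilon> - r) * per_sobolev_norm r (cos_lift f)"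
    if k: "k \<ge> 0" and N: "N \<ge> 1" and zero: "\<And>n. alias_diff N n s = 0" and r: "r > 7/2 + \<epsilon>" and f: "lift_in_sobolev r f" for r k N f
  proof -
    have r1: "r \<ge> 1" "7/2 + \<epsilon> \<le> r" using r \<epsilon> by auto
    define X where "X = 1 + (cos s)\<^sup>2 * log_plus k"
    have X: "X \<ge> 1" by (simp add: X_def log_plus_def)
    define NN where "NN = real N powr (7/2 + \<epsilon>)"
    have NN: "NN \<ge> 1" unfolding NN_def using N \<epsilon> by (intro ge_one_powr_ge_zero) auto
    have Nr: "real N powr (7/2 + \<epsilon> - r) = NN * real N powr (- r)"
      unfolding NN_def by (simp only: powr_add[symmetric]) simp
    define Q where "Q = real N powr (- r) * per_sobolev_norm r (cos_lift f)"
    have Q: "Q \<ge> 0" by (simp add: Q_def per_sobolev_norm_nonneg)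
    have XN: "X * NN \<ge> 1" using mult_mono[OF X NN] X by simp
    have "cmod (rule_error s k N f) \<le> 2 ^ 2 * ((C0 + 2 * B) * (X * NN * Q)) * (1 + k) powr (- real 2)"
    proof (rule frequency_decay_combine[OF k])
      show "0 \<le> (C0 + 2 * B) * (X * NN * Q)" using C0(1) B X NN Q by simp
      assume k1: "k \<ge> 1"
      have Xk: "X = 1 + (cos s)\<^sup>2 * ln k" using k1 by (simp add: X_def log_plus_def)
      define Y where "Y = D * X / k\<^sup>2"
      have Y: "Y \<ge> 0" using D(1) X by (simp add: Y_def)
      have sum: "error_energy s k N (7/2 + \<epsilon>) M \<le> (NN * Y * sqrt Z)\<^sup>2" for M
      proof -
        have "error_energy s k N (7/2 + \<epsilon>) M
          \<le> (\<Sum>n\<in>{N<..<M}. (NN * Y)\<^sup>2 * real n powr (- (1 + 2 * \<epsilon>)))"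
        proof (rule sum_mono)
          fix n assume n: "n \<in> {N<..<M}"
          then have n0: "real n > 0" "n > N" by auto
          define e where "e = cmod (cheb_error s k N n)"
          have "k\<^sup>2 * e \<le> D * real n ^ 3 * X"
            unfolding e_def Xk by (rule D(2)[OF k1 N n0(2) zero])
          then have "e \<le> D * real n ^ 3 * X / k\<^sup>2" using k1 by (simp add: pos_le_divide_eq mult.commute)
          then have "e \<le> Y * real n ^ 3" by (simp add: Y_def mult_ac)
          then have "e\<^sup>2 \<le> (Y * real n ^ 3)\<^sup>2" by (rule power_mono) (simp add: e_def)
          then have "(real N / real n) powr (2 * (7/2 + \<epsilon>)) * e\<^sup>2 \<le> (real N / real n) powr (2 * (7/2 + \<epsilon>)) * (Y * real n ^ 3)\<^sup>2"
            by (rule mult_left_mono) simp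
          also have "\<dots> = (NN * Y)\<^sup>2 * real n powr (- (1 + 2 * \<epsilon>))"
          proof -
            have 1: "(real N / real n) powr (2 * (7/2 + \<epsilon>)) = NN\<^sup>2 * real n powr (- (2 * (7/2 + \<epsilon>)))"
              unfolding NN_def powr_square powr_divide powr_minus by (rule divide_inverse)
            have 2: "(Y * real n ^ 3)\<^sup>2 = Y\<^sup>2 * real n powr 6"
              using n0 by (simp add: power_mult_distrib flip: power_mult)
            have 3: "real n powr (- (2 * (7/2 + \<epsilon>))) * real n powr 6 = real n powr (- (1 + 2 * \<epsilon>))"
              unfolding powr_add[symmetric] by (rule arg_cong[of _ _ "\<lambda>x. real n powr x"]) simp
            show ?thesis unfolding 1 2 3[symmetric] by (simp add: power_mult_distrib)
          qed
          finally show "(real N / real n) powr (2 * (7/2 + \<epsilon>)) * (cmod (cheb_error s k N n))\<^sup>2 \<le>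
              (NN * Y)\<^sup>2 * real n powr (- (1 + 2 * \<epsilon>))" unfolding e_def .
        qed
        also have "\<dots> = (NN * Y)\<^sup>2 * (\<Sum>n\<in>{N<..<M}. real n powr (- (1 + 2 * \<epsilon>)))"
          by (simp only: sum_distrib_left)
        also have "\<dots> \<le> (NN * Y)\<^sup>2 * Z" by (intro mult_left_mono Z) auto
        also have "\<dots> = (NN * Y * sqrt Z)\<^sup>2" using Z0 by (simp add: power_mult_distrib)
        finally show ?thesis .
      qed
      have "cmod (rule_error s k N f) \<le> 2 * (NN * Y * sqrt Z) * real N powr (- r) * per_sobolev_norm r (cos_lift f)"
        using NN Y Z0 by (intro rule_error_bound_from_chebyshev[OF s N r1 f _ sum]) auto
      also have "\<dots> = 2 * B * (X * NN * Q) / k\<^sup>2"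
        by (simp add: B_def Y_def Q_def)
      also have "\<dots> \<le> (C0 + 2 * B) * (X * NN * Q) / k\<^sup>2"
        using C0(1) X NN Q by (intro divide_right_mono mult_right_mono) auto
      finally show "cmod (rule_error s k N f) \<le> (C0 + 2 * B) * (X * NN * Q) / k\<^sup>2" .
    next
      have "cmod (rule_error s k N f) \<le> C0 * (1 * Q)"
        using C0(2)[OF r1(1) N f, of k] by (simp add: Q_def mult.assoc)
      also have "\<dots> \<le> (C0 + 2 * B) * (X * NN * Q)"
        using C0(1) B Q by (intro mult_mono mult_right_mono XN) auto
      finally show "cmod (rule_error s k N f) \<le> (C0 + 2 * B) * (X * NN * Q)" .
    qed
    then show ?thesis by (simp only: Q_def X_def Nr mult_ac of_nat_numeral)
  qed
  then show ?thesis using C0(1) B by (intro exI[of _ "2\<^sup>2 * (C0 + 2 * B)"]) auto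
qed

text \<open>
  For \<open>s = \<pi> / 2\<close> the weight \<open>(cos s)\<^sup>2\<close> is 0, matching the absence of the logarithm in the interior
  decay; at the end points it is 1.
\<close>
lemma rule_error_bound_special_points:
  assumes \<epsilon>: "\<epsilon> > 0"
  shows "\<exists>C>0. \<forall>s\<in>{0, pi / 2, pi}. \<forall>k\<ge>0. \<forall>r N f. N \<ge> 1 \<longrightarrow> (\<forall>n. alias_diff N n s = 0) \<longrightarrow> r > 7/2 + \<epsilon> \<longrightarrow> lift_in_sobolev r f \<longrightarrow>
    cmod (rule_error s k N f) \<le> C * (1 + k) powr (- 2) * (1 + (cos s)\<^sup>2 * log_plus k) * real N powr (7/2 + \<epsilon> - r)
      * per_sobolev_norm r (cos_lift f)" (is "\<exists>C>0. \<forall>s\<in>_. ?bound C s")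
proof -
  have "\<exists>C\<ge>0. ?bound C s" if "s \<in> {0, pi / 2, pi}" for s
  proof (rule rule_error_bound_second_order[OF _ \<epsilon>])
    have "s = 0 \<or> s = pi / 2 \<or> s = pi" using that by simp
    then show sI: "s \<in> {0..pi}" by (elim disjE; hypsubst; simp)
    show "\<exists>C\<ge>0. \<forall>k\<ge>1. k * cmod (log_moment s k) \<le> C * (1 + (cos s)\<^sup>2 * ln k)"
    proof (cases "s = pi / 2")
      case True
      show ?thesis unfolding True using log_moment_decay_interior[of "pi / 2"] by simp
    next
      case False
      then have "(cos s)\<^sup>2 = 1" using that by auto
      then show ?thesis using log_moment_decay[OF sI] by simp
    qed
  qed
  then obtain C where C: "\<And>s. s \<in> {0, pi / 2, pi} \<Longrightarrow> C s \<ge> 0" "\<And>s. s \<in> {0, pi / 2, pi} \<Longrightarrow> ?bound (C s) s"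
    by metis
  define C1 where "C1 = 1 + C 0 + C (pi / 2) + C pi"
  have C1: "C s \<le> C1" if "s \<in> {0, pi / 2, pi}" for s
  proof -
    have "s = 0 \<or> s = pi / 2 \<or> s = pi" using that by simp
    then show ?thesis
      using C(1)[of 0] C(1)[of "pi / 2"] C(1)[of pi] unfolding C1_def by (elim disjE; hypsubst; simp)
  qed
  show ?thesis
  proof (intro exI[of _ C1] conjI ballI allI impI)
    show "C1 > 0" using C(1)[of 0] C(1)[of "pi / 2"] C(1)[of pi] unfolding C1_def by simp
    fix s k r :: real and N f
    assume s: "s \<in> {0, pi / 2, pi}" and h: "0 \<le> k" "1 \<le> N" "\<forall>n. alias_diff N n s = 0" "7/2 + \<epsilon> < r" "lift_in_sobolev r f"
    have "cmod (rule_error s k N f) \<le> C s * (1 + k) powr (- 2) * (1 + (cos s)\<^sup>2 * log_plus k) * real N powr (7/2 + \<epsilon> - r)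
      * per_sobolev_norm r (cos_lift f)" using C(2)[OF s] h by blast
    also have "\<dots> \<le> C1 * (1 + k) powr (- 2) * (1 + (cos s)\<^sup>2 * log_plus k) * real N powr (7/2 + \<epsilon> - r)
      * per_sobolev_norm r (cos_lift f)"
      using C1[OF s] by (intro mult_right_mono per_sobolev_norm_nonneg) (auto simp: log_plus_def)
    finally show "cmod (rule_error s k N f) \<le> C1 * (1 + k) powr (- 2) * (1 + (cos s)\<^sup>2 * log_plus k) * real N powr (7/2 + \<epsilon> - r)
      * per_sobolev_norm r (cos_lift f)" .
  qed
qed

theorem theorem2p4:
  "(\<forall>\<alpha>\<in>{-1..1::real}. \<exists>C>0. \<forall>\<delta>\<in>{0, 1::real}. \<forall>r\<ge>1. \<forall>k\<ge>0. \<forall>N\<ge>1. \<forall>f.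
      lift_in_sobolev r f \<longrightarrow>
      cmod (log_osc_integral \<alpha> k f - log_osc_rule \<alpha> k N f)
        \<le> C * (1 + k) powr (- \<delta>) * real N powr (\<delta> - r) * per_sobolev_norm r (cos_lift f)) \<and>
   (\<forall>\<epsilon>>0. \<exists>C>0. \<forall>\<alpha> k r. \<forall>N\<ge>1. \<forall>f.
      k \<ge> 0 \<longrightarrow> \<alpha> = 1 \<or> \<alpha> = -1 \<or> (\<alpha> = 0 \<and> even N) \<longrightarrow>
      r > 7/2 + \<epsilon> \<longrightarrow> lift_in_sobolev r f \<longrightarrow>
      cmod (log_osc_integral \<alpha> k f - log_osc_rule \<alpha> k N f)
        \<le> C * (1 + k) powr (-2) * (1 + \<alpha>\<^sup>2 * log_plus k) * real N powr (7/2 + \<epsilon> - r)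
            * per_sobolev_norm r (cos_lift f))"
proof (intro conjI ballI allI impI)
  fix \<alpha> :: real assume \<alpha>: "\<alpha> \<in> {-1..1}"
  define s where "s = arccos \<alpha>"
  have s: "s \<in> {0..pi}" "cos s = \<alpha>" using \<alpha> by (auto simp: s_def arccos_lbound arccos_ubound)
  obtain C0 where C0: "C0 \<ge> 0" "\<And>r k N f. r \<ge> 1 \<Longrightarrow> N \<ge> 1 \<Longrightarrow> lift_in_sobolev r f \<Longrightarrow>
      cmod (rule_error s k N f) \<le> C0 * real N powr (- r) * per_sobolev_norm r (cos_lift f)"
    using rule_error_bound_zeroth_order[OF s(1)] by blast
  obtain C1 where C1: "C1 \<ge> 0" "\<And>r k N f. r \<ge> 1 \<Longrightarrow> k \<ge> 0 \<Longrightarrow> N \<ge> 1 \<Longrightarrow> lift_in_sobolev r f \<Longrightarrow>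
      cmod (rule_error s k N f) \<le> C1 * (1 + k) powr (- 1) * real N powr (1 - r) * per_sobolev_norm r (cos_lift f)"
    using rule_error_bound_first_order[OF s(1)] by blast
  show "\<exists>C>0. \<forall>\<delta>\<in>{0, 1::real}. \<forall>r\<ge>1. \<forall>k\<ge>0. \<forall>N\<ge>1. \<forall>f. lift_in_sobolev r f \<longrightarrow>
      cmod (log_osc_integral \<alpha> k f - log_osc_rule \<alpha> k N f)
        \<le> C * (1 + k) powr (- \<delta>) * real N powr (\<delta> - r) * per_sobolev_norm r (cos_lift f)"
  proof (intro exI[of _ "C0 + C1 + 1"] conjI ballI allI impI)
    show "0 < C0 + C1 + 1" using C0(1) C1(1) by simp
    fix \<delta> r k :: real and N :: nat and f
    assume h: "\<delta> \<in> {0, 1}" "1 \<le> r" "0 \<le> k" "1 \<le> N" "lift_in_sobolev r f"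
    define C where "C = (if \<delta> = 0 then C0 else C1)"
    have "cmod (log_osc_integral \<alpha> k f - log_osc_rule \<alpha> k N f) \<le>
        C * (1 + k) powr (- \<delta>) * real N powr (\<delta> - r) * per_sobolev_norm r (cos_lift f)"
      using C0(2)[OF h(2,4,5), of k] C1(2)[OF h(2-5)] h(1,3)
      unfolding rule_error_def s(2) by (auto simp: C_def)
    also have "\<dots> \<le> (C0 + C1 + 1) * (1 + k) powr (- \<delta>) * real N powr (\<delta> - r) * per_sobolev_norm r (cos_lift f)"
      using C0(1) C1(1) by (intro mult_right_mono per_sobolev_norm_nonneg) (auto simp: C_def)
    finally show "cmod (log_osc_integral \<alpha> k f - log_osc_rule \<alpha> k N f) \<le>
        (C0 + C1 + 1) * (1 + k) powr (- \<delta>) * real N powr (\<delta> - r) * per_sobolev_norm r (cos_lift f)" .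
  qed
next
  fix \<epsilon> :: real assume "\<epsilon> > 0"
  from rule_error_bound_special_points[OF this] obtain C where C: "C > 0"
    "\<And>s k r N f. s \<in> {0, pi / 2, pi} \<Longrightarrow> k \<ge> 0 \<Longrightarrow> N \<ge> 1 \<Longrightarrow> (\<forall>n. alias_diff N n s = 0) \<Longrightarrow> r > 7/2 + \<epsilon> \<Longrightarrow> lift_in_sobolev r f \<Longrightarrow>
    cmod (rule_error s k N f) \<le> C * (1 + k) powr (- 2) * (1 + (cos s)\<^sup>2 * log_plus k) * real N powr (7/2 + \<epsilon> - r)
      * per_sobolev_norm r (cos_lift f)"
    by blast
  show "\<exists>C>0. \<forall>\<alpha> k r. \<forall>N\<ge>1. \<forall>f.
      k \<ge> 0 \<longrightarrow> \<alpha> = 1 \<or> \<alpha> = -1 \<or> (\<alpha> = 0 \<and> even N) \<longrightarrow>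
      r > 7/2 + \<epsilon> \<longrightarrow> lift_in_sobolev r f \<longrightarrow>
      cmod (log_osc_integral \<alpha> k f - log_osc_rule \<alpha> k N f)
        \<le> C * (1 + k) powr (-2) * (1 + \<alpha>\<^sup>2 * log_plus k) * real N powr (7/2 + \<epsilon> - r)
            * per_sobolev_norm r (cos_lift f)"
  proof (intro exI[of _ C] conjI allI impI C(1))
    fix \<alpha> k r :: real and N :: nat and f
    assume N: "1 \<le> N" and k: "0 \<le> k" and \<alpha>: "\<alpha> = 1 \<or> \<alpha> = -1 \<or> (\<alpha> = 0 \<and> even N)"
      and r: "7/2 + \<epsilon> < r" and f: "lift_in_sobolev r f"
    \<comment> \<open>The singularity is a node in each case: \<open>cos 0\<close>, \<open>cos \<pi>\<close>, or the middle node for even \<open>N\<close>.\<close>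
    obtain s where s: "s \<in> {0, pi / 2, pi}" "cos s = \<alpha>" "\<forall>n. alias_diff N n s = 0"
    proof -
      consider "\<alpha> = 1" | "\<alpha> = -1" | "\<alpha> = 0" "even N" using \<alpha> by blast
      then show ?thesis
      proof cases
        case 1 then show ?thesis using that[of 0] by simp
      next
        case 2 then show ?thesis using that[of pi] alias_diff_pi[OF N] by simp
      next
        case 3
        then obtain j where j: "N = 2 * j" by (elim evenE)
        then have "real j * pi / real N = pi / 2" using N by simp
        then have "alias_diff N n (pi / 2) = 0" for n using alias_diff_node[OF N, of n j] by (simp only:)
        then show ?thesis using that[of "pi / 2"] 3 by simp
      qed
    qed
    show "cmod (log_osc_integral \<alpha> k f - log_osc_rule \<alpha> k N f)
        \<le> C * (1 + k) powr (-2) * (1 + \<alpha>\<^sup>2 * log_plus k) * real N powr (7/2 + \<epsilon> - r)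
            * per_sobolev_norm r (cos_lift f)"
      using C(2)[OF s(1) k N s(3) r f] unfolding rule_error_def s(2) .
  qed
qed

end
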